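(* Let $G$ be an $\infty$-spanned Coxeter group which is not a free product $C_2 * \ldots * C_2$ of copies of the group $C_2$ of order two. Then $\frac{g_k}{w_k} \sim \nu \cdot \delta(G)^k$ as $k\rightarrow \infty$, where $\nu = \nu(G) > 0$ is a positive constant and $\delta(G) = \frac{\gamma(G)}{\omega(G)} > 1$. In particular, $\gamma(G)>\omega(G)$.
   Context: A Coxeter group $G$ of rank $n$ is a group given by a presentation $G = \langle s_1, \dots, s_n \mid s_i^2 = 1,\ (s_i s_j)^{m_{ij}} = 1,\ 1\le i<j\le n\rangle$ with $m_{ij}=m_{ji}\in\{2,3,\dots\}\cup\{\infty\}$ for $i\neq j$, where $m_{ij}=\infty$ means that there is no relation between $s_i$ and $s_j$. The set $S=\{s_1,\dots,s_n\}$ is its standard generating set; $G$ is always considered with this fixed presentation and generating set. The Coxeter diagram $\mathcal{D}$ of $G$ is the labelled graph with vertices $1,\dots,n$, where $i$ and $j$ are joined by an edge if and only if $m_{ij}\ge 3$; the edge carries the label $m_{ij}$ if $m_{ij}\geq 4$ (possibly $\infty$) and is unlabelled if $m_{ij}=3$. The group $G$ (and its diagram) is called $\infty$-spanned if $\mathcal{D}$ has more than $2$ vertices and has a spanning tree all of whose edges are labelled $\infty$. The word length of $g\in G$ is the least length of a word in the alphabet $S$ representing $g$. For $k\ge 0$, $w_k$ is the number of elements of $G$ of word length $k$, and $g_k$ is the number of geodesic paths of length $k$ in the Cayley graph $\mathrm{Cay}(G,S)$ starting at the identity $e$ (equivalently, the number of words of length $k$ over $S$ that represent an element of word length exactly $k$);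 $w_0=g_0=1$. The word growth rate is $\omega(G)=\limsup_{k\to\infty}\sqrt[k]{w_k}$ and the geodesic growth rate is $\gamma(G)=\limsup_{k\to\infty}\sqrt[k]{g_k}$. For two sequences of positive real numbers, $a_k\sim b_k$ means $\lim_{k\to\infty} a_k/b_k=1$. *)

theory Defs
  imports
    "HOL-Library.Extended_Nat"
    "HOL-Library.Extended_Real"
    "HOL-Library.Landau_Symbols"
    "HOL-Algebra.Elementary_Groups"
begin

section \<open>Groups given by generators and relations\<close>

text \<open>The smallest congruence on the free monoid of words over the alphabet \<open>A\<close> that
  identifies \<open>l\<close> with \<open>r\<close> for every pair \<open>(l, r)\<close> in \<open>R\<close>.\<close>

inductive_set word_cong :: "'a set \<Rightarrow> ('a list \<times> 'a list) set \<Rightarrow> ('a list \<times> 'a list) set"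
  for A :: "'a set" and R :: "('a list \<times> 'a list) set" where
  base: "(l, r) \<in> R \<Longrightarrow> u @ l @ v \<in> lists A \<Longrightarrow> u @ r @ v \<in> lists A
    \<Longrightarrow> (u @ l @ v, u @ r @ v) \<in> word_cong A R"
| refl: "w \<in> lists A \<Longrightarrow> (w, w) \<in> word_cong A R"
| sym: "(v, w) \<in> word_cong A R \<Longrightarrow> (w, v) \<in> word_cong A R"
| trans: "(u, v) \<in> word_cong A R \<Longrightarrow> (v, w) \<in> word_cong A R \<Longrightarrow> (u, w) \<in> word_cong A R"

definition word_quotient :: "'a set \<Rightarrow> ('a list \<times> 'a list) set \<Rightarrow> 'a list set monoid" where
  "word_quotient A R =
    \<lparr>carrier = lists A // word_cong A R,
     monoid.mult = (\<lambda>X Y. \<Union>u\<in>X. \<Union>v\<in>Y. word_cong A R `` {u @ v}),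
     one = word_cong A R `` {[]}\<rparr>"

text \<open>The group \<open>\<langle>X | Q\<rangle>\<close>. The letters \<open>(x, True)\<close> and \<open>(x, False)\<close> stand for \<open>x\<close> and its formal
  inverse; \<open>Q\<close> is a set of relators, i.e. of words in these letters that are set equal to 1.\<close>

definition group_presentation :: "'x set \<Rightarrow> ('x \<times> bool) list set \<Rightarrow> ('x \<times> bool) list set monoid" where
  "group_presentation X Q = word_quotient (X \<times> UNIV)
    ({([(x, b), (x, \<not> b)], []) | x b. x \<in> X} \<union> {(q, []) | q. q \<in> Q})"

text \<open>The free product of the groups \<open>H i\<close> for \<open>i\<close> in \<open>I\<close>: words over the disjoint union of the
  factors, modulo deleting identity elements and multiplying adjacent letters of one factor.\<close>

definition free_product :: "'i set \<Rightarrow> ('i \<Rightarrow> 'a monoid) \<Rightarrow> ('i \<times> 'a) list set monoid" where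
  "free_product I H = word_quotient (SIGMA i:I. carrier (H i))
    ({([(i, \<one>\<^bsub>H i\<^esub>)], []) | i. i \<in> I} \<union>
     {([(i, x), (i, y)], [(i, x \<otimes>\<^bsub>H i\<^esub> y)]) | i x y. i \<in> I \<and> x \<in> carrier (H i) \<and> y \<in> carrier (H i)})"


section \<open>Coxeter groups and their diagrams\<close>

text \<open>Only the values \<open>m i j\<close> with distinct \<open>i\<close>, \<open>j\<close> in \<open>{1..n}\<close> matter.\<close>

definition coxeter_matrix :: "nat \<Rightarrow> (nat \<Rightarrow> nat \<Rightarrow> enat) \<Rightarrow> bool" where
  "coxeter_matrix n m \<longleftrightarrow>
    (\<forall>i\<in>{1..n}. \<forall>j\<in>{1..n}. i \<noteq> j \<longrightarrow> m i j = m j i \<and> m i j \<ge> 2)"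

definition coxeter_relators :: "nat \<Rightarrow> (nat \<Rightarrow> nat \<Rightarrow> enat) \<Rightarrow> (nat \<times> bool) list set" where
  "coxeter_relators n m =
    {[(i, True), (i, True)] | i. i \<in> {1..n}} \<union>
    {concat (replicate k [(i, True), (j, True)]) | i j k. 1 \<le> i \<and> i < j \<and> j \<le> n \<and> m i j = enat k}"

definition coxeter_group :: "nat \<Rightarrow> (nat \<Rightarrow> nat \<Rightarrow> enat) \<Rightarrow> (nat \<times> bool) list set monoid" where
  "coxeter_group n m = group_presentation {1..n} (coxeter_relators n m)"

definition coxeter_generators :: "nat \<Rightarrow> (nat \<Rightarrow> nat \<Rightarrow> enat) \<Rightarrow> (nat \<times> bool) list set set" where
  "coxeter_generators n m =
    {X \<in> carrier (coxeter_group n m). \<exists>i\<in>{1..n}. [(i, True)] \<in> X}"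

definition diagram_edges :: "nat \<Rightarrow> (nat \<Rightarrow> nat \<Rightarrow> enat) \<Rightarrow> nat set set" where
  "diagram_edges n m = {{i, j} | i j. i \<in> {1..n} \<and> j \<in> {1..n} \<and> i \<noteq> j \<and> m i j \<ge> 3}"

text \<open>Undirected trees with edges given as two-element sets of vertices. The trees of the AFP
  entry Graph_Theory are unsuitable here: they only exclude directed cycles.\<close>

definition is_cycle :: "'v set set \<Rightarrow> 'v list \<Rightarrow> bool" where
  "is_cycle E vs \<longleftrightarrow> length vs \<ge> 3 \<and> distinct vs \<and>
    (\<forall>i. Suc i < length vs \<longrightarrow> {vs ! i, vs ! Suc i} \<in> E) \<and> {last vs, hd vs} \<in> E"

definition is_tree :: "'v set \<Rightarrow> 'v set set \<Rightarrow> bool" where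
  "is_tree V E \<longleftrightarrow> V \<noteq> {} \<and> (\<forall>e\<in>E. e \<subseteq> V \<and> card e = 2) \<and>
    (\<forall>u\<in>V. \<forall>v\<in>V. (u, v) \<in> {(x, y). {x, y} \<in> E}\<^sup>*) \<and> (\<nexists>vs. is_cycle E vs)"

definition infinity_spanned :: "nat \<Rightarrow> (nat \<Rightarrow> nat \<Rightarrow> enat) \<Rightarrow> bool" where
  "infinity_spanned n m \<longleftrightarrow> n > 2 \<and>
    (\<exists>T \<subseteq> diagram_edges n m. is_tree {1..n} T \<and> (\<forall>i j. {i, j} \<in> T \<longrightarrow> m i j = \<infinity>))"


section \<open>Word growth and geodesic growth\<close>

text \<open>The generating sets below consist of involutions, so words need no inverse letters.\<close>

definition word_value :: "('g, 'b) monoid_scheme \<Rightarrow> 'g list \<Rightarrow> 'g" where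
  "word_value G ws = foldr (\<otimes>\<^bsub>G\<^esub>) ws \<one>\<^bsub>G\<^esub>"

definition word_length :: "('g, 'b) monoid_scheme \<Rightarrow> 'g set \<Rightarrow> 'g \<Rightarrow> nat" where
  "word_length G S g = (LEAST k. \<exists>ws\<in>lists S. length ws = k \<and> word_value G ws = g)"

definition word_count :: "('g, 'b) monoid_scheme \<Rightarrow> 'g set \<Rightarrow> nat \<Rightarrow> nat" where
  "word_count G S k = card {g \<in> carrier G. word_length G S g = k}"

definition geodesic_count :: "('g, 'b) monoid_scheme \<Rightarrow> 'g set \<Rightarrow> nat \<Rightarrow> nat" where
  "geodesic_count G S k =
    card {ws \<in> lists S. length ws = k \<and> word_length G S (word_value G ws) = k}"

text \<open>The superior limit is taken in \<open>ereal\<close>, a complete lattice. It is finite for the sequences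
  above when \<open>S\<close> is finite, both counts being at most \<open>card S ^ k\<close>.\<close>

definition growth_rate :: "(nat \<Rightarrow> nat) \<Rightarrow> real" where
  "growth_rate a = real_of_ereal (limsup (\<lambda>k. ereal (root k (real (a k)))))"

definition word_growth_rate :: "('g, 'b) monoid_scheme \<Rightarrow> 'g set \<Rightarrow> real" where
  "word_growth_rate G S = growth_rate (word_count G S)"

definition geodesic_growth_rate :: "('g, 'b) monoid_scheme \<Rightarrow> 'g set \<Rightarrow> real" where
  "geodesic_growth_rate G S = growth_rate (geodesic_count G S)"

end

theory Submission
  imports Defs
begin

text \<open>
  Both counting sequences are growth functions of factor-closed languages: the geodesic words
  and the ShortLex normal forms. In each of them a walk \<open>p\<close> along edges labelled \<open>\<infinity>\<close> that visits
  every vertex is synchronizing, because a wall crossed before \<open>p\<close> and again after \<open>p\<close> would give a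
  positive root which, read along \<open>p\<close>, must lose every generator from its support. Moreover every
  word can be continued by any sufficiently long, prescribed number of letters to end in \<open>p\<close>; a
  detour of odd length around a vertex of degree at least two removes the parity obstruction.
  Hence the ratio of the numbers of extensions of a word by \<open>k + 1\<close> and by \<open>k\<close> letters is a
  weighted average in which the common value at \<open>p\<close> has weight bounded below; its oscillation
  decays exponentially in \<open>k\<close>, so the counts are asymptotic to \<open>c * \<rho> ^ k\<close>. A finite label gives a
  geodesic word that is not in normal form; every geodesic can be continued through it, which
  makes the ShortLex growth strictly smaller.
\<close>

section \<open>Growth of languages with a synchronizing word\<close>

text \<open>The average contracts only if a fixed share of all extensions runs through
  \<open>p\<close>. Synchronization and return to \<open>p\<close> do not give this: a priori other
  words might have far more extensions than \<open>p\<close>. The missing comparison comes from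
  gluing \<open>p\<close> and a bridging walk in front of an arbitrary word of the language. For
  geodesics this is harmless, but a ShortLex word need not stay in normal form behind such a prefix;
  so bridge and word are normalized together, and it must be shown that \<open>p\<close> can precede
  the result although the bridge may have been rewritten (\<open>Lang_walk_left\<close>). No
  automaton for either language is constructed. All root arguments turn on the number 2. An edge
  labelled \<infinity> has coefficient \<open>cof = 2\<close> and nonzero coordinates of positive
  roots are at least 1, so reading a letter outside the support with an \<infinity>-neighbour inside
  it adds at least 2. On the other hand two positive roots made negative by the same element never
  have product \<open>bil\<close> at most \<open>- 2\<close>, and this keeps every coefficient met
  along a reduced word below 2.\<close>

definition ext_count :: "'a list set \<Rightarrow> 'a list \<Rightarrow> nat \<Rightarrow> nat" where
  "ext_count L u k = card {v. length v = k \<and> u @ v \<in> L}"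

locale factor_language =
  fixes A :: "'a set" and L :: "'a list set"
  assumes finite_alphabet: "finite A"
    and sub_lists: "L \<subseteq> lists A"
    and empty_in: "[] \<in> L"
    and prefix_closed: "u @ v \<in> L \<Longrightarrow> u \<in> L"
    and suffix_closed: "u @ v \<in> L \<Longrightarrow> v \<in> L"
begin

lemma finite_ext: "finite {v. length v = k \<and> u @ v \<in> L}"
proof (rule finite_subset)
  show "{v. length v = k \<and> u @ v \<in> L} \<subseteq> {v. set v \<subseteq> A \<and> length v = k}"
    using sub_lists by auto
qed (simp add: finite_lists_length_eq finite_alphabet)

lemma ext_count_add:
  "ext_count L u (a + b) = (\<Sum>v | length v = a \<and> u @ v \<in> L. ext_count L (u @ v) b)"
proof -
  let ?S = "SIGMA v:{v. length v = a \<and> u @ v \<in> L}. {w. length w = b \<and> (u @ v) @ w \<in> L}"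
  have "bij_betw (\<lambda>(v, w). v @ w) ?S {v. length v = a + b \<and> u @ v \<in> L}"
  proof (rule bij_betw_imageI)
    show "inj_on (\<lambda>(v, w). v @ w) ?S"
      by (auto simp: inj_on_def)
    show "(\<lambda>(v, w). v @ w) ` ?S = {v. length v = a + b \<and> u @ v \<in> L}"
    proof (intro equalityI subsetI)
      fix x assume x: "x \<in> {v. length v = a + b \<and> u @ v \<in> L}"
      have "(take a x, drop a x) \<in> ?S"
        using x prefix_closed[of "u @ take a x" "drop a x"] by auto
      then show "x \<in> (\<lambda>(v, w). v @ w) ` ?S"
        by (metis (mono_tags, lifting) append_take_drop_id case_prod_conv image_eqI)
    qed auto
  qed
  then have "ext_count L u (a + b) = card ?S"
    unfolding ext_count_def by (simp add: bij_betw_same_card)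
  also have "\<dots> = (\<Sum>v | length v = a \<and> u @ v \<in> L. ext_count L (u @ v) b)"
    unfolding ext_count_def by (intro card_SigmaI finite_ext ballI)
  finally show ?thesis .
qed

lemma ext_count_le_total: "ext_count L u k \<le> ext_count L [] k"
  unfolding ext_count_def
  by (rule card_mono) (use finite_ext[of k "[]"] suffix_closed in auto)

lemma ext_count_le_pow: "ext_count L u k \<le> card A ^ k"
proof -
  have "ext_count L u k \<le> card {v. set v \<subseteq> A \<and> length v = k}"
    unfolding ext_count_def
    by (rule card_mono) (use sub_lists in \<open>auto simp: finite_lists_length_eq finite_alphabet\<close>)
  then show ?thesis by (simp add: card_lists_length_eq finite_alphabet)
qed

lemma ext_count_add_le: "ext_count L u (k + j) \<le> card A ^ j * ext_count L u k"
proof -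
  have "ext_count L u (k + j) \<le> (\<Sum>v | length v = k \<and> u @ v \<in> L. card A ^ j)"
    unfolding ext_count_add by (rule sum_mono) (rule ext_count_le_pow)
  then show ?thesis by (simp add: ext_count_def mult.commute)
qed

end

text \<open>\<open>reach\<close> prescribes one length \<open>K\<close> for all words, so that every
  average over extensions of length \<open>K + length p\<close> contains one ending in
  \<open>p\<close>. \<open>dominated\<close> is independent of the other conditions: for the words
  over 0 and 1 followed by a power of 2, with \<open>p = [2]\<close>, synchronization and return
  hold, but only one extension of each length follows \<open>p\<close>.\<close>

locale sync_language = factor_language A L
  for A :: "'a set" and L :: "'a list set" +
  fixes p :: "'a list" and K :: nat and C :: real
  assumes p_nonempty: "p \<noteq> []"
    and sync: "u @ p \<in> L \<Longrightarrow> p @ v \<in> L \<Longrightarrow> u @ p @ v \<in> L"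
    and reach: "u \<in> L \<Longrightarrow> \<exists>x. length x = K \<and> u @ x @ p \<in> L"
    and dominated: "real (ext_count L [] k) \<le> C * real (ext_count L p k)"
begin

lemma long_extension:
  assumes "u \<in> L"
  shows "\<exists>v. length v \<ge> j \<and> u @ v \<in> L"
proof (induction j)
  case 0
  then show ?case using assms by (intro exI[of _ "[]"]) simp
next
  case (Suc j)
  then obtain v where v: "length v \<ge> j" "u @ v \<in> L" by blast
  obtain x where "(u @ v) @ x @ p \<in> L" using reach[OF v(2)] by blast
  then show ?case using v p_nonempty
    by (intro exI[of _ "v @ x @ p"]) (cases p, auto)
qed

lemma ext_count_ge_1:
  assumes "u \<in> L"
  shows "ext_count L u k \<ge> 1"
proof -
  obtain v where "length v \<ge> k" "u @ v \<in> L" using long_extension[OF assms] by blast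
  then have "take k v \<in> {v. length v = k \<and> u @ v \<in> L}"
    using prefix_closed[of "u @ take k v" "drop k v"] by simp
  then show ?thesis unfolding ext_count_def using finite_ext[of k u]
    by (metis One_nat_def Suc_leI card_gt_0_iff empty_iff)
qed

lemma ext_count_mono_step: "ext_count L u k \<le> ext_count L u (Suc k)"
proof -
  have "ext_count L u k = (\<Sum>v | length v = k \<and> u @ v \<in> L. 1)"
    by (simp add: ext_count_def)
  also have "\<dots> \<le> ext_count L u (k + 1)"
    unfolding ext_count_add using ext_count_ge_1 by (intro sum_mono) auto
  finally show ?thesis by simp
qed

lemma ext_count_sync:
  assumes "u @ p \<in> L"
  shows "ext_count L (u @ p) k = ext_count L p k"
proof -
  have "{v. length v = k \<and> (u @ p) @ v \<in> L} = {v. length v = k \<and> p @ v \<in> L}"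
    using sync[OF assms] suffix_closed[of u] by auto
  then show ?thesis by (simp add: ext_count_def)
qed

text \<open>A lower bound for the share of the extensions through \<open>p\<close>. The factor 2
  keeps \<open>1 - weight_bound\<close> positive, so that it can be divided by and has a positive
  root.\<close>

definition weight_bound :: real where "weight_bound = 1 / (2 * (max 1 C) * real (card A) ^ (K + length p))"

lemma card_A_pos: "card A \<ge> 1"
  using ext_count_ge_1[OF empty_in, of 1] ext_count_le_pow[of "[]" 1] by simp

lemma weight_bound_bounds: "0 < weight_bound" "weight_bound \<le> 1 / 2"
proof -
  have 1: "real (card A) ^ (K + length p) \<ge> 1" using card_A_pos by simp
  have "max 1 C * real (card A) ^ (K + length p) \<ge> 1 * 1"
    by (rule mult_mono) (use 1 in auto)
  then show "0 < weight_bound" "weight_bound \<le> 1 / 2" unfolding weight_bound_def by (auto simp: field_simps)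
qed

lemma p_weight: "weight_bound * real (ext_count L u (k + (K + length p))) \<le> real (ext_count L p k)"
proof -
  let ?a = "real (card A) ^ (K + length p)"
  have a: "?a > 0" using card_A_pos by simp
  have "real (ext_count L u (k + (K + length p))) \<le> ?a * real (ext_count L u k)"
    using ext_count_add_le[of u k "K + length p"]
    by (metis of_nat_le_iff of_nat_mult of_nat_power)
  also have "\<dots> \<le> ?a * real (ext_count L [] k)"
    using ext_count_le_total[of u k] a by simp
  also have "\<dots> \<le> ?a * (max 1 C * real (ext_count L p k))"
  proof -
    have "C * real (ext_count L p k) \<le> max 1 C * real (ext_count L p k)"
      by (intro mult_right_mono) auto
    then show ?thesis using dominated[of k] a by (intro mult_left_mono) auto
  qed
  also have "\<dots> \<le> 2 * \<dots>" using a by simp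
  finally show ?thesis unfolding weight_bound_def using a by (simp add: field_simps)
qed

section \<open>Contraction of the ratios of consecutive extension counts\<close>

definition ratio :: "'a list \<Rightarrow> nat \<Rightarrow> real" where
  "ratio u k = real (ext_count L u (Suc k)) / real (ext_count L u k)"

lemma ratio_mult: "u \<in> L \<Longrightarrow> ratio u k * real (ext_count L u k) = real (ext_count L u (Suc k))"
  using ext_count_ge_1[of u k] by (simp add: ratio_def)

text \<open>Splitting off the first \<open>j\<close> letters turns numerator and denominator of
  \<open>ratio u (k + j)\<close> into sums over the same \<open>v\<close>, so the ratio is the
  average of the \<open>ratio (u @ v) k\<close> with weights
  \<open>ext_count L (u @ v) k\<close>.\<close>

lemma ratio_average:
  assumes "u \<in> L"
  shows "ratio u (k + j) * real (ext_count L u (k + j))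
    = (\<Sum>v | length v = j \<and> u @ v \<in> L. ratio (u @ v) k * real (ext_count L (u @ v) k))"
proof -
  have "ratio u (k + j) * real (ext_count L u (k + j)) = real (ext_count L u (j + Suc k))"
    using ratio_mult[OF assms, of "k + j"] by (simp add: add.commute)
  also have "\<dots> = (\<Sum>v | length v = j \<and> u @ v \<in> L. real (ext_count L (u @ v) (Suc k)))"
    unfolding ext_count_add by simp
  also have "\<dots> = (\<Sum>v | length v = j \<and> u @ v \<in> L. ratio (u @ v) k * real (ext_count L (u @ v) k))"
    by (rule sum.cong) (use ratio_mult in auto)
  finally show ?thesis .
qed

lemma ratio_ge_1: "u \<in> L \<Longrightarrow> ratio u k \<ge> 1"
  using ext_count_ge_1[of u k] ext_count_mono_step[of u k] by (simp add: ratio_def)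

lemma ratio_le: "u \<in> L \<Longrightarrow> ratio u k \<le> real (card A)"
proof -
  assume u: "u \<in> L"
  have "real (ext_count L u (k + 1)) \<le> real (card A ^ 1 * ext_count L u k)"
    using ext_count_add_le[of u k 1] of_nat_le_iff by blast
  then show "ratio u k \<le> real (card A)"
    using ext_count_ge_1[OF u, of k] by (simp add: ratio_def field_simps)
qed

lemma ratio_propagate:
  assumes "\<And>u. u \<in> L \<Longrightarrow> a \<le> ratio u k \<and> ratio u k \<le> b" and "u \<in> L"
  shows "a \<le> ratio u (k + j) \<and> ratio u (k + j) \<le> b"
proof -
  let ?X = "{v. length v = j \<and> u @ v \<in> L}"
  let ?w = "\<lambda>v. real (ext_count L (u @ v) k)"
  have tot: "real (ext_count L u (k + j)) = sum ?w ?X"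
    using ext_count_add[of u j k] by (simp add: add.commute)
  have pos: "real (ext_count L u (k + j)) > 0"
    using ext_count_ge_1[OF assms(2), of "k + j"] by simp
  have "a * sum ?w ?X \<le> (\<Sum>v\<in>?X. ratio (u @ v) k * ?w v)"
    unfolding sum_distrib_left using assms(1) by (intro sum_mono mult_right_mono) auto
  moreover have "(\<Sum>v\<in>?X. ratio (u @ v) k * ?w v) \<le> b * sum ?w ?X"
    unfolding sum_distrib_left using assms(1) by (intro sum_mono mult_right_mono) auto
  ultimately show ?thesis
    using ratio_average[OF assms(2), of k j] mult_le_cancel_right_pos[OF pos]
    unfolding tot[symmetric] by metis
qed

lemma p_in: "p \<in> L"
  using reach[OF empty_in] suffix_closed by auto

lemma ratio_contract:
  assumes bnd: "\<And>u. u \<in> L \<Longrightarrow> a \<le> ratio u k \<and> ratio u k \<le> b" and u: "u \<in> L"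
  shows "a + weight_bound * (ratio p k - a) \<le> ratio u (k + (K + length p))"
    and "ratio u (k + (K + length p)) \<le> b - weight_bound * (b - ratio p k)"
proof -
  let ?j = "K + length p"
  let ?X = "{v. length v = ?j \<and> u @ v \<in> L}"
  let ?w = "\<lambda>v. real (ext_count L (u @ v) k)"
  let ?N = "real (ext_count L u (k + ?j))"
  obtain x where x: "length x = K" "u @ x @ p \<in> L" using reach[OF u] by blast
  let ?v = "x @ p"
  have v: "?v \<in> ?X" using x by simp
  have wv: "?w ?v = real (ext_count L p k)"
    using ext_count_sync[of "u @ x"] x by simp
  have rv: "ratio (u @ ?v) k = ratio p k"
    using ext_count_sync[of "u @ x"] x by (simp add: ratio_def)
  have tot: "?N = sum ?w ?X"
    using ext_count_add[of u ?j k] by (simp add: add.commute)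
  have pos: "?N > 0"
    using ext_count_ge_1[OF u, of "k + ?j"] by simp
  have split: "sum ?w ?X = ?w ?v + sum ?w (?X - {?v})"
    using v finite_ext by (intro sum.remove) auto
  have split2: "(\<Sum>v\<in>?X. ratio (u @ v) k * ?w v)
      = ratio p k * ?w ?v + (\<Sum>v\<in>?X - {?v}. ratio (u @ v) k * ?w v)"
    unfolding rv[symmetric] using v finite_ext by (intro sum.remove) auto
  have wt: "weight_bound * ?N \<le> ?w ?v" unfolding wv by (rule p_weight)
  have bp: "a \<le> ratio p k" "ratio p k \<le> b" using bnd[OF p_in] by auto
  have "a * sum ?w (?X - {?v}) \<le> (\<Sum>v\<in>?X - {?v}. ratio (u @ v) k * ?w v)"
    unfolding sum_distrib_left using bnd by (intro sum_mono mult_right_mono) auto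
  then have "ratio u (k + ?j) * ?N \<ge> ratio p k * ?w ?v + a * (?N - ?w ?v)"
    using ratio_average[OF u, of k ?j] split split2 tot by simp
  moreover have "(ratio p k - a) * (weight_bound * ?N) \<le> (ratio p k - a) * ?w ?v"
    by (intro mult_left_mono wt) (use bp in simp)
  ultimately have "(a + weight_bound * (ratio p k - a)) * ?N \<le> ratio u (k + ?j) * ?N"
    by (simp add: algebra_simps)
  then show "a + weight_bound * (ratio p k - a) \<le> ratio u (k + ?j)" using pos by simp
  have "(\<Sum>v\<in>?X - {?v}. ratio (u @ v) k * ?w v) \<le> b * sum ?w (?X - {?v})"
    unfolding sum_distrib_left using bnd by (intro sum_mono mult_right_mono) auto
  then have "ratio u (k + ?j) * ?N \<le> ratio p k * ?w ?v + b * (?N - ?w ?v)"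
    using ratio_average[OF u, of k ?j] split split2 tot by simp
  moreover have "(b - ratio p k) * (weight_bound * ?N) \<le> (b - ratio p k) * ?w ?v"
    by (intro mult_left_mono wt) (use bp in simp)
  ultimately have "ratio u (k + ?j) * ?N \<le> (b - weight_bound * (b - ratio p k)) * ?N"
    by (simp add: algebra_simps)
  then show "ratio u (k + ?j) \<le> b - weight_bound * (b - ratio p k)" using pos by simp
qed

lemma ratio_bounds:
  "\<exists>a b. b - a = (1 - weight_bound) ^ j * real (card A) \<and>
     (\<forall>k \<ge> j * (K + length p). \<forall>u\<in>L. a \<le> ratio u k \<and> ratio u k \<le> b)"
proof (induction j)
  case 0
  show ?case
    using ratio_ge_1 ratio_le
    by (intro exI[of _ "0::real"] exI[of _ "real (card A)"]) (auto intro: order_trans[of _ 1])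
next
  case (Suc j)
  let ?k = "j * (K + length p)"
  obtain a b where ab: "b - a = (1 - weight_bound) ^ j * real (card A)"
    "\<And>u. u \<in> L \<Longrightarrow> a \<le> ratio u ?k \<and> ratio u ?k \<le> b"
    using Suc.IH by blast
  \<comment> \<open>Both endpoints move towards \<open>ratio p ?k\<close>; wherever that value lies,
    the length of the interval shrinks by exactly \<open>1 - weight_bound\<close>.\<close>
  define a' b' where "a' = a + weight_bound * (ratio p ?k - a)" and "b' = b - weight_bound * (b - ratio p ?k)"
  have "b' - a' = (1 - weight_bound) * (b - a)" by (simp add: a'_def b'_def algebra_simps)
  then have 1: "b' - a' = (1 - weight_bound) ^ Suc j * real (card A)" using ab(1) by simp
  have base: "a' \<le> ratio u (?k + (K + length p)) \<and> ratio u (?k + (K + length p)) \<le> b'"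
    if "u \<in> L" for u
    using ratio_contract[of a ?k b u] ab(2) that unfolding a'_def b'_def by blast
  have "a' \<le> ratio u k \<and> ratio u k \<le> b'" if "k \<ge> Suc j * (K + length p)" "u \<in> L" for k u
    using ratio_propagate[of a' "?k + (K + length p)" b' u "k - Suc j * (K + length p)"]
      base that by (simp add: add.commute)
  then show ?case using 1 by blast
qed

theorem count_asymptotics:
  "\<exists>\<rho> c. \<rho> \<ge> 1 \<and> c > 0 \<and> (\<lambda>k. real (ext_count L [] k) / \<rho> ^ k) \<longlonglongrightarrow> c"
proof -
  let ?J = "K + length p"
  let ?f = "ratio []"
  have J: "?J > 0" using p_nonempty by simp
  \<comment> \<open>One contraction takes \<open>?J\<close> levels, and \<open>q\<close> spreads it
    evenly over them; dividing by \<open>1 - weight_bound\<close> in \<open>D\<close> pays for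
    rounding \<open>k\<close> down to a multiple of \<open>?J\<close>.\<close>
  define q where "q = root ?J (1 - weight_bound)"
  have cw1: "0 < 1 - weight_bound" "1 - weight_bound < 1" using weight_bound_bounds by auto
  have q: "0 < q" "q < 1" unfolding q_def using cw1 J
    by (auto simp: real_root_gt_zero real_root_lt_1_iff)
  have qJ: "q ^ ?J = 1 - weight_bound" unfolding q_def using cw1 J by (intro real_root_pow_pos2) auto
  define D where "D = real (card A) / (1 - weight_bound)"
  have D: "D \<ge> 0" using cw1 by (simp add: D_def)
  have decay: "(1 - weight_bound) ^ (k div ?J) * real (card A) \<le> D * q ^ k" for k
  proof -
    have "(1 - weight_bound) * (1 - weight_bound) ^ (k div ?J) = q ^ (?J * Suc (k div ?J))"
      by (metis power_Suc power_mult qJ)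
    also have "\<dots> \<le> q ^ k"
    proof (rule power_decreasing)
      show "k \<le> ?J * Suc (k div ?J)"
        using J dividend_less_times_div[of ?J k] by simp
    qed (use q in auto)
    finally have "(1 - weight_bound) ^ (k div ?J) \<le> q ^ k / (1 - weight_bound)"
      using cw1 by (simp add: pos_le_divide_eq mult.commute)
    then have "(1 - weight_bound) ^ (k div ?J) * real (card A) \<le> q ^ k / (1 - weight_bound) * real (card A)"
      by (rule mult_right_mono) simp
    then show ?thesis by (simp add: D_def ac_simps)
  qed
  have close: "\<bar>?f k - ?f l\<bar> \<le> D * q ^ k" if "l \<ge> k" for k l
  proof -
    obtain a b where ab: "b - a = (1 - weight_bound) ^ (k div ?J) * real (card A)"
      "\<And>k' u. k' \<ge> (k div ?J) * ?J \<Longrightarrow> u \<in> L \<Longrightarrow> a \<le> ratio u k' \<and> ratio u k' \<le> b"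
      using ratio_bounds[of "k div ?J"] by blast
    have "k div ?J * ?J \<le> k" "k div ?J * ?J \<le> l"
      using that by (simp_all add: order_trans[of _ k l])
    then have "a \<le> ?f k \<and> ?f k \<le> b" "a \<le> ?f l \<and> ?f l \<le> b"
      using ab(2)[OF _ empty_in] by blast+
    then show ?thesis using ab(1) decay[of k] by linarith
  qed
  have "(\<lambda>k. D * q ^ k) \<longlonglongrightarrow> D * 0"
    by (intro tendsto_mult tendsto_const LIMSEQ_power_zero) (use q in auto)
  then have lim0: "(\<lambda>k. D * q ^ k) \<longlonglongrightarrow> 0" by simp
  have "Cauchy ?f"
  proof (rule metric_CauchyI)
    fix e :: real assume "e > 0"
    then have "\<forall>\<^sub>F k in sequentially. D * q ^ k < e / 2"
      using lim0 by (intro order_tendstoD) auto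
    then obtain M where M: "D * q ^ M < e / 2" by (auto simp: eventually_sequentially)
    have "dist (?f k) (?f l) < e" if "k \<ge> M" "l \<ge> M" for k l
      using close[of M k] close[of M l] M that by (simp add: dist_real_def)
    then show "\<exists>M. \<forall>m\<ge>M. \<forall>n\<ge>M. dist (?f m) (?f n) < e" by blast
  qed
  then obtain \<rho> where \<rho>: "?f \<longlonglongrightarrow> \<rho>" using Cauchy_convergent convergent_def by blast
  have f1: "?f k \<ge> 1" for k using ratio_ge_1 empty_in by blast
  have \<rho>1: "\<rho> \<ge> 1" using \<rho> f1 by (intro LIMSEQ_le_const) auto
  have f_close: "\<bar>?f k - \<rho>\<bar> \<le> D * q ^ k" for k
  proof (rule LIMSEQ_le_const2)
    show "(\<lambda>l. \<bar>?f k - ?f l\<bar>) \<longlonglongrightarrow> \<bar>?f k - \<rho>\<bar>"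
      by (intro tendsto_intros \<rho>)
  qed (use close in blast)
  \<comment> \<open>The count is the product of the ratios. All ratios and their limit are at least
    1, where the logarithm is 1-Lipschitz, so the geometric error bound makes the sum of logarithms
    converge and the normalized product has the positive limit \<open>exp s\<close>.\<close>
  have ln_lip: "\<bar>ln x - ln y\<bar> \<le> \<bar>x - y\<bar>" if "x \<ge> 1" "y \<ge> 1" for x y :: real
  proof -
    have *: "ln s - ln t \<le> s - t" if "s \<ge> t" "t \<ge> 1" for s t :: real
    proof -
      have "ln s - ln t \<le> (s - t) / t" using that ln_diff_le by simp
      also have "\<dots> \<le> (s - t) / 1" using that by (intro divide_left_mono) auto
      also have "\<dots> = s - t" by simp
      finally show ?thesis .
    qed
    show ?thesis
    proof (cases "x \<ge> y")
      case True
      then show ?thesis using *[of y x] that by (simp add: abs_of_nonneg)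
    next
      case False
      then show ?thesis using *[of x y] that by (simp add: abs_if)
    qed
  qed
  have "summable (\<lambda>k. ln (?f k) - ln \<rho>)"
  proof (rule summable_comparison_test)
    show "summable (\<lambda>k. D * q ^ k)"
      by (intro summable_mult summable_geometric) (use q in auto)
    show "\<exists>N. \<forall>k\<ge>N. norm (ln (?f k) - ln \<rho>) \<le> D * q ^ k"
      using ln_lip[OF f1 \<rho>1] f_close order_trans by (metis real_norm_def)
  qed
  then obtain s where s: "(\<lambda>k. \<Sum>i<k. ln (?f i) - ln \<rho>) \<longlonglongrightarrow> s"
    using summable_LIMSEQ by blast
  have "real (ext_count L [] k) / \<rho> ^ k = exp (\<Sum>i<k. ln (?f i) - ln \<rho>)" for k
  proof (induction k)
    case 0
    have "{v. length v = 0 \<and> [] @ v \<in> L} = {[]}" using empty_in by auto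
    then show ?case by (simp add: ext_count_def)
  next
    case (Suc k)
    have "real (ext_count L [] (Suc k)) / \<rho> ^ Suc k
        = (real (ext_count L [] k) / \<rho> ^ k) * (?f k / \<rho>)"
      using ratio_mult[OF empty_in, of k] by (simp add: field_simps)
    also have "?f k / \<rho> = exp (ln (?f k) - ln \<rho>)"
      using f1[of k] \<rho>1 by (simp add: exp_diff)
    finally show ?case using Suc.IH by (simp add: exp_add)
  qed
  then have "(\<lambda>k. real (ext_count L [] k) / \<rho> ^ k) \<longlonglongrightarrow> exp s"
    using tendsto_exp[OF s] by simp
  then show ?thesis using \<rho>1 by (intro exI[of _ \<rho>] exI[of _ "exp s"]) auto
qed

text \<open>All words have comparable numbers of extensions: the count after \<open>u\<close> is
  bounded through \<open>dominated\<close> by the count after \<open>p\<close>, and \<open>v\<close>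
  can be continued to end in \<open>p\<close> by \<open>K + length p\<close> letters. Each surplus
  letter costs at most a factor \<open>card A\<close>.\<close>

lemma uniform_weight:
  "\<exists>c. 0 < c \<and> c < 1 \<and> (\<forall>k. \<forall>u\<in>L. \<forall>v\<in>L. c * real (ext_count L u (k + j)) \<le> real (ext_count L v k))"
proof -
  let ?a = "real (card A)" and ?J = "K + length p"
  have a: "?a \<ge> 1" using card_A_pos by simp
  define c where "c = weight_bound / (?a ^ (j + ?J))"
  have 1: "?a ^ (j + ?J) \<ge> 1" using a by simp
  have "c > 0" unfolding c_def using weight_bound_bounds a by simp
  moreover have "c < 1" unfolding c_def using weight_bound_bounds 1
    by (subst divide_less_eq_1_pos) linarith+
  moreover have "c * real (ext_count L u (k + j)) \<le> real (ext_count L v k)"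
    if "u \<in> L" "v \<in> L" for k u v
  proof -
    obtain x where x: "length x = K" "v @ x @ p \<in> L" using reach[OF \<open>v \<in> L\<close>] by blast
    have "ext_count L p k = ext_count L (v @ x @ p) k"
      using ext_count_sync[of "v @ x"] x by simp
    also have "\<dots> \<le> ext_count L v (?J + k)"
      unfolding ext_count_add using x finite_ext
      by (intro member_le_sum) auto
    finally have "ext_count L p k \<le> card A ^ ?J * ext_count L v k"
      using ext_count_add_le[of v k ?J] by (simp add: add.commute)
    then have 1: "real (ext_count L p k) \<le> ?a ^ ?J * real (ext_count L v k)"
      by (metis of_nat_le_iff of_nat_mult of_nat_power)
    have "weight_bound * real (ext_count L u (k + j)) \<le> weight_bound * (?a ^ j * real (ext_count L u k))"
      using ext_count_add_le[of u k j] weight_bound_bounds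
      by (intro mult_left_mono) (metis of_nat_le_iff of_nat_mult of_nat_power, simp)
    also have "real (ext_count L u k) \<le> real (ext_count L u (k + ?J))"
      using lift_Suc_mono_le[of "ext_count L u" k "k + ?J"] ext_count_mono_step by simp
    finally have "weight_bound * real (ext_count L u (k + j)) \<le> ?a ^ j * (weight_bound * real (ext_count L u (k + ?J)))"
      using weight_bound_bounds a by (simp add: mult_left_mono mult.left_commute)
    also have "\<dots> \<le> ?a ^ j * (?a ^ ?J * real (ext_count L v k))"
      using p_weight[of u k] 1 a by (intro mult_left_mono) auto
    finally show ?thesis unfolding c_def using a by (simp add: field_simps power_add)
  qed
  ultimately show ?thesis by blast
qed

lemma sublanguage_decay:
  assumes E: "E \<subseteq> L" "\<And>u v. u @ v \<in> E \<Longrightarrow> u \<in> E"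
    and escape: "\<And>u. u \<in> L \<Longrightarrow> \<exists>x. length x = J \<and> u @ x \<in> L \<and> u @ x \<notin> E"
  shows "\<exists>\<theta>. 0 < \<theta> \<and> \<theta> < 1 \<and>
    (\<forall>j. real (ext_count E [] (j * J)) \<le> \<theta> ^ j * real (ext_count L [] (j * J)))"
proof -
  obtain c where c: "0 < c" "c < 1"
    "\<And>k u v. u \<in> L \<Longrightarrow> v \<in> L \<Longrightarrow> c * real (ext_count L u (k + J)) \<le> real (ext_count L v k)"
    using uniform_weight[of J] by blast
  \<comment> \<open>Only the first \<open>j\<close> blocks of \<open>J\<close> letters are confined
    to \<open>E\<close>; the tail of \<open>N\<close> letters is free in \<open>L\<close>. The
    induction turns \<open>J\<close> letters of the tail into a confined block, and the extensions
    through the escaping word, at least the share \<open>c\<close>, are lost each time.\<close>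
  define T where "T j N = {x. length x = j * J + N \<and> x \<in> L \<and> take (j * J) x \<in> E}" for j N
  have finT: "finite (T j N)" for j N
    using finite_ext[of "j * J + N" "[]"] by (rule finite_subset[rotated]) (auto simp: T_def)
  have cardT: "card (T j N) = (\<Sum>u | length u = j * J \<and> u \<in> E. ext_count L u N)" for j N
  proof -
    let ?S = "SIGMA u:{u. length u = j * J \<and> u \<in> E}. {v. length v = N \<and> u @ v \<in> L}"
    have "bij_betw (\<lambda>(v, w). v @ w) ?S (T j N)"
    proof (rule bij_betw_imageI)
      show "(\<lambda>(v, w). v @ w) ` ?S = T j N"
      proof (intro equalityI subsetI)
        fix x assume x: "x \<in> T j N"
        have "(take (j * J) x, drop (j * J) x) \<in> ?S" using x by (auto simp: T_def)
        then show "x \<in> (\<lambda>(v, w). v @ w) ` ?S"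
          by (metis (mono_tags, lifting) append_take_drop_id case_prod_conv image_eqI)
      qed (auto simp: T_def)
    qed (auto simp: inj_on_def)
    then have "card (T j N) = card ?S" by (simp add: bij_betw_same_card)
    also have "\<dots> = (\<Sum>u | length u = j * J \<and> u \<in> E. ext_count L u N)"
      unfolding ext_count_def
      by (intro card_SigmaI finite_ext ballI finite_subset[OF _ finite_ext[of "j * J" "[]"]])
        (use E(1) in auto)
    finally show ?thesis .
  qed
  have "real (card (T j N)) \<le> (1 - c) ^ j * real (ext_count L [] (j * J + N))" for j N
  proof (induction j arbitrary: N)
    case 0
    have "card (T 0 N) \<le> ext_count L [] N"
      unfolding ext_count_def T_def by (rule card_mono) (use finite_ext[of N "[]"] in auto)
    then show ?case by simp
  next
    case (Suc j)
    let ?X = "{u. length u = j * J \<and> u \<in> E}"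
    let ?B = "\<lambda>u. {v. length v = J + N \<and> u @ v \<in> L \<and> u @ take J v \<in> E}"
    have finX: "finite ?X"
      by (rule finite_subset[OF _ finite_ext[of "j * J" "[]"]]) (use E(1) in auto)
    have finB: "finite (?B u)" for u
      using finite_ext[of "J + N" u] by (rule finite_subset[rotated]) auto
    have B: "real (card (?B u)) \<le> (1 - c) * real (ext_count L u (N + J))" if u: "u \<in> L" for u
    proof -
      obtain x where x: "length x = J" "u @ x \<in> L" "u @ x \<notin> E" using escape[OF u] by blast
      let ?D = "(\<lambda>w. x @ w) ` {w. length w = N \<and> (u @ x) @ w \<in> L}"
      have "card ?D = ext_count L (u @ x) N"
        unfolding ext_count_def by (rule card_image) (simp add: inj_on_def)
      moreover have "?B u \<inter> ?D = {}" using x by auto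
      then have "card (?B u) + card ?D = card (?B u \<union> ?D)"
        using finB finite_ext[of N "u @ x"] by (intro card_Un_disjoint[symmetric]) auto
      moreover have "card (?B u \<union> ?D) \<le> ext_count L u (N + J)"
        unfolding ext_count_def using x
        by (intro card_mono finite_ext) auto
      ultimately have "real (card (?B u)) + real (ext_count L (u @ x) N) \<le> real (ext_count L u (N + J))"
        by linarith
      then show ?thesis using c(3)[OF u x(2), of N] by (simp add: algebra_simps)
    qed
    have "T (Suc j) N \<subseteq> (\<lambda>(v, w). v @ w) ` (SIGMA u:?X. ?B u)"
    proof
      fix z assume z: "z \<in> T (Suc j) N"
      let ?x = "take (j * J) z" and ?y = "drop (j * J) z"
      have z': "length z = Suc j * J + N" "z \<in> L" "take (Suc j * J) z \<in> E"
        using z by (auto simp: T_def)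
      have "take (Suc j * J) z = ?x @ take J ?y"
        using take_add[of "j * J" J z] by (metis add.commute mult_Suc)
      then have "?x @ take J ?y \<in> E" using z'(3) by simp
      moreover from this have "?x \<in> E" by (rule E(2))
      moreover have "length ?x = j * J" "length ?y = J + N" using z'(1) by simp_all
      ultimately have "(?x, ?y) \<in> (SIGMA u:?X. ?B u)"
        using z'(2) by simp
      then show "z \<in> (\<lambda>(v, w). v @ w) ` (SIGMA u:?X. ?B u)"
        by (metis (mono_tags, lifting) append_take_drop_id case_prod_conv image_eqI)
    qed
    then have "card (T (Suc j) N) \<le> card ((\<lambda>(v, w). v @ w) ` (SIGMA u:?X. ?B u))"
      using finX finB by (intro card_mono finite_imageI finite_SigmaI) auto
    also have "\<dots> \<le> card (SIGMA u:?X. ?B u)"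
      by (rule card_image_le) (use finX finB in \<open>intro finite_SigmaI, auto\<close>)
    also have "\<dots> = (\<Sum>u\<in>?X. card (?B u))" using finX finB by simp
    finally have "real (card (T (Suc j) N)) \<le> real (\<Sum>u\<in>?X. card (?B u))"
      by (simp only: of_nat_le_iff)
    also have "\<dots> = (\<Sum>u\<in>?X. real (card (?B u)))" by simp
    also have "\<dots> \<le> (\<Sum>u\<in>?X. (1 - c) * real (ext_count L u (N + J)))"
      by (rule sum_mono) (use B E(1) in auto)
    also have "\<dots> = (1 - c) * real (card (T j (N + J)))"
      by (simp add: cardT sum_distrib_left)
    also have "\<dots> \<le> (1 - c) * ((1 - c) ^ j * real (ext_count L [] (j * J + (N + J))))"
      using Suc.IH[of "N + J"] c by (intro mult_left_mono) auto
    finally show ?case by (simp add: algebra_simps)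
  qed
  moreover have "ext_count E [] (j * J) \<le> card (T j 0)" for j
    unfolding ext_count_def by (rule card_mono[OF finT]) (use E(1) in \<open>auto simp: T_def\<close>)
  ultimately have "real (ext_count E [] (j * J)) \<le> (1 - c) ^ j * real (ext_count L [] (j * J))" for j
    by (metis add.right_neutral of_nat_le_iff order_trans)
  then show ?thesis using c by (intro exI[of _ "1 - c"]) auto
qed

end

section \<open>Words and the geometric representation\<close>

lemma rev_in_lists [simp]: "rev w \<in> lists A \<longleftrightarrow> w \<in> lists A"
  by (auto simp: in_lists_conv_set)

lemma word_cong_lists: "(x, y) \<in> word_cong A R \<Longrightarrow> x \<in> lists A \<and> y \<in> lists A"
  by (induction rule: word_cong.induct) auto

lemma word_cong_context:
  assumes "(x, y) \<in> word_cong A R" "u \<in> lists A" "v \<in> lists A"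
  shows "(u @ x @ v, u @ y @ v) \<in> word_cong A R"
  using assms
proof (induction rule: word_cong.induct)
  case (base l r u' v')
  then show ?case
    using word_cong.base[of l r R "u @ u'" "v' @ v" A] by simp
next
  case (refl w)
  then show ?case by (intro word_cong.refl) auto
next
  case (sym v w)
  then show ?case by (blast intro: word_cong.sym)
next
  case (trans u v w)
  then show ?case by (blast intro: word_cong.trans)
qed

lemma word_cong_append:
  assumes "(x, y) \<in> word_cong A R" "(x', y') \<in> word_cong A R"
  shows "(x @ x', y @ y') \<in> word_cong A R"
proof -
  have "(x @ x', y @ x') \<in> word_cong A R"
    using word_cong_context[OF assms(1), of "[]" x'] word_cong_lists[OF assms(2)] by simp
  moreover have "(y @ x', y @ y') \<in> word_cong A R"
    using word_cong_context[OF assms(2), of y "[]"] word_cong_lists[OF assms(1)] by simp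
  ultimately show ?thesis by (rule word_cong.trans)
qed

section \<open>Alternating words and Chebyshev polynomials\<close>

fun alt :: "'a \<Rightarrow> 'a \<Rightarrow> nat \<Rightarrow> 'a list" where
  "alt a b 0 = []"
| "alt a b (Suc j) = a # alt b a j"

lemma alt_length [simp]: "length (alt a b j) = j"
  by (induction j arbitrary: a b) auto

lemma alt_snoc: "alt a b (Suc j) = alt a b j @ [if even j then a else b]"
proof (induction j arbitrary: a b)
  case (Suc j)
  have "alt a b (Suc (Suc j)) = a # alt b a (Suc j)" by simp
  also have "alt b a (Suc j) = alt b a j @ [if even j then b else a]" by (rule Suc.IH)
  finally show ?case by simp
qed simp

lemma alt_lists: "a \<in> A \<Longrightarrow> b \<in> A \<Longrightarrow> alt a b j \<in> lists A"
  by (induction j arbitrary: a b) auto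

lemma alt_double: "concat (replicate k [a, b]) = alt a b (2 * k)"
  by (induction k) auto

lemma rev_alt_double: "rev (alt b a (2 * k)) = alt a b (2 * k)"
proof (induction k)
  case (Suc k)
  have "alt b a (2 * Suc k) = alt b a (2 * k) @ [b, a]"
    using alt_snoc[of b a "Suc (2 * k)"] alt_snoc[of b a "2 * k"] by simp
  then show ?case using Suc.IH by simp
qed simp

lemma alt_split: "alt a b (i + j) = alt a b i @ (if even i then alt a b j else alt b a j)"
  by (induction i arbitrary: a b) auto

text \<open>\<open>cheb c (k + 1)\<close> is the Chebyshev polynomial of the second kind of degree
  \<open>k\<close> at \<open>c / 2\<close>. These values are the coordinates of the roots of a
  dihedral group; \<open>c = 2\<close> belongs to the label \<infinity>.\<close>

fun cheb :: "real \<Rightarrow> nat \<Rightarrow> real" where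
  "cheb c 0 = 0"
| "cheb c (Suc 0) = 1"
| "cheb c (Suc (Suc k)) = c * cheb c (Suc k) - cheb c k"

lemma cheb_two: "cheb 2 k = real k"
proof (induction k rule: less_induct)
  case (less k)
  then show ?case by (cases "(2::real, k)" rule: cheb.cases) auto
qed

lemma cheb_cos: "cheb (2 * cos t) k * sin t = sin (real k * t)"
proof (induction k rule: less_induct)
  case (less k)
  show ?case
  proof (cases "(2 * cos t, k)" rule: cheb.cases)
    case (3 c j)
    have "sin (real (Suc (Suc j)) * t) + sin (real j * t)
        = sin ((real j + 1) * t + t) + sin ((real j + 1) * t - t)"
      by (simp add: algebra_simps)
    also have "\<dots> = 2 * cos t * sin ((real j + 1) * t)"
      by (simp only: sin_add sin_diff) simp
    also have "real j + 1 = real (Suc j)" by simp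
    finally have "sin (real (Suc (Suc j)) * t) = 2 * cos t * sin (real (Suc j) * t) - sin (real j * t)"
      by linarith
    moreover have "cheb (2 * cos t) j * sin t = sin (real j * t)"
      "cheb (2 * cos t) (Suc j) * sin t = sin (real (Suc j) * t)"
      using 3 less.IH by auto
    moreover have "c = 2 * cos t" "k = Suc (Suc j)" using 3 by auto
    ultimately show ?thesis
      by (simp only: cheb.simps left_diff_distrib mult.assoc)
  qed auto
qed

section \<open>The geometric representation\<close>

locale coxeter =
  fixes n :: nat and m :: "nat \<Rightarrow> nat \<Rightarrow> enat"
  assumes matrix: "coxeter_matrix n m"
begin

definition gens :: "nat set" where "gens = {1..n}"

lemma finite_gens [simp]: "finite gens"
  by (simp add: gens_def)

text \<open>The presentation over unsigned letters, in which all arguments about words take place.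
  \<open>geqv_iff\<close> compares it with the signed letters of
  \<open>group_presentation\<close>.\<close>

definition relations :: "(nat list \<times> nat list) set" where
  "relations = {([i, i], []) | i. i \<in> gens} \<union>
    {(concat (replicate k [i, j]), []) | i j k. 1 \<le> i \<and> i < j \<and> j \<le> n \<and> m i j = enat k}"

abbreviation eqv :: "nat list \<Rightarrow> nat list \<Rightarrow> bool" where
  "eqv u v \<equiv> (u, v) \<in> word_cong gens relations"

text \<open>\<open>cof i j\<close> is \<open>- 2 B(\<alpha>\<^sub>i, \<alpha>\<^sub>j)\<close> for the standard bilinear form \<open>B\<close> of the geometric
  representation, so \<open>sigma i\<close> is the reflection \<open>v \<mapsto> v - 2 B(\<alpha>\<^sub>i, v) \<alpha>\<^sub>i\<close>.\<close>

definition cof :: "nat \<Rightarrow> nat \<Rightarrow> real" where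
  "cof i j = (if i = j then - 2 else case m i j of enat k \<Rightarrow> 2 * cos (pi / real k) | \<infinity> \<Rightarrow> 2)"

definition phi :: "nat \<Rightarrow> (nat \<Rightarrow> real) \<Rightarrow> real" where
  "phi i v = (\<Sum>j\<in>gens. cof i j * v j)"

definition sigma :: "nat \<Rightarrow> (nat \<Rightarrow> real) \<Rightarrow> (nat \<Rightarrow> real)" where
  "sigma i v = v(i := v i + phi i v)"

fun act :: "nat list \<Rightarrow> (nat \<Rightarrow> real) \<Rightarrow> (nat \<Rightarrow> real)" where
  "act [] v = v"
| "act (s # w) v = sigma s (act w v)"

definition simple :: "nat \<Rightarrow> nat \<Rightarrow> real" where
  "simple i j = (if j = i then 1 else 0)"

lemma m_sym: "i \<in> gens \<Longrightarrow> j \<in> gens \<Longrightarrow> i \<noteq> j \<Longrightarrow> m i j = m j i"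
  using matrix unfolding coxeter_matrix_def gens_def by blast

lemma m_ge_2: "i \<in> gens \<Longrightarrow> j \<in> gens \<Longrightarrow> i \<noteq> j \<Longrightarrow> m i j = enat k \<Longrightarrow> k \<ge> 2"
  using matrix unfolding coxeter_matrix_def gens_def by (metis enat_ord_simps(1) numeral_eq_enat)

lemma cof_same [simp]: "cof i i = - 2" by (simp add: cof_def)

lemma cof_sym: "i \<in> gens \<Longrightarrow> j \<in> gens \<Longrightarrow> cof i j = cof j i"
  using m_sym by (simp add: cof_def)

lemma cof_inf: "i \<noteq> j \<Longrightarrow> m i j = \<infinity> \<Longrightarrow> cof i j = 2"
  by (simp add: cof_def)

lemma cof_nonneg:
  assumes "i \<in> gens" "j \<in> gens" "i \<noteq> j"
  shows "0 \<le> cof i j"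
proof (cases "m i j")
  case (enat k)
  then have "real k \<ge> 2" using m_ge_2[OF assms] by simp
  then have "pi / real k \<le> pi / 2" by (intro divide_left_mono) auto
  then have "0 \<le> cos (pi / real k)" by (intro cos_ge_zero) (auto intro: order_trans[of _ 0])
  then show ?thesis using enat assms by (simp add: cof_def)
qed (use assms in \<open>simp add: cof_def\<close>)

lemma phi_lin: "phi i (\<lambda>x. a * u x + b * v x) = a * phi i u + b * phi i v"
  unfolding phi_def by (simp add: sum_distrib_left sum.distrib algebra_simps)

lemma phi_simple: "j \<in> gens \<Longrightarrow> phi i (simple j) = cof i j"
  unfolding phi_def simple_def by (simp add: if_distrib[of "\<lambda>x. _ * x"] cong: if_cong)

lemma sigma_lin: "sigma i (\<lambda>x. a * u x + b * v x) = (\<lambda>x. a * sigma i u x + b * sigma i v x)"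
  unfolding sigma_def phi_lin by (auto simp: algebra_simps)

lemma act_lin: "act w (\<lambda>x. a * u x + b * v x) = (\<lambda>x. a * act w u x + b * act w v x)"
  by (induction w) (simp_all add: sigma_lin)

lemma act_scale: "act w (\<lambda>x. a * u x) = (\<lambda>x. a * act w u x)"
  using act_lin[of w a u 0 u] by simp

lemma act_uminus: "act w (\<lambda>x. - u x) = (\<lambda>x. - act w u x)"
  using act_scale[of w "-1" u] by simp

lemma sigma_eq: "sigma i v = (\<lambda>x. 1 * v x + phi i v * simple i x)"
  by (auto simp: sigma_def simple_def)

lemma sigma_simple_self: "i \<in> gens \<Longrightarrow> sigma i (simple i) = (\<lambda>x. - simple i x)"
  by (simp add: sigma_eq phi_simple)

lemma sigma_simple: "j \<in> gens \<Longrightarrow> sigma i (simple j) = (\<lambda>x. simple j x + cof i j * simple i x)"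
  by (simp add: sigma_eq phi_simple)

lemma sigma_sigma:
  assumes "i \<in> gens"
  shows "sigma i (sigma i v) = v"
proof -
  have "sigma i (sigma i v) = (\<lambda>x. 1 * sigma i v x + phi i v * sigma i (simple i) x)"
    by (subst (2) sigma_eq) (rule sigma_lin)
  then show ?thesis using assms by (auto simp: sigma_simple_self sigma_eq[of i v])
qed

lemma act_append [simp]: "act (u @ w) v = act u (act w v)"
  by (induction u) auto

lemma act_rev_act: "w \<in> lists gens \<Longrightarrow> act (rev w) (act w v) = v"
  by (induction w) (auto simp: sigma_sigma)

lemma act_act_rev: "w \<in> lists gens \<Longrightarrow> act w (act (rev w) v) = v"
  using act_rev_act[of "rev w" v] by (simp add: in_lists_conv_set)

text \<open>The letter after \<open>alt a b j\<close> in the alternating word is \<open>a\<close>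
  for even \<open>j\<close> and \<open>b\<close> for odd \<open>j\<close>. Prepending a reflection
  is one step of the recursion for \<open>cheb\<close>.\<close>

lemma act_alt:
  assumes "a \<in> gens" "b \<in> gens"
  shows "act (alt a b j) (simple (if even j then a else b))
    = (\<lambda>x. cheb (cof a b) (Suc j) * simple a x + cheb (cof a b) j * simple b x)"
  using assms
proof (induction j arbitrary: a b)
  case (Suc j)
  have c: "cof b a = cof a b" using cof_sym Suc.prems by simp
  have "act (alt a b (Suc j)) (simple (if even (Suc j) then a else b))
    = sigma a (act (alt b a j) (simple (if even j then b else a)))" by simp
  also have "\<dots> = sigma a (\<lambda>x. cheb (cof a b) (Suc j) * simple b x + cheb (cof a b) j * simple a x)"
    using Suc.IH[of b a] Suc.prems c by simp
  also have "\<dots> = (\<lambda>x. cheb (cof a b) (Suc j) * (simple b x + cof a b * simple a x)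
      + cheb (cof a b) j * - simple a x)"
    using Suc.prems by (subst sigma_lin) (simp add: sigma_simple sigma_simple_self)
  finally show ?case by (simp add: algebra_simps)
qed auto

lemma act_fix: "phi a v = 0 \<Longrightarrow> phi b v = 0 \<Longrightarrow> act (alt a b j) v = v"
  by (induction j arbitrary: a b) (simp_all add: sigma_eq)

text \<open>On the plane of the two simple roots the product of the reflections is a rotation of
  order \<open>k\<close>, seen from the Chebyshev values at \<open>2 * k\<close> and its neighbours.
  Vectors on which \<open>phi a\<close> and \<open>phi b\<close> vanish are fixed by both
  reflections. A finite label makes the form nondegenerate on the plane, so every vector is a sum of
  these two kinds.\<close>

lemma act_relation:
  assumes ab: "a \<in> gens" "b \<in> gens" "a \<noteq> b" and mab: "m a b = enat k"
  shows "act (alt a b (2 * k)) v = v"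
proof -
  have k: "k \<ge> 2" using m_ge_2[OF ab mab] .
  define t where "t = pi / real k"
  have t: "0 < t" "t < pi" unfolding t_def using k by (auto simp: field_simps)
  have st: "sin t > 0" using t by (intro sin_gt_zero) auto
  have kt: "real k * t = pi" unfolding t_def using k by simp
  have c: "cof a b = 2 * cos t" using ab mab by (simp add: cof_def t_def)
  have ch: "cheb (cof a b) j = sin (real j * t) / sin t" for j
    using cheb_cos[of t j] st c by (simp add: field_simps)
  have u0: "cheb (cof a b) (2 * k) = 0"
  proof -
    have "real (2 * k) * t = 2 * pi" using kt by simp
    then show ?thesis by (simp only: ch sin_two_pi div_0)
  qed
  have u1: "cheb (cof a b) (Suc (2 * k)) = 1"
  proof -
    have "real (Suc (2 * k)) * t = t + 2 * pi" using kt by (simp add: algebra_simps)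
    then show ?thesis using st by (simp only: ch sin_periodic) simp
  qed
  have um: "cheb (cof a b) (2 * k - 1) = - 1"
  proof -
    have "real (2 * k - 1) * t = - t + 2 * pi" using kt k by (simp add: algebra_simps of_nat_diff)
    then show ?thesis using st by (simp only: ch sin_periodic) simp
  qed
  have fa: "act (alt a b (2 * k)) (simple a) = simple a"
    using act_alt[OF ab(1,2), of "2 * k"] u0 u1 by simp
  have fb: "act (alt a b (2 * k)) (simple b) = simple b"
  proof -
    obtain j where j: "2 * k = Suc j" "odd j" using k by (metis Suc_pred even_Suc even_mult_iff even_numeral gr0I mult_is_0 not_numeral_le_zero zero_neq_numeral)
    have "act (alt a b (2 * k)) (simple b) = act (alt a b j) (\<lambda>x. - simple b x)"
      unfolding j alt_snoc using j ab by (simp add: sigma_simple_self)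
    also have "\<dots> = (\<lambda>x. - act (alt a b j) (simple b) x)" by (rule act_uminus)
    also have "\<dots> = simple b"
      using act_alt[OF ab(1,2), of j] u0 um j by simp
    finally show ?thesis .
  qed
  define c where "c = cof a b"
  have "cos t < 1" using t by (metis cos_zero cos_monotone_0_pi less_eq_real_def order_refl pi_ge_zero)
  moreover have "c \<ge> 0" unfolding c_def using cof_nonneg[OF ab] .
  ultimately have "c < 2" "c \<ge> 0" using c c_def by auto
  then have "c * c < 2 * 2" by (intro mult_strict_mono) auto
  then have det: "4 - c * c \<noteq> 0" by simp
  \<comment> \<open>Cramer's rule for the plane component whose removal makes \<open>phi a\<close>
    and \<open>phi b\<close> vanish; the determinant is \<open>4 - c * c\<close>.\<close>
  define x y where "x = - (2 * phi a v + c * phi b v) / (4 - c * c)"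
    and "y = - (c * phi a v + 2 * phi b v) / (4 - c * c)"
  define v' where "v' = (\<lambda>i. 1 * v i + (- 1) * (\<lambda>i. x * simple a i + y * simple b i) i)"
  have cba: "cof b a = c" using cof_sym ab c_def by simp
  have "phi a v' = phi a v - (x * (- 2) + y * c)"
    unfolding v'_def phi_lin using ab by (simp add: phi_simple c_def)
  also have "\<dots> = 0" unfolding x_def y_def using det
    by (simp add: divide_simps) (simp add: algebra_simps)
  finally have 1: "phi a v' = 0" .
  have "phi b v' = phi b v - (x * c + y * (- 2))"
    unfolding v'_def phi_lin using ab cba by (simp add: phi_simple)
  also have "\<dots> = 0" unfolding x_def y_def using det
    by (simp add: divide_simps) (simp add: algebra_simps)
  finally have 2: "phi b v' = 0" .
  have v: "v = (\<lambda>i. 1 * v' i + 1 * (\<lambda>i. x * simple a i + y * simple b i) i)"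
    by (simp add: v'_def)
  show ?thesis
    by (subst (1 2) v) (simp only: act_lin act_fix[OF 1 2] fa fb)
qed

lemma eqv_act: "eqv u w \<Longrightarrow> act u v = act w v"
proof (induction arbitrary: v rule: word_cong.induct)
  case (base l r x y)
  have "act l v' = act r v'" for v'
  proof -
    consider i where "i \<in> gens" "(l, r) = ([i, i], [])"
      | i j k where "1 \<le> i" "i < j" "j \<le> n" "m i j = enat k"
          "(l, r) = (concat (replicate k [i, j]), [])"
      using base(1) unfolding relations_def by blast
    then show ?thesis
    proof cases
      case 1
      then show ?thesis by (simp add: sigma_sigma)
    next
      case 2
      then have "act (alt i j (2 * k)) v' = v'" by (intro act_relation) (auto simp: gens_def)
      then show ?thesis using 2(5) by (simp only: alt_double prod.inject act.simps)
    qed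
  qed
  then show ?case by simp
qed auto

lemma eqv_parity: "eqv u w \<Longrightarrow> even (length u) = even (length w)"
proof (induction rule: word_cong.induct)
  case (base l r x y)
  then have "even (length l)" "r = []" unfolding relations_def
    by (auto simp: alt_double)
  then show ?case by simp
qed auto

lemma eqv_lists: "eqv u w \<Longrightarrow> u \<in> lists gens \<and> w \<in> lists gens"
  by (rule word_cong_lists)

lemma eqv_cancel: "i \<in> gens \<Longrightarrow> u \<in> lists gens \<Longrightarrow> w \<in> lists gens \<Longrightarrow> eqv (u @ [i, i] @ w) (u @ w)"
  using word_cong.base[of "[i, i]" "[]" relations u w gens] by (auto simp: relations_def)

lemma eqv_rev_cancel: "u \<in> lists gens \<Longrightarrow> eqv (u @ rev u) []"
proof (induction u)
  case (Cons a u)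
  have "eqv ([a] @ (u @ rev u) @ [a]) ([a] @ [] @ [a])"
    by (rule word_cong_context) (use Cons in auto)
  moreover have "eqv ([] @ [a, a] @ []) ([] @ [])"
    by (rule eqv_cancel) (use Cons in auto)
  ultimately show ?case using word_cong.trans by fastforce
qed (simp add: word_cong.refl)

text \<open>Reversal is inversion in the group. The relators are listed for \<open>i < j\<close>
  only, so a reversed relator is not itself one and the claim is derived by cancelling
  \<open>rev u @ u\<close> and \<open>w @ rev w\<close>.\<close>

lemma eqv_rev:
  assumes "eqv u w"
  shows "eqv (rev u) (rev w)"
proof -
  have u: "u \<in> lists gens" and w: "w \<in> lists gens" using eqv_lists[OF assms] by auto
  have "eqv (rev u @ u) []"
    using eqv_rev_cancel[of "rev u"] u by (simp add: in_lists_conv_set)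
  from word_cong_context[OF this, of "[]" "rev w"]
  have 1: "eqv (rev u @ u @ rev w) (rev w)" using w by simp
  have 2: "eqv (rev u @ u @ rev w) (rev u @ w @ rev w)"
    by (rule word_cong_context[OF assms]) (use u w in auto)
  from word_cong_context[OF eqv_rev_cancel[OF w], of "rev u" "[]"]
  have 3: "eqv (rev u @ w @ rev w) (rev u)" using u by simp
  have "eqv (rev w) (rev u)"
    by (rule word_cong.trans[OF word_cong.sym[OF 1] word_cong.trans[OF 2 3]])
  then show ?thesis by (rule word_cong.sym)
qed

section \<open>Reduced words\<close>

definition reduced :: "nat list \<Rightarrow> bool" where
  "reduced w \<longleftrightarrow> w \<in> lists gens \<and> (\<forall>w'. eqv w w' \<longrightarrow> length w \<le> length w')"

lemma reduced_lists: "reduced w \<Longrightarrow> w \<in> lists gens"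
  by (simp add: reduced_def)

lemma reduced_Nil: "reduced []"
  by (simp add: reduced_def)

lemma reduced_factor:
  assumes "reduced (u @ w @ v)"
  shows "reduced w"
  unfolding reduced_def
proof (intro conjI allI impI)
  have l: "u \<in> lists gens" "w \<in> lists gens" "v \<in> lists gens"
    using reduced_lists[OF assms] by auto
  then show "w \<in> lists gens" by simp
  fix w' assume "eqv w w'"
  then have "eqv (u @ w @ v) (u @ w' @ v)" by (rule word_cong_context) (use l in auto)
  then have "length (u @ w @ v) \<le> length (u @ w' @ v)"
    using assms unfolding reduced_def by blast
  then show "length w \<le> length w'" by simp
qed

lemma reduced_prefix: "reduced (u @ v) \<Longrightarrow> reduced u"
  using reduced_factor[of "[]" u v] by simp

lemma reduced_suffix: "reduced (u @ v) \<Longrightarrow> reduced v"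
  using reduced_factor[of u v "[]"] by simp

lemma reduced_rev: "reduced w \<Longrightarrow> reduced (rev w)"
  unfolding reduced_def using eqv_rev[of "rev w"] by (auto, metis length_rev rev_rev_ident)

lemma reduced_eqv: "reduced w \<Longrightarrow> eqv w w' \<Longrightarrow> length w' = length w \<Longrightarrow> reduced w'"
  unfolding reduced_def using eqv_lists word_cong.trans by metis

lemma ex_reduced:
  assumes "w \<in> lists gens"
  shows "\<exists>w'. eqv w w' \<and> reduced w'"
proof -
  obtain w' where w': "eqv w w'" "\<And>w''. eqv w w'' \<Longrightarrow> length w' \<le> length w''"
    using ex_has_least_nat[of "eqv w" w length] word_cong.refl[OF assms] by blast
  then have "reduced w'" unfolding reduced_def using eqv_lists word_cong.trans by metis
  then show ?thesis using w' by blast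
qed

text \<open>By parity \<open>w @ [s]\<close> cannot represent an element of the same length as
  \<open>w\<close>; being shorter than expected, it is shorter than \<open>w\<close>, and appending
  \<open>s\<close> once more recovers \<open>w\<close>.\<close>

lemma not_reduced_snoc:
  assumes w: "reduced w" and s: "s \<in> gens" and nr: "\<not> reduced (w @ [s])"
  shows "\<exists>w'. eqv w (w' @ [s]) \<and> Suc (length w') = length w \<and> reduced (w' @ [s])"
proof -
  have wl: "w \<in> lists gens" using reduced_lists[OF w] .
  obtain w' where w': "eqv (w @ [s]) w'" "length w' < length (w @ [s])"
    using nr wl s unfolding reduced_def by (auto simp: not_le)
  have "even (length (w @ [s])) = even (length w')" using eqv_parity w'(1) .
  then have len: "length w' < length w" using w'(2)
    by (metis One_nat_def Suc_eq_plus1 even_Suc length_append_singleton less_SucE)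
  have "eqv ((w @ [s]) @ [s]) (w' @ [s])"
    using word_cong_append[OF w'(1) word_cong.refl, of "[s]"] s by simp
  moreover have "eqv (w @ [s, s] @ []) (w @ [])"
    by (rule eqv_cancel) (use s wl in auto)
  ultimately have e: "eqv w (w' @ [s])"
    using word_cong.trans word_cong.sym by fastforce
  then have "length w \<le> length (w' @ [s])" using w unfolding reduced_def by blast
  then have "Suc (length w') = length w" using len by simp
  then show ?thesis using e reduced_eqv[OF w e] by auto
qed

lemma not_reduced_double: "u @ [s, s] @ v \<in> lists gens \<Longrightarrow> \<not> reduced (u @ [s, s] @ v)"
  using eqv_cancel[of s u v] unfolding reduced_def by fastforce

text \<open>In the relator of length \<open>2 * k\<close> the first \<open>k + 1\<close> letters
  equal the inverse of the remaining \<open>k - 1\<close>, which is a shorter word.\<close>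

lemma not_reduced_alt:
  assumes ab: "a \<in> gens" "b \<in> gens" "a \<noteq> b" and mab: "m a b = enat k" and "j > k"
  shows "\<not> reduced (alt a b j)"
proof
  assume "reduced (alt a b j)"
  moreover have "alt a b j = alt a b (Suc k) @ (if even (Suc k) then alt a b (j - Suc k) else alt b a (j - Suc k))"
    using alt_split[of a b "Suc k" "j - Suc k"] assms(5) by simp
  ultimately have r: "reduced (alt a b (Suc k))" using reduced_prefix by metis
  have k: "k \<ge> 2" using m_ge_2[OF ab mab] .
  have rel: "eqv (alt a b (2 * k)) []"
  proof (cases "a < b")
    case True
    then have "(alt a b (2 * k), []) \<in> relations"
      unfolding relations_def alt_double[symmetric] using ab mab by (auto simp: gens_def)
    then show ?thesis using word_cong.base[of "alt a b (2 * k)" "[]" relations "[]" "[]" gens]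
        alt_lists[OF ab(1,2), of "2 * k"] by simp
  next
    case False
    then have "(alt b a (2 * k), []) \<in> relations"
      unfolding relations_def alt_double[symmetric] using ab mab m_sym[OF ab]
      by (auto simp: gens_def intro!: exI)
    then have "eqv (alt b a (2 * k)) []"
      using word_cong.base[of "alt b a (2 * k)" "[]" relations "[]" "[]" gens]
        alt_lists[OF ab(2,1), of "2 * k"] by simp
    moreover have "rev (alt b a (2 * k)) = alt a b (2 * k)"
      by (rule rev_alt_double)
    ultimately show ?thesis using eqv_rev by fastforce
  qed
  let ?r = "if even (Suc k) then alt a b (k - 1) else alt b a (k - 1)"
  have "alt a b (2 * k) = alt a b (Suc k) @ ?r"
    using alt_split[of a b "Suc k" "k - 1"] k by (simp add: mult_2)
  moreover have rl: "?r \<in> lists gens" using ab by (cases "even k") (simp_all add: alt_lists del: in_lists_conv_set)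
  moreover have "rev ?r \<in> lists gens" using rl by (simp add: in_lists_conv_set)
  ultimately have 1: "eqv (alt a b (Suc k) @ ?r @ rev ?r) (rev ?r)"
    using word_cong_append[OF rel word_cong.refl[of "rev ?r"]] by (simp only: append_assoc append_Nil)
  have "eqv (alt a b (Suc k) @ (?r @ rev ?r) @ []) (alt a b (Suc k) @ [] @ [])"
    by (rule word_cong_context[OF eqv_rev_cancel[OF rl] alt_lists[OF ab(1,2)]]) simp
  then have 2: "eqv (alt a b (Suc k) @ ?r @ rev ?r) (alt a b (Suc k))"
    by (simp only: append_Nil append_Nil2 append_assoc)
  have "eqv (alt a b (Suc k)) (rev ?r)"
    by (rule word_cong.trans[OF word_cong.sym[OF 2] 1])
  then have "length (alt a b (Suc k)) \<le> length (rev ?r)" using r unfolding reduced_def by blast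
  then show False using k by (auto split: if_splits)
qed

end

section \<open>Roots\<close>

context coxeter
begin

text \<open>Asking nonzero coordinates to be at least 1, instead of positive, yields lower bounds for
  \<open>phi\<close> on positive roots.\<close>

definition pos :: "(nat \<Rightarrow> real) \<Rightarrow> bool" where
  "pos v \<longleftrightarrow> (\<forall>x. v x = 0 \<or> 1 \<le> v x)"

abbreviation neg :: "(nat \<Rightarrow> real) \<Rightarrow> bool" where
  "neg v \<equiv> pos (\<lambda>x. - v x)"

definition roots :: "(nat \<Rightarrow> real) set" where
  "roots = {act w (simple i) | w i. w \<in> lists gens \<and> i \<in> gens}"

lemma pos_nonneg: "pos v \<Longrightarrow> 0 \<le> v x"
  unfolding pos_def by (metis order_refl order_trans zero_le_one)

lemma pos_ge_1: "pos v \<Longrightarrow> v x \<noteq> 0 \<Longrightarrow> 1 \<le> v x"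
  unfolding pos_def by blast

lemma neg_nonpos: "neg v \<Longrightarrow> v x \<le> 0"
  using pos_nonneg[of "\<lambda>x. - v x" x] by simp

lemma pos_simple: "pos (simple i)"
  by (simp add: pos_def simple_def)

lemma pos_comb:
  assumes "pos u" "pos v" "a = 0 \<or> 1 \<le> a" "b = 0 \<or> 1 \<le> b"
  shows "pos (\<lambda>x. a * u x + b * v x)"
proof -
  have *: "c * d = 0 \<or> 1 \<le> c * d" if "c = 0 \<or> 1 \<le> c" "d = 0 \<or> 1 \<le> d" for c d :: real
    using that mult_mono[of 1 c 1 d] by auto
  show ?thesis unfolding pos_def
  proof
    fix x
    have "a * u x = 0 \<or> 1 \<le> a * u x" "b * v x = 0 \<or> 1 \<le> b * v x"
      using assms * unfolding pos_def by blast+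
    then show "a * u x + b * v x = 0 \<or> 1 \<le> a * u x + b * v x" by auto
  qed
qed

text \<open>For a finite label the value is \<open>sin (i * t) / sin t\<close> with
  \<open>t = pi / k\<close>. Among the multiples of \<open>t\<close> strictly between 0 and pi the
  sine is least at the two ends; the second half is folded onto the first by
  \<open>sin (pi - x) = sin x\<close>.\<close>

lemma cheb_zero_or_ge_1:
  assumes ab: "a \<in> gens" "b \<in> gens" "a \<noteq> b" and i: "enat i \<le> m a b"
  shows "cheb (cof a b) i = 0 \<or> 1 \<le> cheb (cof a b) i"
proof (cases "m a b")
  case (enat k)
  have k: "k \<ge> 2" using m_ge_2[OF ab enat] .
  define t where "t = pi / real k"
  have t: "0 < t" "t \<le> pi / 2" unfolding t_def using k by (auto simp: field_simps)
  have st: "sin t > 0" using t by (intro sin_gt_zero) auto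
  have kt: "real k * t = pi" unfolding t_def using k by simp
  have c: "cof a b = 2 * cos t" using ab enat by (simp add: cof_def t_def)
  have ch: "cheb (cof a b) j = sin (real j * t) / sin t" for j
    using cheb_cos[of t j] st c by (simp add: field_simps)
  have ik: "i \<le> k" using i enat by simp
  consider "i = 0" | "i = k" | "1 \<le> i" "i < k" using ik by linarith
  then show ?thesis
  proof cases
    case 2
    then show ?thesis by (simp add: ch kt)
  next
    case 3
    have "sin t \<le> sin (real i * t)"
    proof (cases "real i * t \<le> pi / 2")
      case True
      have "t \<le> real i * t" using 3 t by simp
      then show ?thesis using True t by (intro sin_monotone_2pi_le) auto
    next
      case False
      have "sin (real i * t) = sin (real (k - i) * t)"
        using kt ik sin_pi_minus[of "real i * t"] by (simp add: of_nat_diff algebra_simps)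
      moreover have "t \<le> real (k - i) * t" using 3 t by simp
      moreover have "real (k - i) * t \<le> pi / 2"
        using False kt ik by (simp add: of_nat_diff algebra_simps)
      moreover from calculation(2,3) have "sin t \<le> sin (real (k - i) * t)"
        using t by (intro sin_monotone_2pi_le) auto
      ultimately show ?thesis by simp
    qed
    then show ?thesis using st by (simp add: ch)
  qed simp
next
  case infinity
  then show ?thesis using cof_inf[OF ab(3)] by (cases i) (simp_all add: cheb_two)
qed

lemma reduced_alternates:
  assumes "x \<in> lists {a, b}" "reduced x"
  shows "x = alt a b (length x) \<or> x = alt b a (length x)"
  using assms
proof (induction x rule: list.induct)
  case (Cons c x)
  have cx: "c \<in> {a, b}" "x \<in> lists {a, b}" and r: "reduced (c # x)"
    using Cons.prems by simp_all
  have x: "x = alt a b (length x) \<or> x = alt b a (length x)"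
    using Cons.IH[OF cx(2)] r reduced_suffix[of "[c]" x] by simp
  show ?case
  proof (cases x)
    case (Cons d y)
    have "c \<noteq> d"
      using not_reduced_double[of "[]" c y] r reduced_lists[OF r] Cons by auto
    moreover have "d \<in> {a, b}" using cx(2) Cons by simp
    ultimately show ?thesis using x cx(1) Cons by (cases "length x") auto
  qed (use cx in auto)
qed simp

text \<open>Coset argument for the dihedral subgroup of \<open>s\<close> and the last letter
  \<open>t\<close> of \<open>w\<close>: write \<open>w\<close> as \<open>v u\<close> with
  \<open>u\<close> in the letters \<open>s\<close>, \<open>t\<close> and \<open>v\<close> as short
  as possible. By induction \<open>v\<close> keeps both simple roots positive, and
  \<open>u @ [s]\<close> is alternating, so the root is a combination of the two images with
  Chebyshev coefficients. These are 0 or at least 1 because a reduced alternating word does not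
  exceed the label in length.\<close>

theorem reduced_snoc_pos:
  assumes "reduced (w @ [s])"
  shows "pos (act w (simple s))"
  using assms
proof (induction "length w" arbitrary: w s rule: less_induct)
  case less
  show ?case
  proof (cases w rule: rev_cases)
    case Nil
    then show ?thesis by (simp add: pos_simple)
  next
    case (snoc w0 t)
    have lists: "w @ [s] \<in> lists gens" using reduced_lists[OF less.prems] .
    then have s: "s \<in> gens" and t: "t \<in> gens" and w0: "w0 \<in> lists gens" and wl: "w \<in> lists gens"
      using snoc by auto
    have ts: "t \<noteq> s"
      using not_reduced_double[of w0 s "[]"] less.prems lists snoc by auto
    define Q where "Q v \<longleftrightarrow> (\<exists>u. u \<in> lists {s, t} \<and> eqv (v @ u) w \<and> length v + length u = length w)" for v
    have "Q w0" unfolding Q_def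
      by (rule exI[of _ "[t]"]) (use snoc word_cong.refl[OF wl] in simp)
    then obtain v where v: "Q v" and vmin: "\<And>v'. Q v' \<Longrightarrow> length v \<le> length v'"
      using ex_has_least_nat[of Q w0 length] by blast
    obtain u where u: "u \<in> lists {s, t}" "eqv (v @ u) w" "length v + length u = length w"
      using v unfolding Q_def by blast
    have ul: "u \<in> lists gens" and vl: "v \<in> lists gens" using eqv_lists[OF u(2)] by auto
    have vlen: "length v < length w" using vmin[OF \<open>Q w0\<close>] snoc by simp
    have wred: "reduced w" using reduced_prefix less.prems by blast
    have vu: "reduced (v @ u)"
      by (rule reduced_eqv[OF wred word_cong.sym[OF u(2)]]) (use u in simp)
    have "eqv ((v @ u) @ [s]) (w @ [s])"
      by (rule word_cong_append[OF u(2) word_cong.refl]) (use s in simp)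
    then have vus: "reduced ((v @ u) @ [s])"
      by (rule reduced_eqv[OF less.prems word_cong.sym]) (use u in simp)
    \<comment> \<open>Otherwise \<open>v\<close> could be written with \<open>r\<close> at its end,
      and moving that letter over to \<open>u\<close> would shorten \<open>v\<close>.\<close>
    have vr: "reduced (v @ [r])" if r: "r \<in> {s, t}" for r
    proof (rule ccontr)
      assume nr: "\<not> reduced (v @ [r])"
      have rg: "r \<in> gens" using r s t by auto
      obtain v' where v': "eqv v (v' @ [r])" "Suc (length v') = length v"
        using not_reduced_snoc[OF reduced_prefix[OF vu] rg nr] by blast
      have "eqv ((v' @ [r]) @ u) (v @ u)"
        by (rule word_cong_append[OF word_cong.sym[OF v'(1)] word_cong.refl[OF ul]])
      then have "eqv (v' @ r # u) w" using word_cong.trans[OF _ u(2)] by simp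
      then have "Q v'" unfolding Q_def
        by (intro exI[of _ "r # u"]) (use u r v' in auto)
      then show False using vmin v'(2) by fastforce
    qed
    have ps: "pos (act v (simple s))" and pt: "pos (act v (simple t))"
      using less.hyps[OF vlen vr] by auto
    let ?j = "length u"
    have us: "reduced (u @ [s])" using vus reduced_suffix[of v "u @ [s]"] by simp
    have "u @ [s] \<in> lists {s, t}" using u by auto
    then have "u @ [s] = alt s t (Suc ?j) \<or> u @ [s] = alt t s (Suc ?j)"
      using reduced_alternates[OF _ us] by simp
    then obtain c d where cd: "(c, d) = (s, t) \<or> (c, d) = (t, s)" and alt: "u @ [s] = alt c d (Suc ?j)"
      by blast
    have cdg: "c \<in> gens" "d \<in> gens" "c \<noteq> d" using cd s t ts by auto
    have us': "u = alt c d ?j" "s = (if even ?j then c else d)"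
      using alt unfolding alt_snoc by auto
    have le: "enat (Suc ?j) \<le> m c d"
    proof (cases "m c d")
      case (enat k)
      then show ?thesis using not_reduced_alt[OF cdg enat, of "Suc ?j"] us alt by fastforce
    qed simp
    then have le': "enat ?j \<le> m c d" by (cases "m c d") auto
    have "act w (simple s) = act v (act (alt c d ?j) (simple s))"
      using eqv_act[OF u(2)] us'(1) by (metis act_append)
    also have "\<dots> = (\<lambda>x. cheb (cof c d) (Suc ?j) * act v (simple c) x + cheb (cof c d) ?j * act v (simple d) x)"
      using act_alt[OF cdg(1,2), of ?j] us'(2) by (simp add: act_lin)
    finally show ?thesis
      using pos_comb[of "act v (simple c)" "act v (simple d)"] ps pt cd
        cheb_zero_or_ge_1[OF cdg le] cheb_zero_or_ge_1[OF cdg le'] by auto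
  qed
qed

lemma not_reduced_snoc_neg:
  assumes "reduced w" "s \<in> gens" "\<not> reduced (w @ [s])"
  shows "neg (act w (simple s))"
proof -
  obtain w' where w': "eqv w (w' @ [s])" "reduced (w' @ [s])"
    using not_reduced_snoc[OF assms] by blast
  have "act w (simple s) = (\<lambda>x. - act w' (simple s) x)"
    using eqv_act[OF w'(1)] assms(2) by (simp add: sigma_simple_self act_uminus)
  then show ?thesis using reduced_snoc_pos[OF w'(2)] by simp
qed

section \<open>Sign changes of roots\<close>

lemma roots_act:
  assumes "w \<in> lists gens" "v \<in> roots"
  shows "act w v \<in> roots"
proof -
  obtain u i where "v = act u (simple i)" "u \<in> lists gens" "i \<in> gens"
    using assms(2) unfolding roots_def by blast
  then have "act w v = act (w @ u) (simple i) \<and> w @ u \<in> lists gens \<and> i \<in> gens"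
    using assms(1) by simp
  then show ?thesis unfolding roots_def by blast
qed

lemma simple_root: "i \<in> gens \<Longrightarrow> simple i \<in> roots"
  unfolding roots_def by (auto intro!: exI[of _ "[]"])

lemma root_dichotomy:
  assumes "v \<in> roots"
  shows "pos v \<or> neg v"
proof -
  obtain w i where wi: "v = act w (simple i)" "w \<in> lists gens" "i \<in> gens"
    using assms unfolding roots_def by blast
  obtain w' where w': "eqv w w'" "reduced w'" using ex_reduced[OF wi(2)] by blast
  show ?thesis
    using eqv_act[OF w'(1)] wi reduced_snoc_pos[of w' i] not_reduced_snoc_neg[OF w'(2) wi(3)]
    by auto
qed

lemma root_nonzero:
  assumes "v \<in> roots"
  shows "\<exists>x. v x \<noteq> 0"
proof (rule ccontr)
  assume "\<nexists>x. v x \<noteq> 0"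
  then have v0: "v = (\<lambda>x. 0 * v x)" by auto
  obtain w i where wi: "v = act w (simple i)" "w \<in> lists gens" "i \<in> gens"
    using assms unfolding roots_def by blast
  have "simple i = act (rev w) v" using wi act_rev_act by simp
  also have "\<dots> = (\<lambda>x. 0 * act (rev w) v x)" by (subst v0) (rule act_scale)
  finally have "simple i i = 0" by (metis mult_zero_left)
  then show False by (simp add: simple_def)
qed

lemma root_support:
  assumes "v \<in> roots" "x \<notin> gens"
  shows "v x = 0"
proof -
  obtain w i where wi: "v = act w (simple i)" "w \<in> lists gens" "i \<in> gens"
    using assms unfolding roots_def by blast
  have "act w (simple i) x = 0" using wi(2)
    by (induction w) (use assms(2) wi(3) in \<open>auto simp: simple_def sigma_def\<close>)
  then show ?thesis using wi by simp
qed

lemma pos_neg_False: "v \<in> roots \<Longrightarrow> pos v \<Longrightarrow> neg v \<Longrightarrow> False"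
  using root_nonzero[of v] pos_nonneg[of v] neg_nonpos[of v] by (metis antisym)

lemma root_nonneg_pos: "v \<in> roots \<Longrightarrow> (\<And>x. 0 \<le> v x) \<Longrightarrow> pos v"
  using root_dichotomy root_nonzero neg_nonpos by (metis antisym)

lemma root_nonpos_neg: "v \<in> roots \<Longrightarrow> (\<And>x. v x \<le> 0) \<Longrightarrow> neg v"
  using root_dichotomy root_nonzero pos_nonneg by (metis antisym)

text \<open>The reflection changes only the coordinate \<open>s\<close>, so a root that turns
  negative is \<open>c\<close> times \<open>simple s\<close>. Undoing the word that produced the
  root gives \<open>1 = c * d\<close> for a coordinate \<open>d\<close> of another root; both
  factors have absolute value at least 1, so \<open>c = 1\<close>.\<close>

lemma flipped_is_simple:
  assumes v: "v \<in> roots" "pos v" and s: "s \<in> gens" and n: "neg (sigma s v)"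
  shows "v = simple s"
proof -
  have 0: "v x = 0" if "x \<noteq> s" for x
    using pos_nonneg[OF v(2), of x] neg_nonpos[OF n, of x] that by (simp add: sigma_def)
  define c where "c = v s"
  have vc: "v = (\<lambda>x. c * simple s x)" using 0 by (auto simp: c_def simple_def)
  have c1: "c \<ge> 1" using root_nonzero[OF v(1)] 0 pos_ge_1[OF v(2)] unfolding c_def by metis
  obtain w i where wi: "v = act w (simple i)" "w \<in> lists gens" "i \<in> gens"
    using v(1) unfolding roots_def by blast
  let ?d = "act (rev w) (simple s)"
  have "simple i = act (rev w) v" using wi act_rev_act by simp
  also have "\<dots> = (\<lambda>x. c * ?d x)" unfolding vc by (rule act_scale)
  finally have cd: "1 = c * ?d i" by (metis simple_def)
  have "?d \<in> roots" using roots_act[OF _ simple_root[OF s], of "rev w"] wi by simp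
  then consider "?d i = 0" | "?d i \<ge> 1" | "?d i \<le> - 1"
    using root_dichotomy[of ?d] unfolding pos_def by fastforce
  then have "c \<le> 1"
  proof cases
    case 2
    then have "c * 1 \<le> c * ?d i" using c1 by (intro mult_left_mono) auto
    then show ?thesis using cd by simp
  next
    case 3
    then have "c * ?d i \<le> c * (- 1)" using c1 by (intro mult_left_mono) auto
    then show ?thesis using cd c1 by simp
  qed (use cd in auto)
  then show ?thesis using vc c1 by simp
qed

text \<open>By \<open>flipped_is_simple\<close> every letter of \<open>Y\<close> adds at most one
  root to the set.\<close>

lemma finite_flipped:
  assumes "Y \<in> lists gens"
  shows "finite {v \<in> roots. pos v \<and> neg (act Y v)}"
  using assms
proof (induction Y)
  case Nil
  have "{v \<in> roots. pos v \<and> neg (act [] v)} = {}" using pos_neg_False by auto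
  then show ?case by (simp only: finite.emptyI)
next
  case (Cons s Y)
  have "{v \<in> roots. pos v \<and> neg (act (s # Y) v)}
    \<subseteq> insert (act (rev Y) (simple s)) {v \<in> roots. pos v \<and> neg (act Y v)}"
  proof
    fix v assume v: "v \<in> {v \<in> roots. pos v \<and> neg (act (s # Y) v)}"
    have Yv: "act Y v \<in> roots" using v Cons.hyps roots_act by blast
    show "v \<in> insert (act (rev Y) (simple s)) {v \<in> roots. pos v \<and> neg (act Y v)}"
    proof (cases "pos (act Y v)")
      case True
      then have "act Y v = simple s"
        using flipped_is_simple[OF Yv True Cons.hyps(1)] v by simp
      then have "v = act (rev Y) (simple s)" using act_rev_act[OF Cons.hyps(2), of v] by simp
      then show ?thesis by simp
    qed (use v Yv root_dichotomy in blast)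
  qed
  then show ?case using Cons.IH finite_subset by blast
qed

section \<open>The invariant form and pairs of roots that are flipped together\<close>

definition bil :: "(nat \<Rightarrow> real) \<Rightarrow> (nat \<Rightarrow> real) \<Rightarrow> real" where
  "bil u v = - (\<Sum>i\<in>gens. u i * phi i v)"

lemma bil_sym: "bil u v = bil v u"
proof -
  have "(\<Sum>i\<in>gens. u i * phi i v) = (\<Sum>i\<in>gens. \<Sum>j\<in>gens. u i * (cof i j * v j))"
    by (simp add: phi_def sum_distrib_left)
  also have "\<dots> = (\<Sum>j\<in>gens. \<Sum>i\<in>gens. u i * (cof i j * v j))"
    by (rule sum.swap)
  also have "\<dots> = (\<Sum>j\<in>gens. \<Sum>i\<in>gens. v j * (cof j i * u i))"
    by (intro sum.cong refl) (use cof_sym in auto)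
  also have "\<dots> = (\<Sum>i\<in>gens. v i * phi i u)"
    by (simp add: phi_def sum_distrib_left)
  finally show ?thesis by (simp add: bil_def)
qed

lemma bil_lin: "bil w (\<lambda>x. a * u x + b * v x) = a * bil w u + b * bil w v"
  unfolding bil_def phi_lin by (simp add: sum_distrib_left sum.distrib algebra_simps)

lemma bil_lin2: "bil (\<lambda>x. a * u x + b * v x) w = a * bil u w + b * bil v w"
  using bil_lin bil_sym by metis

lemma bil_simple: "s \<in> gens \<Longrightarrow> bil (simple s) v = - phi s v"
  unfolding bil_def simple_def by (simp add: if_distrib[of "\<lambda>x. x * _"] cong: if_cong)

lemma bil_simple2: "s \<in> gens \<Longrightarrow> bil v (simple s) = - phi s v"
  using bil_simple bil_sym by metis

lemma bil_sigma: "s \<in> gens \<Longrightarrow> bil (sigma s u) (sigma s v) = bil u v"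
  unfolding sigma_eq bil_lin bil_lin2 by (simp add: bil_simple bil_simple2 phi_simple)

lemma bil_act: "w \<in> lists gens \<Longrightarrow> bil (act w u) (act w v) = bil u v"
  by (induction w) (auto simp: bil_sigma)

text \<open>\<open>bil\<close> is twice the standard form, whose value on a simple root paired with
  itself is 1.\<close>

lemma bil_root:
  assumes "v \<in> roots"
  shows "bil v v = 2"
proof -
  obtain w i where "v = act w (simple i)" "w \<in> lists gens" "i \<in> gens"
    using assms unfolding roots_def by blast
  then show ?thesis by (simp add: bil_act bil_simple phi_simple)
qed

text \<open>The reflection in \<open>b = act w (simple i)\<close> is the conjugate of
  \<open>sigma i\<close> by \<open>w\<close>.\<close>

lemma reflected_root:
  assumes "b \<in> roots" "v \<in> roots"
  shows "(\<lambda>x. 1 * v x + (- bil b v) * b x) \<in> roots"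
proof -
  obtain w i where wi: "b = act w (simple i)" "w \<in> lists gens" "i \<in> gens"
    using assms(1) unfolding roots_def by blast
  have "bil b v = bil (act w (simple i)) (act w (act (rev w) v))"
    using wi act_act_rev by simp
  also have "\<dots> = - phi i (act (rev w) v)" using wi by (simp add: bil_act bil_simple)
  finally have ph: "phi i (act (rev w) v) = - bil b v" by simp
  have "act (w @ [i] @ rev w) v = act w (\<lambda>x. 1 * act (rev w) v x + (- bil b v) * simple i x)"
    by (simp add: sigma_eq ph)
  also have "\<dots> = (\<lambda>x. 1 * v x + (- bil b v) * b x)"
    unfolding act_lin using wi act_act_rev by simp
  finally show ?thesis using roots_act[OF _ assms(2), of "w @ [i] @ rev w"] wi by simp
qed

text \<open>Otherwise the infinite dihedral group generated by the two reflections would produce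
  infinitely many positive roots in the cone of \<open>b\<close> and \<open>b'\<close>, all flipped by \<open>Y\<close>.\<close>

lemma flipped_pair:
  assumes b: "b \<in> roots" "pos b" and b': "b' \<in> roots" "pos b'" and Y: "Y \<in> lists gens"
    and nb: "neg (act Y b)" and nb': "neg (act Y b')"
  shows "bil b b' > - 2"
proof (rule ccontr)
  assume "\<not> bil b b' > - 2"
  define e where "e = - bil b b'"
  then have e: "e \<ge> 2" using \<open>\<not> bil b b' > - 2\<close> by simp
  have e': "bil b' b = - e" using bil_sym e_def by simp
  \<comment> \<open>Reflecting in the root with the smaller coefficient replaces that coefficient by
    one which, as \<open>e \<ge> 2\<close>, exceeds the other by at least the old gap. So the gap
    stays at least 1 and the sum of the coefficients grows by at least 1.\<close>
  have gen: "\<exists>x y. 0 \<le> x \<and> 0 \<le> y \<and> 1 \<le> \<bar>x - y\<bar> \<and> real k \<le> x + y \<and>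
    (\<lambda>i. x * b i + y * b' i) \<in> roots" for k
  proof (induction k)
    case 0
    show ?case using b by (intro exI[of _ 1] exI[of _ 0]) auto
  next
    case (Suc k)
    then obtain x y where xy: "0 \<le> x" "0 \<le> y" "1 \<le> \<bar>x - y\<bar>" "real k \<le> x + y"
      "(\<lambda>i. x * b i + y * b' i) \<in> roots" by blast
    show ?case
    proof (cases "x \<ge> y")
      case True
      have "bil b' (\<lambda>i. x * b i + y * b' i) = - e * x + 2 * y"
        unfolding bil_lin by (simp add: e' bil_root[OF b'(1)])
      with reflected_root[OF b'(1) xy(5)]
      have r: "(\<lambda>i. x * b i + (e * x - y) * b' i) \<in> roots"
        by (simp add: algebra_simps)
      have "2 * x \<le> e * x" using e xy by (intro mult_right_mono) auto
      then have "0 \<le> e * x - y" "1 \<le> \<bar>x - (e * x - y)\<bar>" "real (Suc k) \<le> x + (e * x - y)"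
        using xy True by linarith+
      then show ?thesis using r xy(1) by blast
    next
      case False
      have "bil b (\<lambda>i. x * b i + y * b' i) = 2 * x - e * y"
        unfolding bil_lin by (simp add: e_def bil_root[OF b(1)])
      with reflected_root[OF b(1) xy(5)]
      have r: "(\<lambda>i. (e * y - x) * b i + y * b' i) \<in> roots"
        by (simp add: algebra_simps)
      have "2 * y \<le> e * y" using e xy by (intro mult_right_mono) auto
      then have "0 \<le> e * y - x" "1 \<le> \<bar>(e * y - x) - y\<bar>" "real (Suc k) \<le> (e * y - x) + y"
        using xy False by linarith+
      then show ?thesis using r xy(2) by blast
    qed
  qed
  \<comment> \<open>The height of a root. It is bounded on the finite set of roots flipped by
    \<open>Y\<close>, but at least \<open>x + y\<close> on the roots just built.\<close>
  define h where "h v = (\<Sum>i\<in>gens. v i)" for v :: "nat \<Rightarrow> real"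
  have h1: "h v \<ge> 1" if v: "v \<in> roots" "pos v" for v
  proof -
    obtain x where x: "v x \<noteq> 0" "x \<in> gens"
      using root_nonzero[OF v(1)] root_support[OF v(1)] by blast
    have "1 \<le> v x" using pos_ge_1[OF v(2) x(1)] .
    also have "\<dots> \<le> h v" unfolding h_def
      by (rule member_le_sum) (use x pos_nonneg[OF v(2)] in auto)
    finally show ?thesis .
  qed
  let ?F = "{v \<in> roots. pos v \<and> neg (act Y v)}"
  obtain k :: nat where k: "Max (insert 0 (h ` ?F)) < real k"
    using reals_Archimedean2 by blast
  obtain x y where xy: "0 \<le> x" "0 \<le> y" "real k \<le> x + y"
    and r: "(\<lambda>i. x * b i + y * b' i) \<in> roots" using gen[of k] by blast
  let ?v = "\<lambda>i. x * b i + y * b' i"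
  have "pos ?v"
    by (rule root_nonneg_pos[OF r]) (use xy pos_nonneg[OF b(2)] pos_nonneg[OF b'(2)] in auto)
  moreover have "neg (act Y ?v)"
  proof (rule root_nonpos_neg[OF roots_act[OF Y r]])
    fix i
    show "act Y ?v i \<le> 0" unfolding act_lin
      using xy neg_nonpos[OF nb] neg_nonpos[OF nb'] by (simp add: add_nonpos_nonpos mult_nonneg_nonpos)
  qed
  ultimately have "h ?v \<le> Max (insert 0 (h ` ?F))"
    using r finite_flipped[OF Y] by (intro Max_ge) auto
  moreover have "h ?v = x * h b + y * h b'"
    by (simp add: h_def sum.distrib sum_distrib_left)
  moreover have "x * 1 + y * 1 \<le> x * h b + y * h b'"
    using xy h1 b b' by (intro add_mono mult_left_mono) auto
  ultimately show False using k xy by simp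
qed

text \<open>If \<open>x = phi s b\<close> were at least 2, then \<open>act Y (sigma s b)\<close>
  would be \<open>act Y b\<close> plus a positive multiple of the positive root
  \<open>act Y (simple s)\<close>, so \<open>Y\<close> would make \<open>b\<close> negative along
  with \<open>sigma s b\<close>. Their product \<open>2 - x * x\<close> is at most
  \<open>- 2\<close>, which \<open>flipped_pair\<close> forbids.\<close>

lemma crossing_bound:
  assumes b: "b \<in> roots" "pos b" and s: "s \<in> gens" and Y: "Y \<in> lists gens"
    and ps: "pos (act Y (simple s))" and ng: "neg (act Y (sigma s b))"
  shows "phi s b < 2"
proof (rule ccontr)
  assume "\<not> phi s b < 2"
  define x where "x = phi s b"
  have x: "x \<ge> 2" using \<open>\<not> phi s b < 2\<close> x_def by simp
  have sb: "sigma s b = (\<lambda>i. 1 * b i + x * simple s i)" by (simp add: sigma_eq x_def)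
  have sbr: "sigma s b \<in> roots" using roots_act[of "[s]" b] b s by simp
  have sbp: "pos (sigma s b)"
    by (rule root_nonneg_pos[OF sbr])
      (use pos_nonneg[OF b(2)] pos_nonneg[OF pos_simple] x in \<open>simp add: sb\<close>)
  have "act Y b i \<le> 0" for i
    using neg_nonpos[OF ng, of i] pos_nonneg[OF ps, of i] x
    unfolding sb act_lin by (smt (verit) mult_nonneg_nonneg)
  then have "neg (act Y b)" using root_nonpos_neg[OF roots_act[OF Y b(1)]] by blast
  then have "bil b (sigma s b) > - 2"
    using flipped_pair[OF b sbr sbp Y _ ng] by blast
  moreover have "bil b (sigma s b) = 2 - x * x"
    unfolding sb bil_lin using s by (simp add: bil_root[OF b(1)] bil_simple2 x_def)
  moreover have "2 * 2 \<le> x * x" using x by (intro mult_mono) auto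
  ultimately show False by simp
qed

end

section \<open>Walks along edges labelled infinity\<close>

lemma append_eq_append_split:
  "a @ b = c @ d \<Longrightarrow> length a \<le> length c \<Longrightarrow> \<exists>z. c = a @ z \<and> b = z @ d"
  by (auto simp: append_eq_append_conv2)

context coxeter
begin

definition inf_adj :: "nat \<Rightarrow> nat \<Rightarrow> bool" where
  "inf_adj s t \<longleftrightarrow> s \<in> gens \<and> t \<in> gens \<and> s \<noteq> t \<and> m s t = \<infinity>"

lemma inf_adj_sym: "inf_adj s t \<Longrightarrow> inf_adj t s"
  unfolding inf_adj_def using m_sym by metis

definition walk :: "nat list \<Rightarrow> bool" where
  "walk xs \<longleftrightarrow> successively inf_adj xs \<and> xs \<in> lists gens"

text \<open>The last letter is set apart because a letter is known to leave the support only when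
  the walk goes on after it (\<open>walk_step_support\<close>).\<close>

definition covering :: "nat list \<Rightarrow> bool" where
  "covering p \<longleftrightarrow> walk p \<and> (\<exists>q z. p = q @ [z] \<and> set q = gens)"

lemma walk_prefix: "walk (x @ y) \<Longrightarrow> walk x"
  unfolding walk_def by (simp add: successively_append_iff)

lemma walk_suffix: "walk (x @ y) \<Longrightarrow> walk y"
  unfolding walk_def by (simp add: successively_append_iff)

lemma walk_rev: "walk x \<Longrightarrow> walk (rev x)"
  unfolding walk_def successively_rev using successively_mono[of inf_adj x] inf_adj_sym by auto

definition inf_free :: "(nat \<Rightarrow> real) \<Rightarrow> bool" where
  "inf_free b \<longleftrightarrow> (\<forall>s t. inf_adj s t \<longrightarrow> b s = 0 \<or> b t = 0)"

text \<open>Traces the root \<open>b\<close> of a wall along a word, undoing one letter at a time.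
  The bound 2 is the one that \<open>crossing_bound\<close> provides along reduced words.\<close>

fun uncrossed :: "(nat \<Rightarrow> real) \<Rightarrow> nat list \<Rightarrow> bool" where
  "uncrossed b [] \<longleftrightarrow> b \<in> roots \<and> pos b"
| "uncrossed b (s # y) \<longleftrightarrow>
     b \<in> roots \<and> pos b \<and> s \<in> gens \<and> phi s b < 2 \<and> uncrossed (sigma s b) y"

lemma uncrossed_root: "uncrossed b y \<Longrightarrow> b \<in> roots \<and> pos b"
  by (cases y) auto

text \<open>\<open>crossing_bound\<close> is applied with the inverse of \<open>y e\<close> for the
  remaining word \<open>y\<close>: that element sends the next root \<open>act y (simple e)\<close>
  to \<open>- simple e\<close>, while it keeps \<open>simple s\<close> positive because the word
  read backwards is reduced.\<close>

lemma reduced_uncrossed: "reduced (y @ [e]) \<Longrightarrow> uncrossed (act y (simple e)) y"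
proof (induction y)
  case Nil
  then show ?case using reduced_lists[of "[e]"] simple_root pos_simple by simp
next
  case (Cons s y)
  let ?b = "act (s # y) (simple e)"
  have l: "s \<in> gens" "y \<in> lists gens" "e \<in> gens" using reduced_lists[OF Cons.prems] by auto
  have red: "reduced (y @ [e])" using Cons.prems reduced_suffix[of "[s]" "y @ [e]"] by simp
  have b: "?b \<in> roots" using roots_act[of "s # y"] simple_root l by simp
  have bp: "pos ?b" using reduced_snoc_pos[OF Cons.prems] .
  have sb: "sigma s ?b = act y (simple e)" using l by (simp add: sigma_sigma)
  have "reduced (rev (y @ [e]) @ [s])" using reduced_rev[OF Cons.prems] by simp
  then have ps: "pos (act (rev (y @ [e])) (simple s))" by (rule reduced_snoc_pos)
  have "act (rev (y @ [e])) (sigma s ?b) = (\<lambda>x. - simple e x)"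
    unfolding sb using l act_rev_act[of y] by (simp add: sigma_simple_self)
  then have ng: "neg (act (rev (y @ [e])) (sigma s ?b))" by (simp add: pos_simple)
  have "phi s ?b < 2"
    by (rule crossing_bound[OF b bp l(1) _ ps ng]) (use l in simp)
  then show ?case using b bp l sb Cons.IH[OF red] by simp
qed

text \<open>The neighbour \<open>s\<close> contributes \<open>2 * b s \<ge> 2\<close>. The only
  negative coefficient, \<open>cof t t\<close>, meets the coordinate \<open>b t = 0\<close>.\<close>

lemma phi_ge_2:
  assumes "pos b" "inf_adj s t" "b t = 0" "b s \<noteq> 0"
  shows "phi t b \<ge> 2"
proof -
  have st: "s \<in> gens" "t \<in> gens" "s \<noteq> t" "cof t s = 2"
    using assms(2) cof_inf cof_sym unfolding inf_adj_def by auto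
  have "cof t s * b s \<le> phi t b" unfolding phi_def
  proof (rule member_le_sum)
    fix j assume "j \<in> gens - {s}"
    then show "0 \<le> cof t j * b j"
      using cof_nonneg[of t j] st pos_nonneg[OF assms(1), of j] assms(3) by (cases "j = t") auto
  qed (use st in auto)
  moreover have "1 \<le> b s" using pos_ge_1 assms by blast
  ultimately show ?thesis using st by simp
qed

text \<open>A letter entering the support beside an \<infinity>-neighbour would need
  \<open>phi s b \<ge> 2\<close>.\<close>

lemma inf_free_step:
  assumes "uncrossed b (s # y)" "inf_free b"
  shows "inf_free (sigma s b)"
proof -
  have *: "b t = 0" if "inf_adj s t" "sigma s b s \<noteq> 0" for t
  proof (rule ccontr)
    assume "b t \<noteq> 0"
    then have "b s = 0" using assms(2) that(1) unfolding inf_free_def by blast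
    then have "phi s b \<ge> 2"
      using phi_ge_2[of b t s] assms(1) inf_adj_sym[OF that(1)] \<open>b t \<noteq> 0\<close> by auto
    then show False using assms(1) by simp
  qed
  show ?thesis unfolding inf_free_def
  proof (intro allI impI)
    fix u t assume ut: "inf_adj u t"
    then have "u \<noteq> t" by (simp add: inf_adj_def)
    consider "u = s" | "t = s" | "u \<noteq> s" "t \<noteq> s" by blast
    then show "sigma s b u = 0 \<or> sigma s b t = 0"
    proof cases
      case 1
      then show ?thesis using * ut \<open>u \<noteq> t\<close> by (auto simp: sigma_def)
    next
      case 2
      then show ?thesis using *[of u] inf_adj_sym[OF ut] \<open>u \<noteq> t\<close> by (auto simp: sigma_def)
    next
      case 3
      then show ?thesis using ut assms(2) by (simp add: sigma_def inf_free_def)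
    qed
  qed
qed

text \<open>If \<open>s\<close> were in the support after its own reflection, independence of the
  support would keep \<open>t\<close> out of it, and the next step would meet
  \<open>phi t \<ge> 2\<close>.\<close>

lemma walk_step_support:
  assumes "uncrossed b (s # t # y)" "inf_adj s t" "inf_free b"
  shows "sigma s b s = 0"
proof (rule ccontr)
  assume n: "sigma s b s \<noteq> 0"
  have "inf_free (sigma s b)" using inf_free_step assms by blast
  then have "sigma s b t = 0" using n assms(2) unfolding inf_free_def by blast
  then have "phi t (sigma s b) \<ge> 2"
    using phi_ge_2[of "sigma s b" s t] n assms(1,2) by simp
  then show False using assms(1) by simp
qed

text \<open>Each letter read is erased and no other coordinate changes, so the support can only
  shrink.\<close>

lemma walk_support:
  assumes "uncrossed b (q @ z # y)" "walk (q @ [z])" "inf_free b"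
    and "act (rev q) b x \<noteq> 0"
  shows "b x \<noteq> 0 \<and> x \<notin> set q"
  using assms
proof (induction q arbitrary: b)
  case (Cons s q)
  obtain t r where t: "q @ z # y = t # r" "q @ [z] = t # tl (q @ [z])" by (cases q) auto
  have adj: "inf_adj s t" using Cons.prems(2) t(2) unfolding walk_def
    by (metis append_Cons successively.simps(3))
  have s0: "sigma s b s = 0"
    using walk_step_support[of b s t r] Cons.prems(1,3) adj t(1) by simp
  have "sigma s b x \<noteq> 0 \<and> x \<notin> set q"
  proof (rule Cons.IH)
    show "uncrossed (sigma s b) (q @ z # y)" using Cons.prems(1) by simp
    show "walk (q @ [z])" using Cons.prems(2) walk_suffix[of "[s]"] by simp
    show "inf_free (sigma s b)" using inf_free_step Cons.prems by simp
    show "act (rev q) (sigma s b) x \<noteq> 0" using Cons.prems(4) by simp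
  qed
  then show ?case using s0 by (auto simp: sigma_def split: if_splits)
qed simp

lemma uncrossed_append:
  "uncrossed b (w @ y) \<Longrightarrow> inf_free b \<Longrightarrow> w \<in> lists gens \<and> uncrossed (act (rev w) b) y \<and> inf_free (act (rev w) b)"
proof (induction w arbitrary: b)
  case (Cons s w)
  then show ?case using inf_free_step[of b s "w @ y"] Cons.IH[of "sigma s b"] by simp
qed simp

text \<open>Along a covering walk the support of an uncrossed root loses every letter.\<close>

lemma covering_blocks:
  assumes red: "reduced (w @ p @ v @ [e])" and p: "covering p" and a: "a \<in> gens"
  shows "act (w @ p @ v) (simple e) \<noteq> simple a"
proof
  assume eq: "act (w @ p @ v) (simple e) = simple a"
  have "uncrossed (simple a) (w @ p @ v)"
    using reduced_uncrossed[of "w @ p @ v" e] red eq by simp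
  moreover have "inf_free (simple a)"
    unfolding inf_free_def inf_adj_def simple_def by auto
  ultimately have u: "uncrossed (act (rev w) (simple a)) (p @ v)" "inf_free (act (rev w) (simple a))"
    using uncrossed_append by blast+
  obtain q z where q: "p = q @ [z]" "set q = gens" "walk p" using p unfolding covering_def by blast
  let ?b = "act (rev w) (simple a)"
  have "act (rev q) ?b \<in> roots"
    using roots_act[of "rev q" ?b] uncrossed_root[OF u(1)] q by (auto simp: in_lists_conv_set)
  then obtain x where x: "act (rev q) ?b x \<noteq> 0" "x \<in> gens"
    using root_nonzero root_support by metis
  then show False using walk_support[of ?b q z v x] u q by simp
qed

text \<open>In the group \<open>c y = y e\<close>; the inverse of \<open>y\<close> takes
  \<open>simple c\<close> to the positive root \<open>simple e\<close>, so \<open>c\<close> is not a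
  left descent of \<open>y\<close>.\<close>

lemma reduced_Cons_simple:
  assumes red: "reduced (y @ [e])" and c: "c \<in> gens" and eq: "act y (simple e) = simple c"
  shows "reduced (c # y)"
proof (rule ccontr)
  assume n: "\<not> reduced (c # y)"
  have y: "reduced y" "y \<in> lists gens" "e \<in> gens"
    using red reduced_prefix reduced_lists[OF red] by auto
  have "\<not> reduced (rev y @ [c])" using n reduced_rev[of "rev y @ [c]"] by auto
  then have "neg (act (rev y) (simple c))" using not_reduced_snoc_neg[OF reduced_rev[OF y(1)] c] by blast
  moreover have "act (rev y) (simple c) = simple e" unfolding eq[symmetric] using act_rev_act y by simp
  ultimately show False using pos_neg_False simple_root pos_simple y by metis
qed

text \<open>\<open>crossing_bound\<close> for the word \<open>c # y\<close>: if the image were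
  \<open>simple c\<close>, undoing \<open>s\<close> and prepending \<open>c\<close> would turn it
  into \<open>- simple c\<close>.\<close>

lemma crossing_blocks:
  assumes red: "reduced (c # y @ [s])" and b: "b \<in> roots" "pos b" and phi: "phi s b \<ge> 2"
  shows "act (y @ [s]) b \<noteq> simple c"
proof
  assume eq: "act (y @ [s]) b = simple c"
  have l: "c \<in> gens" "y \<in> lists gens" "s \<in> gens" using reduced_lists[OF red] by auto
  have "phi s b < 2"
  proof (rule crossing_bound[OF b, of s "c # y"])
    show "pos (act (c # y) (simple s))" using reduced_snoc_pos[of "c # y" s] red by simp
    show "neg (act (c # y) (sigma s b))" using eq l by (simp add: sigma_simple_self pos_simple)
  qed (use l in auto)
  then show False using phi by simp
qed

text \<open>A generator cannot be moved through a word that ends with an \<infinity>-edge, since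
  \<open>phi s (simple t) = 2\<close> already reaches the bound.\<close>

lemma inf_step_blocks:
  assumes red: "reduced (y @ [s, t])" and adj: "inf_adj s t" and c: "c \<in> gens"
  shows "act (y @ [s]) (simple t) \<noteq> simple c"
proof
  assume eq: "act (y @ [s]) (simple t) = simple c"
  have st: "t \<in> gens" "cof s t = 2" using adj cof_inf unfolding inf_adj_def by auto
  have "reduced (c # y @ [s])" using reduced_Cons_simple[of "y @ [s]" t c] red c eq by simp
  then show False
    using crossing_blocks[of c y s "simple t"] eq st simple_root pos_simple by (simp add: phi_simple)
qed

text \<open>Exchange condition in terms of roots: \<open>e\<close> is the letter of \<open>w\<close>
  at which \<open>b\<close> turns negative, and just before that the root is simple.\<close>

lemma exchange_prefix:
  assumes "w \<in> lists gens" "b \<in> roots" "pos b" "neg (act (rev w) b)"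
  shows "\<exists>y e r. w = y @ [e] @ r \<and> act (rev y) b = simple e"
  using assms
proof (induction w arbitrary: b rule: list.induct)
  case Nil
  then show ?case using pos_neg_False by auto
next
  case (Cons a w)
  have a: "a \<in> gens" "w \<in> lists gens" using Cons.prems by auto
  have r: "sigma a b \<in> roots" using roots_act[of "[a]" b] a Cons.prems by simp
  show ?case
  proof (cases "pos (sigma a b)")
    case True
    obtain y e r where "w = y @ [e] @ r" "act (rev y) (sigma a b) = simple e"
      using Cons.IH[OF a(2) r True] Cons.prems(4) by auto
    then show ?thesis by (intro exI[of _ "a # y"] exI[of _ e] exI[of _ r]) simp
  next
    case False
    then have "b = simple a"
      using flipped_is_simple[OF Cons.prems(2,3) a(1)] root_dichotomy[OF r] by blast
    then show ?thesis by (intro exI[of _ "[]"] exI[of _ a] exI[of _ w]) simp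
  qed
qed

text \<open>The equation \<open>act y (simple e) = simple c\<close> says that
  \<open>c y = y e\<close> in the group. Thus a left descent of \<open>w\<close> comes from a single
  letter of \<open>w\<close> moved to the front.\<close>

lemma left_descent_prefix:
  assumes red: "reduced w" and c: "c \<in> gens" and n: "\<not> reduced (c # w)"
  shows "\<exists>y e r. w = y @ [e] @ r \<and> act y (simple e) = simple c"
proof -
  have wl: "w \<in> lists gens" using reduced_lists[OF red] .
  have "\<not> reduced (rev w @ [c])" using n reduced_rev[of "rev w @ [c]"] by auto
  then have "neg (act (rev w) (simple c))" using not_reduced_snoc_neg[OF reduced_rev[OF red] c] by blast
  then obtain y e r where y: "w = y @ [e] @ r" "act (rev y) (simple c) = simple e"
    using exchange_prefix[OF wl simple_root[OF c] pos_simple] by blast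
  have "act y (simple e) = simple c" unfolding y(2)[symmetric] using act_act_rev y(1) wl by simp
  then show ?thesis using y(1) by blast
qed

text \<open>\<open>violation P w\<close>: replacing a factor \<open>y e\<close> of \<open>w\<close> by the equivalent word \<open>a y\<close> puts \<open>a\<close> in the
  place of a letter that \<open>P\<close> ranks above it. For \<open>P\<close> empty \<open>Lang P\<close> consists of all geodesic
  words, for \<open>P\<close> the order of the generators it is the ShortLex language.\<close>

definition violation :: "(nat \<Rightarrow> nat \<Rightarrow> bool) \<Rightarrow> nat list \<Rightarrow> bool" where
  "violation P w \<longleftrightarrow> (\<exists>x y e r a. w = x @ y @ [e] @ r \<and> y \<noteq> [] \<and> a \<in> gens \<and>
     P a (hd y) \<and> act y (simple e) = simple a)"

definition Lang :: "(nat \<Rightarrow> nat \<Rightarrow> bool) \<Rightarrow> nat list set" where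
  "Lang P = {w. reduced w \<and> \<not> violation P w}"

section \<open>Factor-closedness and synchronization of the languages\<close>

lemma violation_context: "violation P w \<Longrightarrow> violation P (u @ w @ v)"
proof -
  assume "violation P w"
  then obtain x y e r a where *: "w = x @ y @ [e] @ r" "y \<noteq> []" "a \<in> gens" "P a (hd y)"
    "act y (simple e) = simple a" unfolding violation_def by blast
  then have "u @ w @ v = (u @ x) @ y @ [e] @ (r @ v)" by simp
  then show ?thesis unfolding violation_def using * by blast
qed

lemma Lang_factor: "u @ w @ v \<in> Lang P \<Longrightarrow> w \<in> Lang P"
  unfolding Lang_def using reduced_factor violation_context by blast

lemma Lang_prefix: "w @ v \<in> Lang P \<Longrightarrow> w \<in> Lang P"
  using Lang_factor[of "[]"] by simp

lemma Lang_suffix: "u @ w \<in> Lang P \<Longrightarrow> w \<in> Lang P"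
  using Lang_factor[of u w "[]"] by simp

lemma Lang_reduced: "w \<in> Lang P \<Longrightarrow> reduced w"
  by (simp add: Lang_def)

lemma violation_snoc:
  assumes "violation P (u @ [t])" "\<not> violation P u"
  shows "\<exists>x y a. u = x @ y \<and> y \<noteq> [] \<and> a \<in> gens \<and> P a (hd y) \<and> act y (simple t) = simple a"
proof -
  obtain x y e r a where *: "u @ [t] = x @ y @ [e] @ r" "y \<noteq> []" "a \<in> gens" "P a (hd y)"
    "act y (simple e) = simple a" using assms(1) unfolding violation_def by blast
  have "r = []"
  proof (rule ccontr)
    assume "r \<noteq> []"
    then have "u = x @ y @ [e] @ butlast r" using *(1)
      by (metis append_is_Nil_conv butlast_append butlast_snoc list.distinct(1))
    then have "violation P u" unfolding violation_def using * by blast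
    then show False using assms(2) by simp
  qed
  then show ?thesis using * by (intro exI[of _ x] exI[of _ y] exI[of _ a]) auto
qed

text \<open>A violating factor that misses the first or the last letter is contained in one of the
  two shorter words, so it must stretch over the whole word.\<close>

lemma violation_ends:
  assumes "violation P (c # u @ [t])" "\<not> violation P (c # u)" "\<not> violation P (u @ [t])"
  shows "\<exists>a\<in>gens. act (c # u) (simple t) = simple a"
proof -
  obtain x y a where *: "c # u = x @ y" "y \<noteq> []" "a \<in> gens" "P a (hd y)" "act y (simple t) = simple a"
    using violation_snoc[of P "c # u" t] assms by auto
  have "x = []"
  proof (rule ccontr)
    assume "x \<noteq> []"
    then have "u @ [t] = tl x @ y @ [t] @ []" using *(1) by (cases x) auto
    then have "violation P (u @ [t])" unfolding violation_def using * by blast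
    then show False using assms(3) by simp
  qed
  then show ?thesis using * by auto
qed

text \<open>By induction the word lies in the language after removal of either end letter, so only
  an obstruction involving both ends remains. Failure to be reduced and a violation then both say
  that the simple root of the last letter is carried to a simple root across
  \<open>p\<close>.\<close>

lemma Lang_sync:
  assumes "covering p" "u @ p \<in> Lang P" "p @ v \<in> Lang P"
  shows "u @ p @ v \<in> Lang P"
  using assms(2,3)
proof (induction "length u + length v" arbitrary: u v rule: less_induct)
  case less
  show ?case
  proof (cases "u = [] \<or> v = []")
    case True
    then show ?thesis using less.prems by auto
  next
    case False
    then obtain c u' v' t where uv: "u = c # u'" "v = v' @ [t]"
      by (metis list.exhaust rev_exhaust)
    let ?y = "u' @ p @ v'"
    have "u' @ p \<in> Lang P" using less.prems(1) uv Lang_suffix[of "[c]"] by simp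
    then have 1: "u' @ p @ v \<in> Lang P" using less.hyps[of u' v] less.prems uv by simp
    have "p @ v' \<in> Lang P" using less.prems(2) uv Lang_prefix[of "p @ v'" "[t]"] by simp
    then have 2: "u @ p @ v' \<in> Lang P" using less.hyps[of u v'] less.prems uv by simp
    have 1: "?y @ [t] \<in> Lang P" and 2: "c # ?y \<in> Lang P" using 1 2 uv by auto
    have rt: "reduced (?y @ [t])" and rc: "reduced (c # ?y)" using 1 2 Lang_reduced by auto
    have c: "c \<in> gens" and t: "t \<in> gens" and yl: "?y \<in> lists gens"
      using reduced_lists[OF rt] reduced_lists[OF rc] by auto
    have r: "reduced (c # ?y @ [t])"
    proof (rule ccontr)
      assume n: "\<not> reduced (c # ?y @ [t])"
      have "neg (act (c # ?y) (simple t))"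
        using not_reduced_snoc_neg[OF rc t] n by simp
      then have "act ?y (simple t) = simple c"
        using flipped_is_simple[of "act ?y (simple t)" c] reduced_snoc_pos[OF rt] c
          roots_act[OF yl simple_root[OF t]] by simp
      then show False using covering_blocks[of u' p v' t c] rt assms(1) c by simp
    qed
    have "\<not> violation P (c # ?y @ [t])"
    proof
      assume "violation P (c # ?y @ [t])"
      then obtain a where "a \<in> gens" "act (c # ?y) (simple t) = simple a"
        using violation_ends[of P c ?y t] 1 2 unfolding Lang_def by auto
      then show False using covering_blocks[of "c # u'" p v' t a] r assms(1) by simp
    qed
    then show ?thesis using r uv unfolding Lang_def by simp
  qed
qed

text \<open>Otherwise \<open>u s\<close> would flip both \<open>simple s\<close> and
  \<open>simple t\<close>, whose product is exactly the forbidden value \<open>- 2\<close>.\<close>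

lemma inf_adj_snoc:
  assumes red: "reduced (u @ [s])" and adj: "inf_adj s t"
  shows "reduced (u @ [s, t])"
proof (rule ccontr)
  assume n: "\<not> reduced (u @ [s, t])"
  have st: "s \<in> gens" "t \<in> gens" "cof s t = 2" using adj cof_inf unfolding inf_adj_def by auto
  have ul: "u @ [s] \<in> lists gens" using reduced_lists[OF red] .
  have "neg (act (u @ [s]) (simple t))" using not_reduced_snoc_neg[OF red st(2)] n by simp
  moreover have "neg (act (u @ [s]) (simple s))"
    using reduced_snoc_pos[OF red] st by (simp add: sigma_simple_self act_uminus)
  ultimately have "bil (simple s) (simple t) > - 2"
    using flipped_pair[OF simple_root[OF st(1)] pos_simple simple_root[OF st(2)] pos_simple ul] by blast
  then show False using st by (simp add: bil_simple phi_simple)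
qed

lemma Lang_inf_adj_snoc:
  assumes "u @ [s] \<in> Lang P" "inf_adj s t"
  shows "u @ [s, t] \<in> Lang P"
proof -
  have r: "reduced (u @ [s, t])" using inf_adj_snoc assms Lang_reduced by blast
  have "\<not> violation P ((u @ [s]) @ [t])"
  proof
    assume "violation P ((u @ [s]) @ [t])"
    then obtain x y a where *: "u @ [s] = x @ y" "y \<noteq> []" "a \<in> gens" "act y (simple t) = simple a"
      using violation_snoc[of P "u @ [s]" t] assms(1) unfolding Lang_def by blast
    obtain y' where y: "y = y' @ [s]" using *(1,2) by (metis append_butlast_last_id last_appendR last_snoc)
    have "u @ [s, t] = x @ y' @ [s, t]" using *(1) y by simp
    then have "reduced (y' @ [s, t])" using r reduced_suffix by metis
    then show False using inf_step_blocks[OF _ assms(2) *(3)] * y by blast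
  qed
  then show ?thesis using r unfolding Lang_def by simp
qed

lemma Lang_walk_append:
  assumes "u @ [s] \<in> Lang P" "walk (s # x)"
  shows "u @ s # x \<in> Lang P"
  using assms
proof (induction x arbitrary: u s)
  case (Cons t x)
  have "inf_adj s t" using Cons.prems(2) unfolding walk_def by simp
  then have "(u @ [s]) @ [t] \<in> Lang P" using Lang_inf_adj_snoc[OF Cons.prems(1)] by simp
  moreover have "walk (t # x)" using Cons.prems(2) walk_suffix[of "[s]"] by simp
  ultimately have "(u @ [s]) @ t # x \<in> Lang P" by (rule Cons.IH)
  then show ?case by simp
qed simp

lemma reduced_single: "s \<in> gens \<Longrightarrow> reduced [s]"
  using not_reduced_snoc[OF reduced_Nil, of s] by auto

lemma Lang_Nil: "[] \<in> Lang P"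
  unfolding Lang_def violation_def using reduced_Nil by simp

lemma Lang_single: "s \<in> gens \<Longrightarrow> [s] \<in> Lang P"
  unfolding Lang_def violation_def using reduced_single by (auto simp: Cons_eq_append_conv)

lemma Lang_walk: "walk x \<Longrightarrow> x \<in> Lang P"
proof (cases x)
  case (Cons s y)
  assume "walk x"
  then show ?thesis using Lang_walk_append[of "[]" s P y] Lang_single[of s] Cons
    unfolding walk_def by simp
qed (simp add: Lang_Nil)

text \<open>A detour of odd length, which makes return times coprime.\<close>

lemma Lang_detour:
  assumes u: "u @ [t] \<in> Lang P" and ts: "inf_adj t s" and tr: "inf_adj t r" and sr: "s \<noteq> r" and P: "\<not> P r s"
  shows "u @ [t, s, r, t] \<in> Lang P"
proof -
  have g: "s \<in> gens" "r \<in> gens" "t \<in> gens" "cof t s = 2" "cof t r = 2"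
    using ts tr cof_inf unfolding inf_adj_def by auto
  have k: "cof s r \<ge> 0" using cof_nonneg[OF g(1,2) sr] .
  have L1: "u @ [t, s] \<in> Lang P" using Lang_inf_adj_snoc[OF u ts] .
  have r1: "reduced (u @ [t, s])" using Lang_reduced[OF L1] .
  have r2: "reduced (u @ [t, r])" using Lang_reduced[OF Lang_inf_adj_snoc[OF u tr]] .
  have l: "u @ [t, s] \<in> lists gens" using reduced_lists[OF r1] .
  have p1: "pos (act (u @ [t]) (simple s))" using reduced_snoc_pos[of "u @ [t]" s] r1 by simp
  have p2: "pos (act (u @ [t]) (simple r))" using reduced_snoc_pos[of "u @ [t]" r] r2 by simp
  \<comment> \<open>\<open>act (u @ [t]) ?b\<close> is a nonnegative combination of the images of
    \<open>simple r\<close> and \<open>simple s\<close>, both positive because \<open>r\<close> and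
    \<open>s\<close> may follow \<open>u @ [t]\<close>.\<close>
  let ?b = "sigma s (simple r)"
  have b: "?b = (\<lambda>x. 1 * simple r x + cof s r * simple s x)" using g by (simp add: sigma_simple)
  have bR: "?b \<in> roots" using roots_act[of "[s]" "simple r"] simple_root g by simp
  have bp: "pos ?b"
    by (rule root_nonneg_pos[OF bR]) (use k in \<open>simp add: b simple_def\<close>)
  have eq: "act (u @ [t, s]) (simple r) = act (u @ [t]) ?b" by simp
  have R: "act (u @ [t]) ?b \<in> roots" using roots_act[OF _ bR, of "u @ [t]"] l by simp
  have "pos (act (u @ [t]) ?b)"
  proof (rule root_nonneg_pos[OF R])
    fix x
    show "0 \<le> act (u @ [t]) ?b x" unfolding b act_lin
      using pos_nonneg[OF p1] pos_nonneg[OF p2] k by simp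
  qed
  then have red: "reduced (u @ [t, s, r])"
    using not_reduced_snoc_neg[OF r1 g(2)] pos_neg_False[OF R] eq by auto
  have "\<not> violation P ((u @ [t, s]) @ [r])"
  proof
    assume "violation P ((u @ [t, s]) @ [r])"
    then obtain x y a where *: "u @ [t, s] = x @ y" "y \<noteq> []" "a \<in> gens" "P a (hd y)"
      "act y (simple r) = simple a"
      using violation_snoc[of P "u @ [t, s]" r] L1 unfolding Lang_def by blast
    obtain y1 where y1: "y = y1 @ [s]"
      using *(1,2) by (metis append_butlast_last_id last_appendR last.simps list.distinct(1))
    show False
    \<comment> \<open>If the violating factor is only \<open>[s, r]\<close>, the letter moved to the
      front must be \<open>r\<close>, which \<open>P\<close> does not rank below \<open>s\<close>. A
      longer factor contains \<open>t\<close>, and there the coefficient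
      \<open>phi t ?b = 2 + 2 * cof s r\<close> reaches 2.\<close>
    proof (cases y1 rule: rev_cases)
      case Nil
      then have "?b = simple a" using *(5) y1 by simp
      then have "?b r = simple a r" by simp
      then have "a = r" unfolding b using sr by (simp add: simple_def split: if_splits)
      then show False using *(4) y1 Nil P by simp
    next
      case (snoc y' t')
      then have y: "y = y' @ [t, s]" using *(1) y1 by auto
      then have "x @ y' @ [t, s, r] = u @ [t, s, r]" using *(1) by simp
      then have "reduced (y' @ [t, s, r])" using red reduced_suffix by metis
      then have "reduced (a # y' @ [t, s])"
        using reduced_Cons_simple[of "y' @ [t, s]" r a] * y by simp
      then have "reduced (a # y' @ [t])" using reduced_prefix[of "a # y' @ [t]" "[s]"] by simp
      moreover have "phi t ?b \<ge> 2" unfolding b phi_lin using g k by (simp add: phi_simple)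
      ultimately have "act (y' @ [t]) ?b \<noteq> simple a" using crossing_blocks bR bp by blast
      then show False using *(5) y by simp
    qed
  qed
  then have "(u @ [t, s]) @ [r] \<in> Lang P" using red unfolding Lang_def by simp
  then show ?thesis using Lang_inf_adj_snoc[OF _ inf_adj_sym[OF tr], of "u @ [t, s]"] by simp
qed

text \<open>Being reduced is invariant under reversal, so prepending a walk amounts to appending its
  reverse.\<close>

lemma reduced_walk_left:
  assumes red: "reduced (s # u)" and w: "walk (x @ [s])"
  shows "reduced (x @ s # u)"
proof -
  let ?P = "\<lambda>_ _. False"
  have "rev u @ [s] \<in> Lang ?P"
    unfolding Lang_def violation_def using reduced_rev[OF red] by simp
  moreover have "walk (s # rev x)" using walk_rev[OF w] by simp
  ultimately have "reduced (rev u @ s # rev x)" using Lang_walk_append Lang_reduced by blast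
  then show ?thesis using reduced_rev by fastforce
qed

section \<open>Normal forms: placing a walk in front, uniqueness and existence\<close>

lemma eqv_reduced_length: "reduced u \<Longrightarrow> reduced w \<Longrightarrow> eqv u w \<Longrightarrow> length u = length w"
  unfolding reduced_def using word_cong.sym le_antisym by metis

lemma simple_inj: "simple a = simple b \<Longrightarrow> a = b"
  unfolding simple_def by (metis zero_neq_one)

text \<open>The difficulty is that \<open>v\<close> need not begin with \<open>q\<close>. A
  violation starting inside \<open>x\<close> makes \<open>c\<close> a left descent of
  \<open>x' @ v\<close>, hence of the equivalent word \<open>x' @ q @ u\<close>, where the exchanged
  letter can be located: inside the walk \<open>inf_step_blocks\<close> applies, beyond it
  \<open>covering_blocks\<close>. What remains is the first letter of \<open>x'\<close>, and then
  \<open>P c c\<close> would hold.\<close>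

lemma Lang_walk_left:
  assumes w: "walk (x @ q)" and q: "covering q" and red: "reduced (x @ q @ u)"
    and v: "eqv (q @ u) v" "v \<in> Lang P" and P: "\<And>a. \<not> P a a"
  shows "x @ v \<in> Lang P"
proof -
  have rqu: "reduced (q @ u)" using red reduced_suffix by blast
  have len: "length v = length (q @ u)"
    using eqv_reduced_length[OF rqu Lang_reduced[OF v(2)] v(1)] by simp
  have xv: "reduced (x @ v)"
  proof (rule reduced_eqv[OF red])
    show "eqv (x @ q @ u) (x @ v)"
      using word_cong_append[OF word_cong.refl v(1), of x] reduced_lists[OF red] by simp
  qed (use len in simp)
  have "\<not> violation P (x @ v)"
  proof
    assume "violation P (x @ v)"
    then obtain x0 y e r c where *: "x @ v = x0 @ y @ [e] @ r" "y \<noteq> []" "c \<in> gens" "P c (hd y)"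
      "act y (simple e) = simple c" unfolding violation_def by blast
    have "length x0 < length x"
    proof (rule ccontr)
      assume "\<not> length x0 < length x"
      then obtain x1 where "x0 = x @ x1" "v = x1 @ y @ [e] @ r"
        using append_eq_append_split[OF *(1)] by fastforce
      then show False using v(2) * unfolding Lang_def violation_def by blast
    qed
    then obtain x' where x': "x = x0 @ x'" "x' @ v = y @ [e] @ r"
      using append_eq_append_split[OF *(1)[symmetric]] by fastforce
    have x'n: "x' \<noteq> []" using \<open>length x0 < length x\<close> x'(1) by auto
    let ?W = "x' @ q @ u"
    have hd: "hd ?W = hd y" using x'(2) x'n *(2) by (metis hd_append2)
    have W: "reduced ?W" using red x'(1) reduced_suffix[of x0 ?W] by simp
    have "\<not> reduced (c # y @ [e])"
    proof
      assume r: "reduced (c # y @ [e])"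
      have "pos (act (c # y) (simple e))" using reduced_snoc_pos[of "c # y" e] r by simp
      then have "neg (simple c)" using *(3,5) pos_simple
        by (simp add: sigma_simple_self)
      then show False using pos_neg_False simple_root[OF *(3)] pos_simple by blast
    qed
    then have "\<not> reduced (c # x' @ v)" unfolding x'(2) using reduced_prefix[of "c # y @ [e]" r] by auto
    moreover have "eqv (c # ?W) (c # x' @ v)"
      using word_cong_append[OF word_cong.refl v(1), of "c # x'"] reduced_lists[OF W] *(3) by simp
    ultimately have "\<not> reduced (c # ?W)" using reduced_eqv[of "c # ?W" "c # x' @ v"] len by auto
    then obtain y2 e2 r2 where y2: "?W = y2 @ [e2] @ r2" "act y2 (simple e2) = simple c"
      using left_descent_prefix[OF W *(3)] by blast
    have r2: "reduced (y2 @ [e2])" using W y2(1) reduced_prefix[of "y2 @ [e2]" r2] by simp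
    show False
    proof (cases y2 rule: rev_cases)
      case Nil
      then have "e2 = c" using y2(2) simple_inj by simp
      moreover have "hd ?W = e2" using y2(1) Nil by simp
      ultimately show False using P *(4) hd by simp
    next
      case (snoc y3 s)
      show False
      proof (cases "length y2 < length (x' @ q)")
        case True
        have "(y2 @ [e2]) @ r2 = (x' @ q) @ u" using y2(1) by simp
        then obtain z where "x' @ q = (y2 @ [e2]) @ z"
          using append_eq_append_split[of "y2 @ [e2]" r2 "x' @ q" u] True by auto
        moreover have "walk (x' @ q)" using w x'(1) walk_suffix[of x0] by simp
        ultimately have "walk (y2 @ [e2])" using walk_prefix by metis
        then have "inf_adj s e2" using snoc unfolding walk_def by (simp add: successively_append_iff)
        then show False using inf_step_blocks[of y3 s e2 c] r2 snoc *(3) y2(2) by simp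
      next
        case False
        have "(x' @ q) @ u = y2 @ [e2] @ r2" using y2(1) by simp
        then obtain z where "y2 = x' @ q @ z"
          using append_eq_append_split[of "x' @ q" u y2 "[e2] @ r2"] False by auto
        then show False using covering_blocks[of x' q z e2 c] r2 q *(3) y2(2) by simp
      qed
    qed
  qed
  then show ?thesis using xv unfolding Lang_def by simp
qed

text \<open>At the first difference \<open>a < b\<close> the smaller letter is a left descent of the
  other tail \<open>b # y\<close>, and moving it to the front of that tail is a violation.\<close>

lemma ShortLex_unique:
  assumes w: "w1 \<in> Lang (<)" "w2 \<in> Lang (<)" and e: "eqv w1 w2"
  shows "w1 = w2"
proof (rule ccontr)
  assume "w1 \<noteq> w2"
  have *: False if w: "w2 \<in> Lang (<)" "reduced w1" and e: "eqv w1 w2"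
    and s: "w1 = pre @ a # x" "w2 = pre @ b # y" and ab: "a < b" for w1 w2 pre a b x y
  proof -
    have l: "pre \<in> lists gens" "a \<in> gens" "x \<in> lists gens" "b \<in> gens" "y \<in> lists gens"
      using eqv_lists[OF e] s by auto
    have c: "eqv (rev pre @ pre @ z) z" if "z \<in> lists gens" for z
      using word_cong_append[OF eqv_rev_cancel[of "rev pre"] word_cong.refl[OF that]] l by simp
    have "eqv (rev pre @ pre @ a # x) (rev pre @ pre @ b # y)"
      using word_cong_append[OF word_cong.refl e, of "rev pre"] l s by simp
    then have "eqv (a # x) (b # y)"
      using c[of "a # x"] c[of "b # y"] l word_cong.trans word_cong.sym by (meson lists.Cons)
    then have "eqv ([a] @ a # x) ([a] @ b # y)"
      by (intro word_cong_append word_cong.refl) (use l in auto)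
    moreover have "eqv ([] @ [a, a] @ x) ([] @ x)" by (rule eqv_cancel) (use l in auto)
    ultimately have ex: "eqv (a # b # y) x"
      using word_cong.trans[OF word_cong.sym] by simp
    have "length x = length y" using eqv_reduced_length[OF w(2) Lang_reduced[OF w(1)] e] s by simp
    then have "\<not> reduced (a # b # y)" using ex unfolding reduced_def by auto
    moreover have "reduced (b # y)" using Lang_reduced[OF w(1)] s reduced_suffix by blast
    ultimately obtain y' e r where y': "b # y = y' @ [e] @ r" "act y' (simple e) = simple a"
      using left_descent_prefix l by blast
    have "y' \<noteq> []" using y' simple_inj[of e a] ab by auto
    moreover from this have "hd y' = b" using y'(1) by (metis hd_append2 list.sel(1))
    ultimately have "violation (<) w2" unfolding violation_def using y' s ab l
      by (intro exI[of _ pre] exI[of _ y'] exI[of _ e] exI[of _ r] exI[of _ a]) simp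
    then show False using w(1) unfolding Lang_def by simp
  qed
  have len: "length w1 = length w2" using eqv_reduced_length w e Lang_reduced by blast
  obtain pre a x b y where s: "a \<noteq> b" "w1 = pre @ [a] @ x" "w2 = pre @ [b] @ y"
    using same_length_different[OF \<open>w1 \<noteq> w2\<close> len] by blast
  then consider "a < b" | "b < a" by linarith
  then show False
  proof cases
    case 1
    then show False using *[OF w(2) Lang_reduced[OF w(1)] e, of pre a x b y] s by simp
  next
    case 2
    then show False using *[OF w(1) Lang_reduced[OF w(2)] word_cong.sym[OF e], of pre b y a x] s by simp
  qed
qed

lemma ShortLex_exists:
  assumes "w \<in> lists gens"
  shows "\<exists>v \<in> Lang (<). eqv w v"
proof -
  obtain w' where w': "eqv w w'" "reduced w'" using ex_reduced[OF assms] by blast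
  let ?S = "{v. eqv w v \<and> reduced v}"
  \<comment> \<open>\<open>lex\<close> relates only words of equal length, so it is well-founded. A
    violation of the least word would let the smaller letter \<open>a\<close> be moved forward and
    give a smaller reduced word.\<close>
  obtain v where v: "v \<in> ?S" "\<And>z. (z, v) \<in> lex less_than \<Longrightarrow> z \<notin> ?S"
    using wfE_min[OF wf_lex[OF wf_less_than], of w' ?S] w' by blast
  have "\<not> violation (<) v"
  proof
    assume "violation (<) v"
    then obtain x y e r a where *: "v = x @ y @ [e] @ r" "y \<noteq> []" "a \<in> gens" "a < hd y"
      "act y (simple e) = simple a" unfolding violation_def by blast
    have red: "reduced (y @ [e])" using v(1) *(1) reduced_factor[of x "y @ [e]" r] by simp
    have xl: "x \<in> lists gens" "r \<in> lists gens" using reduced_lists[of v] v(1) *(1) by auto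
    have "\<not> reduced ((a # y) @ [e])"
    proof
      assume "reduced ((a # y) @ [e])"
      then have "pos (act (a # y) (simple e))" by (rule reduced_snoc_pos)
      then have "neg (simple a)" using *(3,5) by (simp add: sigma_simple_self)
      then show False using pos_neg_False simple_root[OF *(3)] pos_simple by blast
    qed
    then have "\<not> reduced (rev (y @ [e]) @ [a])" using reduced_rev[of "rev (y @ [e]) @ [a]"] by auto
    then obtain z where z: "eqv (rev (y @ [e])) (z @ [a])" "Suc (length z) = length (rev (y @ [e]))"
      using not_reduced_snoc[OF reduced_rev[OF red] *(3)] by blast
    have "eqv (y @ [e]) (a # rev z)" using eqv_rev[OF z(1)] by simp
    from word_cong_context[OF this xl]
    have e1: "eqv v (x @ a # rev z @ r)" using *(1) by simp
    have len: "length (x @ a # rev z @ r) = length v" using z(2) *(1) by simp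
    have "reduced (x @ a # rev z @ r)" using reduced_eqv[OF _ e1 len] v(1) by blast
    then have "x @ a # rev z @ r \<in> ?S" using v(1) e1 word_cong.trans by blast
    moreover have "(x @ a # rev z @ r, v) \<in> lex less_than"
    proof -
      obtain b y' where y: "y = b # y'" using *(2) by (cases y) auto
      have "(a # rev z @ r, b # y' @ [e] @ r) \<in> lex less_than"
        using *(4) y z(2) by (simp add: Cons_in_lex)
      then show ?thesis unfolding *(1) y by (simp add: lex_append_leftI)
    qed
    ultimately show False using v(2) by blast
  qed
  then show ?thesis using v(1) unfolding Lang_def by blast
qed

end

section \<open>Groups spanned by edges labelled infinity\<close>

locale spanned_coxeter = coxeter +
  assumes rank: "n > 2"
    and connected: "s \<in> gens \<Longrightarrow> t \<in> gens \<Longrightarrow> (s, t) \<in> {(x, y). inf_adj x y}\<^sup>*"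
begin

section \<open>Walks in the connected graph of \<infinity>-edges\<close>

lemma ex_neighbour:
  assumes "s \<in> gens"
  shows "\<exists>t. inf_adj s t"
proof -
  define t :: nat where "t = (if s = 1 then 2 else 1)"
  have t: "t \<in> gens" "t \<noteq> s" using rank by (auto simp: t_def gens_def)
  show ?thesis
    using connected[OF assms t(1)]
  proof (cases rule: converse_rtranclE)
    case (step y)
    then show ?thesis by blast
  qed (use t in simp)
qed

lemma walk_join:
  assumes "walk x" "x \<noteq> []" "walk (last x # y)"
  shows "walk (x @ y)"
  using assms unfolding walk_def by (cases y) (auto simp: successively_append_iff)

lemma walk_snoc:
  assumes "walk x" "x \<noteq> []" "inf_adj (last x) t"
  shows "walk (x @ [t])"
  by (rule walk_join) (use assms in \<open>auto simp: walk_def inf_adj_def\<close>)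

lemma walk_connect:
  assumes "s \<in> gens" "t \<in> gens"
  shows "\<exists>x. walk (s # x) \<and> last (s # x) = t"
  using connected[OF assms]
proof (induction rule: rtrancl_induct)
  case base
  then show ?case using assms by (intro exI[of _ "[]"]) (simp add: walk_def)
next
  case (step y z)
  then obtain x where x: "walk (s # x)" "last (s # x) = y" by blast
  have "walk ((s # x) @ [z])" using walk_snoc[OF x(1)] x(2) step by simp
  then show ?case by (intro exI[of _ "x @ [z]"]) simp
qed

lemma walk_last: "walk x \<Longrightarrow> x \<noteq> [] \<Longrightarrow> last x \<in> gens"
  unfolding walk_def by auto

lemma walk_visiting:
  assumes "s \<in> gens" "F \<subseteq> gens"
  shows "\<exists>x. walk (s # x) \<and> F \<subseteq> set (s # x)"
proof -
  have "finite F" using assms(2) finite_gens finite_subset by blast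
  then show ?thesis using assms(2)
  proof (induction F)
    case empty
    then show ?case using assms(1) by (intro exI[of _ "[]"]) (simp add: walk_def)
  next
    case (insert t F)
    then obtain x where x: "walk (s # x)" "F \<subseteq> set (s # x)" by auto
    obtain y where y: "walk (last (s # x) # y)" "last (last (s # x) # y) = t"
      using walk_connect[of "last (s # x)" t] walk_last[OF x(1)] insert.prems by blast
    have "walk ((s # x) @ y)" using walk_join[OF x(1)] y by simp
    moreover have "t \<in> set ((s # x) @ y)"
      using y(2) last_in_set[of y] last_in_set[of "s # x"] by (cases "y = []") auto
    ultimately show ?case using x(2) by (intro exI[of _ "x @ y"]) auto
  qed
qed

lemma coveringI:
  assumes "walk (q @ z # y)" "gens \<subseteq> set q"
  shows "covering (q @ z # y)"
proof -
  have "q @ z # y = butlast (q @ z # y) @ [last (q @ z # y)]"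
    by (rule append_butlast_last_id[symmetric]) simp
  moreover have "set q \<subseteq> set (butlast (q @ z # y))" by (auto simp: butlast_append)
  moreover have "set (butlast (q @ z # y)) \<subseteq> gens"
    using assms(1) in_set_butlastD unfolding walk_def by fastforce
  ultimately show ?thesis unfolding covering_def using assms by blast
qed

lemma covering_from:
  assumes s: "s \<in> gens" and t: "t \<in> gens"
  shows "\<exists>q. covering (s # q) \<and> last (s # q) = t"
proof -
  obtain x where x: "walk (s # x)" "gens \<subseteq> set (s # x)" using walk_visiting[OF s] by blast
  \<comment> \<open>One step more after the last new generator, so that every generator occurs
    before the final letter.\<close>
  obtain z where z: "inf_adj (last (s # x)) z"
    using ex_neighbour walk_last[OF x(1)] by blast
  then have "z \<in> gens" by (simp add: inf_adj_def)
  then obtain y where y: "walk (z # y)" "last (z # y) = t" using walk_connect t by blast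
  have "walk ((s # x) @ [z])" using walk_snoc[OF x(1)] z by simp
  then have w: "walk (((s # x) @ [z]) @ y)" by (rule walk_join) (use y in auto)
  have "covering ((s # x) @ z # y)"
    by (rule coveringI) (use w x in auto)
  then show ?thesis using y(2) by (intro exI[of _ "x @ z # y"]) auto
qed

lemma ex_covering: "\<exists>p. covering p"
  using covering_from[of 1 1] rank by (auto simp: gens_def)

lemma covering_nonempty: "covering p \<Longrightarrow> p \<noteq> [] \<and> walk p"
  unfolding covering_def by auto

text \<open>The bridge by which \<open>p\<close> is put in front of a word beginning with
  \<open>s\<close>.\<close>

lemma covering_between:
  assumes p: "walk p" "p \<noteq> []" and s: "s \<in> gens"
  shows "\<exists>q. covering q \<and> walk (p @ q @ [s])"
proof -
  obtain a where a: "inf_adj (last p) a" using ex_neighbour walk_last[OF p] by blast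
  obtain b where b: "inf_adj s b" using ex_neighbour[OF s] by blast
  have ab: "a \<in> gens" "b \<in> gens" using a b by (auto simp: inf_adj_def)
  obtain q where q: "covering (a # q)" "last (a # q) = b" using covering_from[OF ab] by blast
  have "walk (p @ [a])" using walk_snoc[OF p a] .
  then have "walk ((p @ [a]) @ q)" by (rule walk_join) (use q covering_nonempty in auto)
  then have "walk (((p @ [a]) @ q) @ [s])"
  proof (rule walk_snoc)
    show "inf_adj (last ((p @ [a]) @ q)) s" using q(2) inf_adj_sym[OF b] by (cases "q = []") auto
  qed simp
  then show ?thesis using q(1) by (intro exI[of _ "a # q"]) simp
qed

text \<open>Rank above 2 enters here: some edge leaves the pair \<open>{1, v}\<close>. On two
  vertices all closed walks have even length. The choice \<open>s < r\<close> ensures that a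
  \<open>P\<close> contained in the order does not rank \<open>r\<close> below \<open>s\<close>, as
  the detour requires.\<close>

lemma ex_branch: "\<exists>t s r. inf_adj t s \<and> inf_adj t r \<and> s < r"
proof -
  have 1: "1 \<in> gens" using rank by (simp add: gens_def)
  obtain v where v: "inf_adj 1 v" using ex_neighbour[OF 1] by blast
  have "card {1, v} < card gens"
    using rank card_insert_le_m1[of 2 "{v}" 1] by (simp add: gens_def card_insert_if)
  then have "\<not> gens \<subseteq> {1, v}" using card_mono[of "{1, v}" gens] by auto
  then obtain c where c: "c \<in> gens" "c \<notin> {1, v}" by blast
  have leave: "\<exists>x y. x \<in> X \<and> y \<notin> X \<and> inf_adj x y"
    if "(a, c) \<in> {(x, y). inf_adj x y}\<^sup>*" "a \<in> X" "c \<notin> X" for a c X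
    using that by (induction rule: rtrancl_induct) auto
  obtain x y where xy: "x \<in> {1, v}" "y \<notin> {1, v}" "inf_adj x y"
    using leave[OF connected[OF 1 c(1)], of "{1, v}"] c(2) by blast
  have "\<exists>t s r. inf_adj t s \<and> inf_adj t r \<and> s \<noteq> r"
    using xy v inf_adj_sym[OF v] by blast
  then show ?thesis by (metis linorder_neqE_nat)
qed

text \<open>Going to \<open>s\<close> and back takes two letters, the detour takes three, and 2 and
  3 generate all lengths from 2 on.\<close>

lemma Lang_loop:
  assumes P: "\<forall>a b. P a b \<longrightarrow> a < b"
    and t: "inf_adj t s" "inf_adj t r" "s < r" and u: "u @ [t] \<in> Lang P" and j: "j \<ge> 2"
  shows "\<exists>y. length y = j \<and> u @ t # y \<in> Lang P \<and> last (t # y) = t"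
  using u j
proof (induction j arbitrary: u rule: less_induct)
  case (less j)
  have two: "(u @ [t, s]) @ [t] \<in> Lang P"
    using Lang_inf_adj_snoc[OF _ inf_adj_sym[OF t(1)], of "u @ [t]"]
      Lang_inf_adj_snoc[OF less.prems(1) t(1)] by simp
  consider "j = 2" | "j = 3" | "j \<ge> 4" using less.prems by linarith
  then show ?case
  proof cases
    case 1
    then show ?thesis using two by (intro exI[of _ "[s, t]"]) simp
  next
    case 2
    have "\<not> P r s" using P t(3) by fastforce
    then show ?thesis using 2 Lang_detour[OF less.prems(1) t(1,2)] t(3)
      by (intro exI[of _ "[s, r, t]"]) simp
  next
    case 3
    then have "j - 2 < j" "2 \<le> j - 2" by auto
    then obtain y where "length y = j - 2" "(u @ [t, s]) @ t # y \<in> Lang P" "last (t # y) = t"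
      using less.IH[of "j - 2" "u @ [t, s]"] two by blast
    then show ?thesis using 3 by (intro exI[of _ "s # t # y"]) auto
  qed
qed

text \<open>A loop at the branching vertex \<open>t\<close> absorbs the difference between the
  prescribed length and the lengths of the two fixed walks from \<open>a\<close> to \<open>t\<close>
  and from \<open>t\<close> to a neighbour of \<open>hd p\<close>.\<close>

lemma Lang_reach_from:
  assumes P: "\<forall>a b. P a b \<longrightarrow> a < b" and p: "walk p" "p \<noteq> []" and a: "a \<in> gens"
  shows "\<exists>K0. \<forall>K\<ge>K0. \<forall>u. u @ [a] \<in> Lang P \<longrightarrow> (\<exists>x. length x = K \<and> u @ a # x @ p \<in> Lang P)"
proof -
  obtain t s r where t: "inf_adj t s" "inf_adj t r" "s < r" using ex_branch by blast
  have tg: "t \<in> gens" using t by (simp add: inf_adj_def)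
  obtain x1 where x1: "walk (a # x1)" "last (a # x1) = t" using walk_connect[OF a tg] by blast
  have "hd p \<in> gens" using p unfolding walk_def by (cases p) auto
  then obtain z where z: "inf_adj (hd p) z" using ex_neighbour by blast
  then have "z \<in> gens" by (simp add: inf_adj_def)
  then obtain x2 where x2: "walk (t # x2)" "last (t # x2) = z" using walk_connect[OF tg] by blast
  have x2p: "walk ((t # x2) @ p)"
  proof (rule walk_join[OF x2(1)])
    show "walk (last (t # x2) # p)"
      using p inf_adj_sym[OF z] \<open>z \<in> gens\<close> x2(2) unfolding walk_def by (cases p) auto
  qed simp
  have "\<exists>x. length x = K \<and> u @ a # x @ p \<in> Lang P"
    if K: "K \<ge> length x1 + 2 + length x2" and u: "u @ [a] \<in> Lang P" for K u
  proof -
    have 1: "u @ a # x1 \<in> Lang P" using Lang_walk_append[OF u x1(1)] .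
    define w1 where "w1 = butlast (u @ a # x1)"
    have w1: "u @ a # x1 = w1 @ [t]" using x1(2) unfolding w1_def
      by (metis append_butlast_last_id append_is_Nil_conv last_appendR list.distinct(1))
    define j where "j = K - length x1 - length x2"
    have j: "j \<ge> 2" using K by (simp add: j_def)
    obtain y where y: "length y = j" "w1 @ t # y \<in> Lang P" "last (t # y) = t"
      using Lang_loop[OF P t _ j] 1 unfolding w1 by blast
    define w2 where "w2 = butlast (w1 @ t # y)"
    have w2: "w1 @ t # y = w2 @ [t]" using y(3) unfolding w2_def
      by (metis append_butlast_last_id append_is_Nil_conv last_appendR list.distinct(1))
    have "w2 @ t # x2 @ p \<in> Lang P" using Lang_walk_append[of w2 t P "x2 @ p"] y(2) w2 x2p by simp
    moreover have "w2 @ t # x2 @ p = u @ a # (x1 @ y @ x2) @ p"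
    proof -
      have "w2 @ t # x2 @ p = (w2 @ [t]) @ x2 @ p" by simp
      also have "\<dots> = (w1 @ [t]) @ y @ x2 @ p" by (simp only: w2[symmetric]) simp
      also have "\<dots> = u @ a # (x1 @ y @ x2) @ p" by (simp only: w1[symmetric]) simp
      finally show ?thesis .
    qed
    ultimately have "u @ a # (x1 @ y @ x2) @ p \<in> Lang P" by (simp only:)
    moreover have "length (x1 @ y @ x2) = K" using y(1) K by (simp add: j_def)
    ultimately show ?thesis by blast
  qed
  then show ?thesis by blast
qed

lemma Lang_reach:
  assumes P: "\<forall>a b. P a b \<longrightarrow> a < b" and p: "walk p" "p \<noteq> []"
  shows "\<exists>K. \<forall>u\<in>Lang P. \<exists>x. length x = K \<and> u @ x @ p \<in> Lang P"
proof -
  obtain f where f: "\<And>a K u. a \<in> gens \<Longrightarrow> K \<ge> f a \<Longrightarrow> u @ [a] \<in> Lang P \<Longrightarrow>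
      \<exists>x. length x = K \<and> u @ a # x @ p \<in> Lang P"
    using Lang_reach_from[OF P p] by metis
  define K where "K = sum f gens"
  have fK: "f a \<le> K" if "a \<in> gens" for a
    unfolding K_def by (rule member_le_sum) (use that in auto)
  \<comment> \<open>The extra letter serves the empty word, which must first be given a letter to
    start from.\<close>
  have "\<exists>x. length x = Suc K \<and> u @ x @ p \<in> Lang P" if u: "u \<in> Lang P" for u
  proof (cases u rule: rev_cases)
    case Nil
    have 1: "1 \<in> gens" using rank by (simp add: gens_def)
    obtain x where "length x = K" "[] @ 1 # x @ p \<in> Lang P"
      using f[OF 1 fK[OF 1], of "[]"] Lang_single[OF 1] by auto
    then show ?thesis using Nil by (intro exI[of _ "1 # x"]) simp
  next
    case (snoc u' a)
    have a: "a \<in> gens" using reduced_lists[OF Lang_reduced[OF u]] snoc by simp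
    obtain x where "length x = Suc K" "u' @ a # x @ p \<in> Lang P"
      using f[OF a, of "Suc K" u'] fK[OF a] u snoc by auto
    then show ?thesis using snoc by (intro exI[of _ x]) simp
  qed
  then show ?thesis by blast
qed

section \<open>Domination and the synchronizing structure\<close>

lemma Lang_factor_language: "factor_language gens (Lang P)"
  by unfold_locales
    (use finite_gens Lang_reduced reduced_lists Lang_Nil Lang_prefix Lang_suffix in \<open>blast+\<close>)

text \<open>A word \<open>w\<close> beginning with \<open>s\<close> is sent to the extension
  \<open>N (q s @ w)\<close> of \<open>p\<close>: the bridge \<open>q s\<close> makes
  \<open>p @ q s @ w\<close> reduced, and \<open>Lang_walk_left\<close> lets \<open>p\<close>
  precede the normal form of the rest. The map is injective by \<open>N_inj\<close>, and the
  additional \<open>length (q s)\<close> letters cost a constant factor. \<open>N\<close> is the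
  identity for geodesics and the normal form for ShortLex.\<close>

lemma Lang_dominated:
  assumes P: "\<forall>a b. P a b \<longrightarrow> a < b" and p: "walk p" "p \<noteq> []"
    and N: "\<forall>w. reduced w \<longrightarrow> N w \<in> Lang P \<and> eqv w (N w)"
    and N_inj: "\<forall>q. \<forall>w\<in>Lang P. \<forall>w'\<in>Lang P. reduced (q @ w) \<longrightarrow> reduced (q @ w') \<longrightarrow>
      N (q @ w) = N (q @ w') \<longrightarrow> w = w'"
  shows "\<exists>C. \<forall>k. real (ext_count (Lang P) [] k) \<le> C * real (ext_count (Lang P) p k)"
proof -
  interpret factor_language gens "Lang P" by (rule Lang_factor_language)
  obtain q where q: "\<And>s. s \<in> gens \<Longrightarrow> covering (q s) \<and> walk (p @ q s @ [s])"
    using covering_between[OF p] by metis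
  define a where "a s = card gens ^ length (q s)" for s
  let ?M = "ext_count (Lang P)"
  have part: "card {w. length w = k \<and> w \<in> Lang P \<and> w \<noteq> [] \<and> hd w = s} \<le> a s * ?M p k"
    if s: "s \<in> gens" for s k
  proof -
    let ?X = "{w. length w = k \<and> w \<in> Lang P \<and> w \<noteq> [] \<and> hd w = s}"
    have red: "reduced (p @ q s @ w)" if wX: "w \<in> ?X" for w
    proof -
      have "w = s # tl w" using wX by (cases w) auto
      then obtain w' where w: "w = s # w'" by blast
      have "reduced ((p @ q s) @ s # w')"
        using reduced_walk_left[of s w' "p @ q s"] Lang_reduced[of w P] wX w q[OF s] by simp
      then show ?thesis using w by simp
    qed
    have red': "reduced (q s @ w)" if "w \<in> ?X" for w
      using red[OF that] reduced_suffix by blast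
    have "card ?X \<le> card {v. length v = k + length (q s) \<and> p @ v \<in> Lang P}"
    proof (rule card_inj_on_le[OF _ _ finite_ext])
      show "inj_on (\<lambda>w. N (q s @ w)) ?X"
        using N_inj red' by (fastforce simp: inj_on_def)
      show "(\<lambda>w. N (q s @ w)) ` ?X \<subseteq> {v. length v = k + length (q s) \<and> p @ v \<in> Lang P}"
      proof
        fix v assume "v \<in> (\<lambda>w. N (q s @ w)) ` ?X"
        then obtain w where w: "w \<in> ?X" "v = N (q s @ w)" by blast
        have v: "v \<in> Lang P" "eqv (q s @ w) v" using N red'[OF w(1)] w(2) by auto
        have "length v = length (q s @ w)"
          using eqv_reduced_length[OF red'[OF w(1)] Lang_reduced[OF v(1)] v(2)] by simp
        moreover have "walk (p @ q s)" using q[OF s] walk_prefix[of "p @ q s" "[s]"] by simp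
        then have "p @ v \<in> Lang P"
          by (rule Lang_walk_left[OF _ _ red[OF w(1)] v(2,1)]) (use q[OF s] P in auto)
        ultimately show "v \<in> {v. length v = k + length (q s) \<and> p @ v \<in> Lang P}"
          using w(1) by simp
      qed
    qed
    also have "\<dots> \<le> a s * ?M p k"
      using ext_count_add_le[of p k "length (q s)"] unfolding ext_count_def a_def .
    finally show ?thesis .
  qed
  \<comment> \<open>The summand 1 accounts for the empty word, which has no initial letter to sort
    it by.\<close>
  have "?M [] k \<le> (1 + sum a gens) * ?M p k" for k
  proof (cases k)
    case 0
    have "{v. length v = 0 \<and> [] @ v \<in> Lang P} = {[]}" "{v. length v = 0 \<and> p @ v \<in> Lang P} = {[]}"
      using Lang_Nil Lang_walk[OF p(1)] by auto
    then show ?thesis using 0 unfolding ext_count_def by simp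
  next
    case (Suc k')
    have "{v. length v = k \<and> [] @ v \<in> Lang P}
      \<subseteq> (\<Union>s\<in>gens. {w. length w = k \<and> w \<in> Lang P \<and> w \<noteq> [] \<and> hd w = s})"
    proof
      fix w assume w: "w \<in> {v. length v = k \<and> [] @ v \<in> Lang P}"
      then obtain s w' where "w = s # w'" using Suc by (cases w) auto
      then show "w \<in> (\<Union>s\<in>gens. {w. length w = k \<and> w \<in> Lang P \<and> w \<noteq> [] \<and> hd w = s})"
        using w sub_lists by auto
    qed
    moreover have fin: "finite {w. length w = k \<and> w \<in> Lang P \<and> w \<noteq> [] \<and> hd w = s}" for s
      using finite_ext[of k "[]"] by (rule finite_subset[rotated]) auto
    ultimately have "?M [] k \<le> card (\<Union>s\<in>gens. {w. length w = k \<and> w \<in> Lang P \<and> w \<noteq> [] \<and> hd w = s})"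
      unfolding ext_count_def by (intro card_mono) auto
    also have "\<dots> \<le> (\<Sum>s\<in>gens. card {w. length w = k \<and> w \<in> Lang P \<and> w \<noteq> [] \<and> hd w = s})"
      by (rule card_UN_le) simp
    also have "\<dots> \<le> (\<Sum>s\<in>gens. a s * ?M p k)" by (rule sum_mono) (rule part)
    also have "\<dots> \<le> (1 + sum a gens) * ?M p k" by (simp add: sum_distrib_right)
    finally show ?thesis .
  qed
  then have "real (?M [] k) \<le> real (1 + sum a gens) * real (?M p k)" for k
    by (metis of_nat_le_iff of_nat_mult)
  then show ?thesis by blast
qed

lemma Lang_sync_language:
  assumes P: "\<forall>a b. P a b \<longrightarrow> a < b" and p: "covering p"
    and N: "\<forall>w. reduced w \<longrightarrow> N w \<in> Lang P \<and> eqv w (N w)"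
    and N_inj: "\<forall>q. \<forall>w\<in>Lang P. \<forall>w'\<in>Lang P. reduced (q @ w) \<longrightarrow> reduced (q @ w') \<longrightarrow>
      N (q @ w) = N (q @ w') \<longrightarrow> w = w'"
  shows "\<exists>K C. sync_language gens (Lang P) p K C"
proof -
  have p': "walk p" "p \<noteq> []" using covering_nonempty[OF p] by auto
  obtain K where K: "\<And>u. u \<in> Lang P \<Longrightarrow> \<exists>x. length x = K \<and> u @ x @ p \<in> Lang P"
    using Lang_reach[OF P p'] by metis
  obtain C where C: "\<And>k. real (ext_count (Lang P) [] k) \<le> C * real (ext_count (Lang P) p k)"
    using Lang_dominated[OF P p' N N_inj] by blast
  have "sync_language gens (Lang P) p K C"
    by (intro sync_language.intro sync_language_axioms.intro Lang_factor_language p'(2)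
        Lang_sync[OF p] K C)
  then show ?thesis by blast
qed

section \<open>Comparison of geodesics with ShortLex words\<close>

abbreviation Geo :: "nat list set" where "Geo \<equiv> Lang (\<lambda>_ _. False)"

abbreviation ShortLex :: "nat list set" where "ShortLex \<equiv> Lang (<)"

lemma Geo_iff: "w \<in> Geo \<longleftrightarrow> reduced w"
  unfolding Lang_def violation_def by simp

lemma Geo_sync_language:
  assumes "covering p"
  shows "\<exists>K C. sync_language gens Geo p K C"
  by (rule Lang_sync_language[OF _ assms, of _ "\<lambda>w. w"])
    (auto simp: Geo_iff intro: word_cong.refl dest: reduced_lists simp del: in_lists_conv_set)

lemma eqv_cancel_left:
  assumes "eqv (q @ w) (q @ w')"
  shows "eqv w w'"
proof -
  have l: "q \<in> lists gens" "w \<in> lists gens" "w' \<in> lists gens" using eqv_lists[OF assms] by auto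
  have c: "eqv (rev q @ q @ z) z" if "z \<in> lists gens" for z
    using word_cong_append[OF eqv_rev_cancel[of "rev q"] word_cong.refl[OF that]] l by simp
  have "eqv (rev q @ q @ w) (rev q @ q @ w')"
    using word_cong_append[OF word_cong.refl assms, of "rev q"] l by simp
  then show ?thesis using c l word_cong.trans word_cong.sym by meson
qed

lemma ShortLex_sync_language:
  assumes "covering p"
  shows "\<exists>K C. sync_language gens ShortLex p K C"
proof -
  obtain N where N: "\<And>w. w \<in> lists gens \<Longrightarrow> N w \<in> ShortLex \<and> eqv w (N w)"
    using ShortLex_exists by metis
  show ?thesis
  proof (rule Lang_sync_language[OF _ assms, of _ N]; intro allI ballI impI)
    fix q w w' assume *: "w \<in> ShortLex" "w' \<in> ShortLex" "reduced (q @ w)" "reduced (q @ w')"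
      "N (q @ w) = N (q @ w')"
    have "eqv (q @ w) (N (q @ w))" "eqv (q @ w') (N (q @ w))"
      using N reduced_lists * by metis+
    then have "eqv w w'" using word_cong.trans word_cong.sym eqv_cancel_left by meson
    then show "w = w'" using ShortLex_unique * by blast
  qed (use N reduced_lists in auto)
qed

text \<open>Converse of \<open>not_reduced_alt\<close>: up to the label the Chebyshev coordinates
  are nonnegative, so no further letter is a descent.\<close>

lemma alt_reduced:
  assumes ab: "a \<in> gens" "b \<in> gens" "a \<noteq> b" and j: "enat j \<le> m a b"
  shows "reduced (alt a b j)"
  using j
proof (induction j)
  case 0
  then show ?case by (simp add: reduced_Nil)
next
  case (Suc j)
  let ?e = "if even j then a else b"
  have le: "enat j \<le> m a b" using Suc.prems by (cases "m a b") auto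
  have e: "?e \<in> gens" using ab by simp
  have p: "pos (act (alt a b j) (simple ?e))"
    unfolding act_alt[OF ab(1,2)]
    by (rule pos_comb) (simp_all add: pos_simple cheb_zero_or_ge_1[OF ab le] cheb_zero_or_ge_1[OF ab Suc.prems])
  have "act (alt a b j) (simple ?e) \<in> roots"
    using roots_act alt_lists[OF ab(1,2)] simple_root[OF e] by blast
  then show ?case unfolding alt_snoc
    using not_reduced_snoc_neg[OF Suc.IH[OF le] e] p pos_neg_False by blast
qed

text \<open>One side of the braid relation, begun with the larger letter \<open>j\<close>. The sines
  at \<open>k * t = pi\<close> and \<open>(k - 1) * t = pi - t\<close> show that all but its last
  letter carry the last simple root to \<open>simple i\<close>, so \<open>i\<close> can be moved to
  the front.\<close>

lemma ShortLex_proper: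
  assumes ij: "i \<in> gens" "j \<in> gens" "i < j" and mij: "m i j = enat k"
  shows "alt j i k \<in> Geo \<and> alt j i k \<notin> ShortLex"
proof -
  have k: "k \<ge> 2" using m_ge_2[of i j] assms by simp
  have mji: "m j i = enat k" using m_sym assms by auto
  have red: "reduced (alt j i k)" using alt_reduced[of j i k] assms mji by simp
  obtain l where l: "k = Suc l" "l \<ge> 1" using k by (cases k) auto
  let ?e = "if even l then j else i"
  define t where "t = pi / real k"
  have t: "0 < t" "t < pi" unfolding t_def using k by (auto simp: field_simps)
  have st: "sin t > 0" using t by (intro sin_gt_zero) auto
  have kt: "real k * t = pi" unfolding t_def using k by simp
  have c: "cof j i = 2 * cos t" using ij mji by (simp add: cof_def t_def)
  have "cheb (cof j i) k * sin t = 0" unfolding c cheb_cos kt by simp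
  then have 1: "cheb (cof j i) (Suc l) = 0" using st l by simp
  have "real l * t = pi - t" using kt l by (simp add: algebra_simps)
  then have "cheb (cof j i) l * sin t = sin t" unfolding c cheb_cos by simp
  then have 2: "cheb (cof j i) l = 1" using st by simp
  have "act (alt j i l) (simple ?e) = simple i"
    using act_alt[of j i l] ij 1 2 by simp
  moreover have "alt j i k = [] @ alt j i l @ [?e] @ []" unfolding l alt_snoc by simp
  moreover have "hd (alt j i l) = j" "alt j i l \<noteq> []" using l(2) by (cases l; simp)+
  ultimately have "violation (<) (alt j i k)" unfolding violation_def using ij by metis
  then have "alt j i k \<notin> ShortLex" by (simp add: Lang_def)
  then show ?thesis using red by (simp add: Geo_iff)
qed

theorem count_asymptotics:
  assumes ij: "i \<in> gens" "j \<in> gens" "i < j" "m i j \<noteq> \<infinity>"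
  shows "\<exists>g c w d. 1 \<le> w \<and> w < g \<and> 0 < c \<and> 0 < d \<and>
    (\<lambda>k. real (ext_count Geo [] k) / g ^ k) \<longlonglongrightarrow> c \<and>
    (\<lambda>k. real (ext_count ShortLex [] k) / w ^ k) \<longlonglongrightarrow> d"
proof -
  obtain p where p: "covering p" using ex_covering by blast
  obtain K C where "sync_language gens Geo p K C" using Geo_sync_language[OF p] by blast
  then interpret G: sync_language gens Geo p K C .
  obtain K' C' where "sync_language gens ShortLex p K' C'" using ShortLex_sync_language[OF p] by blast
  then interpret W: sync_language gens ShortLex p K' C' .
  obtain g c where g: "g \<ge> 1" "c > 0" "(\<lambda>k. real (ext_count Geo [] k) / g ^ k) \<longlonglongrightarrow> c"
    using G.count_asymptotics by blast
  obtain w d where w: "w \<ge> 1" "d > 0" "(\<lambda>k. real (ext_count ShortLex [] k) / w ^ k) \<longlonglongrightarrow> d"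
    using W.count_asymptotics by blast
  obtain k where "m i j = enat k" using ij(4) by auto
  define r where "r = alt j i k"
  have r: "r \<in> Geo" "r \<notin> ShortLex" using ShortLex_proper[OF ij(1-3)] \<open>m i j = enat k\<close> r_def by auto
  then obtain s r' where s: "r = s # r'" using Lang_Nil[of "(<)"] by (cases r) auto
  have sg: "s \<in> gens" using reduced_lists r(1) s unfolding Geo_iff by fastforce
  obtain q where q: "covering q" "walk (p @ q @ [s])"
    using covering_between[of p s] covering_nonempty[OF p] sg by blast
  have "reduced ((p @ q) @ s # r')"
    using reduced_walk_left[of s r' "p @ q"] q r(1) s unfolding Geo_iff by simp
  then have pqr: "p @ q @ r \<in> Geo" using s by (simp add: Geo_iff)
  \<comment> \<open>The escape is made of \<open>K\<close> letters leading to \<open>p\<close>, then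
    the bridge \<open>q\<close>, then the forbidden word \<open>r\<close>; since \<open>p\<close>
    synchronizes, \<open>q @ r\<close> may follow whatever came before.\<close>
  let ?J = "K + length p + length q + length r"
  have sub: "ShortLex \<subseteq> Geo" using Lang_reduced Geo_iff by blast
  have esc: "\<exists>x. length x = ?J \<and> u @ x \<in> Geo \<and> u @ x \<notin> ShortLex" if u: "u \<in> Geo" for u
  proof -
    obtain x where x: "length x = K" "u @ x @ p \<in> Geo" using G.reach[OF u] by blast
    have "(u @ x) @ p @ q @ r \<in> Geo" using G.sync[of "u @ x"] x(2) pqr by simp
    moreover have "(u @ x @ p @ q) @ r \<notin> ShortLex" using r(2) Lang_suffix by blast
    ultimately show ?thesis using x(1) by (intro exI[of _ "x @ p @ q @ r"]) simp
  qed
  have "\<exists>\<theta>. 0 < \<theta> \<and> \<theta> < 1 \<and>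
    (\<forall>l. real (ext_count ShortLex [] (l * ?J)) \<le> \<theta> ^ l * real (ext_count Geo [] (l * ?J)))"
    by (rule G.sublanguage_decay[OF sub]) (use Lang_prefix esc in blast)+
  then obtain \<theta> where \<theta>: "0 < \<theta>" "\<theta> < 1"
    "\<And>l. real (ext_count ShortLex [] (l * ?J)) \<le> \<theta> ^ l * real (ext_count Geo [] (l * ?J))"
    by blast
  have J: "?J > 0" using s by simp
  have "w < g"
  proof (rule ccontr)
    assume "\<not> w < g"
    \<comment> \<open>Along multiples of \<open>?J\<close> the ShortLex counts divided by powers of
      \<open>w\<close> would be at most \<open>\<theta> ^ l\<close> times a convergent sequence,
      forcing the positive limit \<open>d\<close> to be 0.\<close>
    then have gw: "g \<le> w" by simp
    have sm: "strict_mono (\<lambda>l. l * ?J)" using J by (simp add: strict_mono_def)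
    have 1: "(\<lambda>l. real (ext_count ShortLex [] (l * ?J)) / w ^ (l * ?J)) \<longlonglongrightarrow> d"
      using LIMSEQ_subseq_LIMSEQ[OF w(3) sm] by (simp add: o_def)
    have "(\<lambda>l. real (ext_count Geo [] (l * ?J)) / g ^ (l * ?J)) \<longlonglongrightarrow> c"
      using LIMSEQ_subseq_LIMSEQ[OF g(3) sm] by (simp add: o_def)
    then have "(\<lambda>l. \<theta> ^ l * (real (ext_count Geo [] (l * ?J)) / g ^ (l * ?J))) \<longlonglongrightarrow> 0 * c"
      by (intro tendsto_mult LIMSEQ_power_zero) (use \<theta> in auto)
    moreover have "real (ext_count ShortLex [] (l * ?J)) / w ^ (l * ?J)
      \<le> \<theta> ^ l * (real (ext_count Geo [] (l * ?J)) / g ^ (l * ?J))" for l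
    proof -
      have "real (ext_count ShortLex [] (l * ?J)) / w ^ (l * ?J)
        \<le> real (ext_count ShortLex [] (l * ?J)) / g ^ (l * ?J)"
        using gw g(1) by (intro divide_left_mono power_mono mult_pos_pos zero_less_power) auto
      also have "\<dots> \<le> (\<theta> ^ l * real (ext_count Geo [] (l * ?J))) / g ^ (l * ?J)"
        using \<theta>(3) g(1) by (intro divide_right_mono) auto
      finally show ?thesis by simp
    qed
    ultimately have "d \<le> 0 * c" using LIMSEQ_le[OF 1] by blast
    then show False using w(2) by simp
  qed
  then show ?thesis using g w by blast
qed

end

section \<open>Presentations and counting in the group\<close>

lemma word_cong_equiv: "equiv (lists A) (word_cong A R)"
proof (rule equivI)
  show "word_cong A R \<subseteq> lists A \<times> lists A"
  proof (rule subrelI)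
    fix x y assume "(x, y) \<in> word_cong A R"
    then show "(x, y) \<in> lists A \<times> lists A" using word_cong_lists by blast
  qed
  show "refl_on (lists A) (word_cong A R)" by (auto intro: refl_onI word_cong.refl)
  show "sym (word_cong A R)" by (auto intro: symI word_cong.sym)
  show "trans (word_cong A R)" by (auto intro: transI word_cong.trans)
qed

lemma word_cong_class_eq:
  "x \<in> lists A \<Longrightarrow> y \<in> lists A \<Longrightarrow>
    word_cong A R `` {x} = word_cong A R `` {y} \<longleftrightarrow> (x, y) \<in> word_cong A R"
  using eq_equiv_class_iff[OF word_cong_equiv] .

lemma carrier_word_quotient:
  "carrier (word_quotient A R) = (\<lambda>x. word_cong A R `` {x}) ` lists A"
  unfolding word_quotient_def quotient_def by auto

lemma mult_word_quotient:
  assumes "x \<in> lists A" "y \<in> lists A"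
  shows "word_cong A R `` {x} \<otimes>\<^bsub>word_quotient A R\<^esub> word_cong A R `` {y} = word_cong A R `` {x @ y}"
proof -
  let ?c = "\<lambda>x. word_cong A R `` {x}"
  have "(\<Union>u\<in>?c x. \<Union>v\<in>?c y. ?c (u @ v)) = (\<Union>u\<in>?c x. \<Union>v\<in>?c y. ?c (x @ y))"
  proof (rule SUP_cong[OF HOL.refl], rule SUP_cong[OF HOL.refl])
    fix u v assume "u \<in> ?c x" "v \<in> ?c y"
    then have "(x @ y, u @ v) \<in> word_cong A R" by (auto intro: word_cong_append)
    then show "?c (u @ v) = ?c (x @ y)" using equiv_class_eq[OF word_cong_equiv] by metis
  qed
  also have "\<dots> = ?c (x @ y)"
  proof -
    have "x \<in> ?c x" "y \<in> ?c y" using assms by (auto intro: word_cong.refl simp del: in_lists_conv_set)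
    then show ?thesis by blast
  qed
  finally show ?thesis by (simp add: word_quotient_def)
qed

lemma concat_map_lists:
  "(\<And>a. a \<in> A \<Longrightarrow> h a \<in> lists B) \<Longrightarrow> w \<in> lists A \<Longrightarrow> concat (map h w) \<in> lists B"
  by (induction w rule: list.induct) auto

lemma word_cong_hom:
  assumes h: "\<And>a. a \<in> A \<Longrightarrow> h a \<in> lists B"
    and R: "\<And>l r. (l, r) \<in> R \<Longrightarrow> (concat (map h l), concat (map h r)) \<in> word_cong B Q"
    and uv: "(u, v) \<in> word_cong A R"
  shows "(concat (map h u), concat (map h v)) \<in> word_cong B Q"
  using uv
proof (induction rule: word_cong.induct)
  case (base l r u v)
  then have "u \<in> lists A" "v \<in> lists A" by auto
  then have "concat (map h u) \<in> lists B" "concat (map h v) \<in> lists B"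
    using concat_map_lists[of A h B] h by blast+
  then show ?case using word_cong_context[OF R[OF base(1)]] by simp
next
  case (refl w)
  then show ?case using concat_map_lists[of A h B] h by (blast intro: word_cong.refl)
qed (blast intro: word_cong.sym word_cong.trans)+

lemma word_cong_inverse_hom:
  assumes "\<And>a. a \<in> A \<Longrightarrow> (concat (map k (h a)), [a]) \<in> word_cong A R" and "w \<in> lists A"
  shows "(concat (map k (concat (map h w))), w) \<in> word_cong A R"
  using assms(2)
proof (induction w rule: list.induct)
  case Nil
  then show ?case by (simp add: word_cong.refl)
next
  case (Cons a w)
  have "(concat (map k (h a)) @ concat (map k (concat (map h w))), [a] @ w) \<in> word_cong A R"
    by (rule word_cong_append) (use assms(1) Cons in auto)
  then show ?case by simp
qed

text \<open>Letters are translated into words in both directions. It suffices that relations go to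
  congruences and that the round trips fix single letters up to congruence.\<close>

lemma word_quotient_iso:
  assumes h: "\<And>a. a \<in> A \<Longrightarrow> h a \<in> lists B"
    and R: "\<And>l r. (l, r) \<in> R \<Longrightarrow> (concat (map h l), concat (map h r)) \<in> word_cong B Q"
    and k: "\<And>b. b \<in> B \<Longrightarrow> k b \<in> lists A"
    and Q: "\<And>l r. (l, r) \<in> Q \<Longrightarrow> (concat (map k l), concat (map k r)) \<in> word_cong A R"
    and kh: "\<And>a. a \<in> A \<Longrightarrow> (concat (map k (h a)), [a]) \<in> word_cong A R"
    and hk: "\<And>b. b \<in> B \<Longrightarrow> (concat (map h (k b)), [b]) \<in> word_cong B Q"
  shows "word_quotient A R \<cong> word_quotient B Q"
proof -
  let ?H = "\<lambda>w. concat (map h w)" and ?K = "\<lambda>w. concat (map k w)"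
  let ?a = "\<lambda>x. word_cong A R `` {x}" and ?b = "\<lambda>x. word_cong B Q `` {x}"
  \<comment> \<open>Saturating the image of a whole class avoids the choice of a
    representative.\<close>
  define F where "F X = word_cong B Q `` (?H ` X)" for X
  define E where "E X = word_cong A R `` (?K ` X)" for X
  have Hl: "?H w \<in> lists B" if "w \<in> lists A" for w
    using concat_map_lists[of A h B] h that by blast
  have Kl: "?K w \<in> lists A" if "w \<in> lists B" for w
    using concat_map_lists[of B k A] k that by blast
  have F: "F (?a x) = ?b (?H x)" if x: "x \<in> lists A" for x
  proof -
    have "?b (?H y) = ?b (?H x)" if "(x, y) \<in> word_cong A R" for y
    proof -
      have "(?H x, ?H y) \<in> word_cong B Q" by (rule word_cong_hom[OF _ _ that]) (fact h R)+
      then show ?thesis using equiv_class_eq[OF word_cong_equiv] by metis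
    qed
    moreover have "x \<in> ?a x" using word_cong.refl[OF x] by simp
    ultimately have "(\<Union>y\<in>?a x. ?b (?H y)) = ?b (?H x)" by blast
    moreover have "F (?a x) = (\<Union>y\<in>?a x. ?b (?H y))" unfolding F_def by blast
    ultimately show ?thesis by simp
  qed
  have E: "E (?b x) = ?a (?K x)" if x: "x \<in> lists B" for x
  proof -
    have "?a (?K y) = ?a (?K x)" if "(x, y) \<in> word_cong B Q" for y
    proof -
      have "(?K x, ?K y) \<in> word_cong A R" by (rule word_cong_hom[OF _ _ that]) (fact k Q)+
      then show ?thesis using equiv_class_eq[OF word_cong_equiv] by metis
    qed
    moreover have "x \<in> ?b x" using word_cong.refl[OF x] by simp
    ultimately have "(\<Union>y\<in>?b x. ?a (?K y)) = ?a (?K x)" by blast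
    moreover have "E (?b x) = (\<Union>y\<in>?b x. ?a (?K y))" unfolding E_def by blast
    ultimately show ?thesis by simp
  qed
  have "F \<in> hom (word_quotient A R) (word_quotient B Q)"
  proof (rule homI)
    fix X assume "X \<in> carrier (word_quotient A R)"
    then show "F X \<in> carrier (word_quotient B Q)"
      unfolding carrier_word_quotient using F Hl by blast
  next
    fix X Y assume "X \<in> carrier (word_quotient A R)" "Y \<in> carrier (word_quotient A R)"
    then obtain x y where xy: "X = ?a x" "Y = ?a y" "x \<in> lists A" "y \<in> lists A"
      unfolding carrier_word_quotient by blast
    have "x @ y \<in> lists A" using xy by simp
    then show "F (X \<otimes>\<^bsub>word_quotient A R\<^esub> Y) = F X \<otimes>\<^bsub>word_quotient B Q\<^esub> F Y"
      using xy Hl by (simp only: F mult_word_quotient map_append concat_append)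
  qed
  moreover have "bij_betw F (carrier (word_quotient A R)) (carrier (word_quotient B Q))"
  proof (rule bij_betw_byWitness[where f' = E])
    show "\<forall>X\<in>carrier (word_quotient A R). E (F X) = X"
    proof
      fix X assume "X \<in> carrier (word_quotient A R)"
      then obtain x where x: "X = ?a x" "x \<in> lists A" unfolding carrier_word_quotient by blast
      have "(?K (?H x), x) \<in> word_cong A R" by (rule word_cong_inverse_hom[OF _ x(2)]) (rule kh)
      from equiv_class_eq[OF word_cong_equiv this]
      show "E (F X) = X" by (simp only: x F E Hl)
    qed
    show "\<forall>Y\<in>carrier (word_quotient B Q). F (E Y) = Y"
    proof
      fix Y assume "Y \<in> carrier (word_quotient B Q)"
      then obtain y where y: "Y = ?b y" "y \<in> lists B" unfolding carrier_word_quotient by blast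
      have "(?H (?K y), y) \<in> word_cong B Q" by (rule word_cong_inverse_hom[OF _ y(2)]) (rule hk)
      from equiv_class_eq[OF word_cong_equiv this]
      show "F (E Y) = Y" by (simp only: y F E Kl)
    qed
    show "F ` carrier (word_quotient A R) \<subseteq> carrier (word_quotient B Q)"
      unfolding carrier_word_quotient using F Hl by blast
    show "E ` carrier (word_quotient B Q) \<subseteq> carrier (word_quotient A R)"
      unfolding carrier_word_quotient using E Kl by blast
  qed
  ultimately show ?thesis unfolding is_iso_def iso_def by blast
qed

context coxeter
begin

section \<open>From signed letters to elements of the Coxeter group\<close>

definition letters :: "(nat \<times> bool) set" where "letters = gens \<times> UNIV"

definition prels :: "((nat \<times> bool) list \<times> (nat \<times> bool) list) set" where
  "prels = {([(x, b), (x, \<not> b)], []) | x b. x \<in> gens} \<union> {(q, []) | q. q \<in> coxeter_relators n m}"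

lemma coxeter_group_eq: "coxeter_group n m = word_quotient letters prels"
  unfolding coxeter_group_def group_presentation_def letters_def prels_def gens_def ..

abbreviation geqv :: "(nat \<times> bool) list \<Rightarrow> (nat \<times> bool) list \<Rightarrow> bool" where
  "geqv u v \<equiv> (u, v) \<in> word_cong letters prels"

definition lift :: "nat list \<Rightarrow> (nat \<times> bool) list" where
  "lift w = map (\<lambda>i. (i, True)) w"

lemma lift_simps [simp]: "lift [] = []" "lift (i # w) = (i, True) # lift w"
  "lift (u @ w) = lift u @ lift w" "map fst (lift w) = w"
  by (simp_all add: lift_def comp_def)

lemma lift_lists: "lift w \<in> lists letters \<longleftrightarrow> w \<in> lists gens"
  by (auto simp: lift_def letters_def)

lemma map_fst_lists: "x \<in> lists letters \<Longrightarrow> map fst x \<in> lists gens"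
  by (induction x rule: list.induct) (auto simp: letters_def)

lemma geqv_relator: "q \<in> coxeter_relators n m \<Longrightarrow> q \<in> lists letters \<Longrightarrow> geqv q []"
  using word_cong.base[of q "[]" prels "[]" "[]" letters] unfolding prels_def by auto

lemma geqv_square: "i \<in> gens \<Longrightarrow> geqv [(i, True), (i, True)] []"
  by (rule geqv_relator) (auto simp: coxeter_relators_def letters_def gens_def)

text \<open>The word \<open>i\<close>, \<open>i\<close>, inverse of \<open>i\<close> cancels in two
  ways, to \<open>i\<close> and to its formal inverse.\<close>

lemma geqv_letter:
  assumes "i \<in> gens"
  shows "geqv [(i, True)] [(i, b)]"
proof (cases b)
  case True
  then show ?thesis using assms by (auto intro!: word_cong.refl simp: letters_def)
next
  case False
  have "geqv ([(i, True)] @ [(i, True), (i, False)] @ []) ([(i, True)] @ [] @ [])"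
    by (rule word_cong.base) (use assms in \<open>auto simp: prels_def letters_def\<close>)
  then have 1: "geqv [(i, True), (i, True), (i, False)] [(i, True)]" by simp
  have "geqv ([(i, True), (i, True)] @ [(i, False)]) ([] @ [(i, False)])"
    by (rule word_cong_append[OF geqv_square[OF assms] word_cong.refl])
      (use assms in \<open>auto simp: letters_def\<close>)
  then have 2: "geqv [(i, True), (i, True), (i, False)] [(i, False)]" by simp
  show ?thesis using word_cong.trans[OF word_cong.sym[OF 1] 2] False by simp
qed

lemma geqv_lift: "x \<in> lists letters \<Longrightarrow> geqv (lift (map fst x)) x"
proof (induction x rule: list.induct)
  case Nil
  then show ?case by (simp add: word_cong.refl)
next
  case (Cons a x)
  have "geqv ([(fst a, True)] @ lift (map fst x)) ([(fst a, snd a)] @ x)"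
    by (rule word_cong_append[OF geqv_letter]) (use Cons in \<open>auto simp: letters_def\<close>)
  then show ?case by simp
qed

lemma concat_map_fst: "concat (map (\<lambda>a. [fst a]) x) = map fst x"
  by (induction x) auto

lemma concat_map_lift: "concat (map (\<lambda>i. [(i, True)]) w) = lift w"
  by (induction w) auto

lemma lift_double: "lift (concat (replicate k [i, j])) = concat (replicate k [(i, True), (j, True)])"
  by (induction k) auto

text \<open>Forgetting signs and lifting to positive letters both respect the relations, and the
  second undoes the first up to congruence because the generators are involutions.\<close>

lemma geqv_iff:
  assumes "x \<in> lists letters" "y \<in> lists letters"
  shows "geqv x y \<longleftrightarrow> eqv (map fst x) (map fst y)"
proof
  assume "geqv x y"
  then have "eqv (concat (map (\<lambda>a. [fst a]) x)) (concat (map (\<lambda>a. [fst a]) y))"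
  proof (rule word_cong_hom[rotated 2])
    fix a assume "a \<in> letters"
    then show "[fst a] \<in> lists gens" by (auto simp: letters_def)
  next
    fix l r assume "(l, r) \<in> prels"
    then consider i b where "i \<in> gens" "(l, r) = ([(i, b), (i, \<not> b)], [])"
      | i where "i \<in> gens" "(l, r) = ([(i, True), (i, True)], [])"
      | i j k where "1 \<le> i" "i < j" "j \<le> n" "m i j = enat k"
          "(l, r) = (concat (replicate k [(i, True), (j, True)]), [])"
      unfolding prels_def coxeter_relators_def gens_def by blast
    then have "(map fst l, map fst r) \<in> relations \<and> map fst l \<in> lists gens \<and> r = []"
    proof cases
      case 3
      have "map fst l = concat (replicate k [i, j])" using 3(5) lift_double[of k i j]
        by (metis lift_simps(4) prod.inject)
      moreover have "concat (replicate k [i, j]) \<in> lists gens"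
        unfolding alt_double by (rule alt_lists) (use 3 in \<open>auto simp: gens_def\<close>)
      ultimately show ?thesis using 3 unfolding relations_def by auto
    qed (auto simp: relations_def)
    then have "eqv ([] @ map fst l @ []) ([] @ map fst r @ [])"
      by (intro word_cong.base) auto
    then show "eqv (concat (map (\<lambda>a. [fst a]) l)) (concat (map (\<lambda>a. [fst a]) r))"
      by (simp add: concat_map_fst)
  qed
  then show "eqv (map fst x) (map fst y)" by (simp add: concat_map_fst)
next
  assume "eqv (map fst x) (map fst y)"
  then have "geqv (concat (map (\<lambda>i. [(i, True)]) (map fst x))) (concat (map (\<lambda>i. [(i, True)]) (map fst y)))"
  proof (rule word_cong_hom[rotated 2])
    fix i assume "i \<in> gens"
    then show "[(i, True)] \<in> lists letters" by (auto simp: letters_def)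
  next
    fix l r assume "(l, r) \<in> relations"
    then consider i where "i \<in> gens" "(l, r) = ([i, i], [])"
      | i j k where "1 \<le> i" "i < j" "j \<le> n" "m i j = enat k"
          "(l, r) = (concat (replicate k [i, j]), [])"
      unfolding relations_def by blast
    then have "lift l \<in> coxeter_relators n m \<and> lift l \<in> lists letters \<and> r = []"
    proof cases
      case 1
      then show ?thesis by (auto simp: coxeter_relators_def letters_def gens_def)
    next
      case 2
      have "concat (replicate k [i, j]) \<in> lists gens"
        unfolding alt_double by (rule alt_lists) (use 2 in \<open>auto simp: gens_def\<close>)
      then have "lift l \<in> lists letters" using 2(5) lift_lists by simp
      moreover have "lift l \<in> coxeter_relators n m"
        using 2 lift_double[of k i j] unfolding coxeter_relators_def by auto
      ultimately show ?thesis using 2(5) by simp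
    qed
    then show "geqv (concat (map (\<lambda>i. [(i, True)]) l)) (concat (map (\<lambda>i. [(i, True)]) r))"
      using geqv_relator by (simp only: concat_map_lift lift_simps)
  qed
  then have "geqv (lift (map fst x)) (lift (map fst y))" by (simp only: concat_map_lift)
  then show "geqv x y"
    using geqv_lift assms word_cong.trans word_cong.sym by meson
qed

abbreviation cls :: "(nat \<times> bool) list \<Rightarrow> (nat \<times> bool) list set" where
  "cls x \<equiv> word_cong letters prels `` {x}"

definition gen :: "nat \<Rightarrow> (nat \<times> bool) list set" where
  "gen i = cls [(i, True)]"

lemma cls_eq_iff:
  "x \<in> lists letters \<Longrightarrow> y \<in> lists letters \<Longrightarrow> cls x = cls y \<longleftrightarrow> eqv (map fst x) (map fst y)"
  using word_cong_class_eq geqv_iff by metis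

lemma cls_lift_eq_iff:
  "u \<in> lists gens \<Longrightarrow> w \<in> lists gens \<Longrightarrow> cls (lift u) = cls (lift w) \<longleftrightarrow> eqv u w"
  using cls_eq_iff[of "lift u" "lift w"] lift_lists by simp

lemma coxeter_generators_eq: "coxeter_generators n m = gen ` gens"
proof -
  have "X \<in> gen ` gens"
    if X: "X \<in> carrier (coxeter_group n m)" and i: "i \<in> {1..n}" "[(i, True)] \<in> X" for X i
  proof -
    obtain x where x: "X = cls x" using X unfolding coxeter_group_eq carrier_word_quotient by blast
    then have "X = gen i" unfolding gen_def
      using i(2) equiv_class_eq[OF word_cong_equiv] by (metis Image_singleton_iff)
    then show ?thesis using i(1) by (simp add: gens_def)
  qed
  moreover have "gen i \<in> carrier (coxeter_group n m) \<and> [(i, True)] \<in> gen i" if "i \<in> gens" for i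
  proof -
    have "[(i, True)] \<in> lists letters" using that by (simp add: letters_def)
    then show ?thesis unfolding gen_def coxeter_group_eq carrier_word_quotient
      by (auto intro: word_cong.refl simp del: in_lists_conv_set)
  qed
  ultimately show ?thesis unfolding coxeter_generators_def gens_def by blast
qed

lemma gen_inj: "inj_on gen gens"
proof (rule inj_onI)
  fix i j assume "i \<in> gens" "j \<in> gens" "gen i = gen j"
  then have "eqv [i] [j]" using cls_lift_eq_iff[of "[i]" "[j]"] by (simp add: gen_def)
  then show "i = j" using ShortLex_unique[of "[i]" "[j]"] Lang_single \<open>i \<in> gens\<close> \<open>j \<in> gens\<close> by simp
qed

section \<open>The counting functions of the group as counts of words\<close>

lemma word_value_gen:
  "w \<in> lists gens \<Longrightarrow> word_value (coxeter_group n m) (map gen w) = cls (lift w)"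
proof (induction w rule: list.induct)
  case Nil
  then show ?case by (simp add: word_value_def coxeter_group_eq word_quotient_def)
next
  case (Cons i w)
  have i: "[(i, True)] \<in> lists letters" and w: "lift w \<in> lists letters" "w \<in> lists gens"
    using Cons.prems lift_lists[of w] by (auto simp: letters_def)
  have "word_value (coxeter_group n m) (map gen (i # w))
    = gen i \<otimes>\<^bsub>coxeter_group n m\<^esub> cls (lift w)"
    using Cons.IH[OF w(2)] by (simp add: word_value_def)
  also have "\<dots> = cls ([(i, True)] @ lift w)"
    unfolding gen_def coxeter_group_eq by (rule mult_word_quotient[OF i w(1)])
  finally show ?case by simp
qed

lemma word_length_cls:
  assumes x: "x \<in> lists letters" and v: "reduced v" "eqv (map fst x) v"
  shows "word_length (coxeter_group n m) (coxeter_generators n m) (cls x) = length v"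
  unfolding word_length_def
proof (rule Least_equality)
  have vl: "v \<in> lists gens" using reduced_lists[OF v(1)] .
  have "cls (lift v) = cls x"
    using cls_eq_iff[of "lift v" x] lift_lists[of v] x vl word_cong.sym[OF v(2)] by simp
  then have "word_value (coxeter_group n m) (map gen v) = cls x" using word_value_gen[OF vl] by simp
  moreover have "map gen v \<in> lists (coxeter_generators n m)"
    unfolding coxeter_generators_eq using vl by auto
  ultimately show "\<exists>ws\<in>lists (coxeter_generators n m).
      length ws = length v \<and> word_value (coxeter_group n m) ws = cls x"
    by (metis length_map)
next
  fix k assume "\<exists>ws\<in>lists (coxeter_generators n m).
      length ws = k \<and> word_value (coxeter_group n m) ws = cls x"
  then obtain w where w: "w \<in> lists gens" "length w = k" "cls (lift w) = cls x"
    unfolding coxeter_generators_eq lists_image using word_value_gen by fastforce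
  then have "eqv w (map fst x)" using cls_eq_iff[of "lift w" x] lift_lists[of w] x by simp
  then have "eqv v w" using v(2) word_cong.trans word_cong.sym by meson
  then show "length v \<le> k" using v(1) w(2) unfolding reduced_def by blast
qed

lemma word_length_lift_iff:
  assumes w: "w \<in> lists gens"
  shows "word_length (coxeter_group n m) (coxeter_generators n m) (cls (lift w)) = length w \<longleftrightarrow> reduced w"
proof -
  obtain v where v: "eqv w v" "reduced v" using ex_reduced[OF w] by blast
  have l: "word_length (coxeter_group n m) (coxeter_generators n m) (cls (lift w)) = length v"
    by (rule word_length_cls) (use w v lift_lists in auto)
  show ?thesis unfolding l
    using reduced_eqv[OF v(2) word_cong.sym[OF v(1)]] eqv_reduced_length[OF _ v(2) v(1)] by auto
qed

lemma geodesic_count_eq: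
  "geodesic_count (coxeter_group n m) (coxeter_generators n m) k = ext_count (Lang (\<lambda>_ _. False)) [] k"
proof -
  let ?L = "word_length (coxeter_group n m) (coxeter_generators n m)"
  have "{ws \<in> lists (coxeter_generators n m). length ws = k \<and>
      ?L (word_value (coxeter_group n m) ws) = k} = map gen ` {w. length w = k \<and> reduced w}"
  proof (intro equalityI subsetI)
    fix ws assume "ws \<in> {ws \<in> lists (coxeter_generators n m). length ws = k \<and>
      ?L (word_value (coxeter_group n m) ws) = k}"
    then obtain w where "ws = map gen w" "w \<in> lists gens" "length w = k" "?L (cls (lift w)) = k"
      unfolding coxeter_generators_eq lists_image using word_value_gen by fastforce
    then show "ws \<in> map gen ` {w. length w = k \<and> reduced w}"
      using word_length_lift_iff by auto
  next
    fix ws assume "ws \<in> map gen ` {w. length w = k \<and> reduced w}"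
    then obtain w where w: "ws = map gen w" "length w = k" "reduced w" by blast
    have "?L (cls (lift w)) = k" "w \<in> lists gens"
      using word_length_lift_iff[OF reduced_lists[OF w(3)]] w reduced_lists by auto
    moreover from this have "ws \<in> lists (coxeter_generators n m)"
      unfolding coxeter_generators_eq w(1) by auto
    ultimately show "ws \<in> {ws \<in> lists (coxeter_generators n m). length ws = k \<and>
      ?L (word_value (coxeter_group n m) ws) = k}"
      using w word_value_gen by simp
  qed
  moreover have "inj_on (map gen) {w. length w = k \<and> reduced w}"
    using inj_on_map_lists[OF gen_inj] reduced_lists by (auto elim!: inj_on_subset)
  ultimately show ?thesis
    unfolding geodesic_count_def ext_count_def
    by (simp add: card_image Lang_def violation_def)
qed

lemma word_count_eq:
  "word_count (coxeter_group n m) (coxeter_generators n m) k = ext_count (Lang (<)) [] k"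
proof -
  let ?L = "word_length (coxeter_group n m) (coxeter_generators n m)"
  let ?X = "{w. length w = k \<and> w \<in> Lang (<)}"
  have "{g \<in> carrier (coxeter_group n m). ?L g = k} = (\<lambda>w. cls (lift w)) ` ?X"
  proof (intro equalityI subsetI)
    fix g assume g: "g \<in> {g \<in> carrier (coxeter_group n m). ?L g = k}"
    then obtain x where x: "g = cls x" "x \<in> lists letters"
      unfolding coxeter_group_eq carrier_word_quotient by blast
    have "map fst x \<in> lists gens" using map_fst_lists[OF x(2)] .
    then obtain v where v: "v \<in> Lang (<)" "eqv (map fst x) v" using ShortLex_exists by blast
    have "length v = k" using word_length_cls[OF x(2) Lang_reduced[OF v(1)] v(2)] g x(1) by simp
    moreover have "g = cls (lift v)"
      using cls_eq_iff[of x "lift v"] x v lift_lists[of v] eqv_lists[OF v(2)] by simp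
    ultimately show "g \<in> (\<lambda>w. cls (lift w)) ` ?X" using v(1) by blast
  next
    fix g assume "g \<in> (\<lambda>w. cls (lift w)) ` ?X"
    then obtain w where w: "g = cls (lift w)" "length w = k" "w \<in> Lang (<)" by blast
    have wl: "w \<in> lists gens" using reduced_lists[OF Lang_reduced[OF w(3)]] .
    have "?L g = k" using word_length_lift_iff[OF wl] w Lang_reduced by auto
    moreover have "g \<in> carrier (coxeter_group n m)"
      unfolding coxeter_group_eq carrier_word_quotient w(1) using wl lift_lists by blast
    ultimately show "g \<in> {g \<in> carrier (coxeter_group n m). ?L g = k}" by simp
  qed
  moreover have "inj_on (\<lambda>w. cls (lift w)) ?X"
  proof (rule inj_onI)
    fix u w assume uw: "u \<in> ?X" "w \<in> ?X" "cls (lift u) = cls (lift w)"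
    then have "eqv u w"
      using cls_lift_eq_iff[OF reduced_lists reduced_lists] Lang_reduced by blast
    then show "u = w" using ShortLex_unique uw by blast
  qed
  ultimately show ?thesis
    unfolding word_count_def ext_count_def by (simp add: card_image)
qed

text \<open>Used in contrapositive form to obtain a finite label. The residue 1 corresponds to the
  generator and the residue 0 to the empty word.\<close>

lemma free_product_case:
  assumes inf: "\<And>i j. i \<in> gens \<Longrightarrow> j \<in> gens \<Longrightarrow> i < j \<Longrightarrow> m i j = \<infinity>"
  shows "coxeter_group n m \<cong> free_product {1..n} (\<lambda>_. integer_mod_group 2)"
proof -
  let ?Z = "integer_mod_group 2"
  let ?B = "SIGMA i:gens. carrier ?Z"
  let ?Q = "{([(i, \<one>\<^bsub>?Z\<^esub>)], []) | i. i \<in> gens} \<union>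
     {([(i, x), (i, y)], [(i, x \<otimes>\<^bsub>?Z\<^esub> y)]) | i x y. i \<in> gens \<and> x \<in> carrier ?Z \<and> y \<in> carrier ?Z}"
  let ?h = "\<lambda>(i, b :: bool). [(i, 1 :: int)]"
  let ?k = "\<lambda>(i, z :: int). if z = 0 then [] else [(i, True)]"
  have car: "carrier ?Z = {0, 1}" by (auto simp: carrier_integer_mod_group)
  have one: "\<one>\<^bsub>?Z\<^esub> = 0" and mult: "x \<otimes>\<^bsub>?Z\<^esub> y = (x + y) mod 2" for x y
    by (simp_all add: one_integer_mod_group mult_integer_mod_group)
  have Q1: "([(i, 0)], []) \<in> word_cong ?B ?Q" if "i \<in> gens" for i
    using word_cong.base[of "[(i, 0)]" "[]" ?Q "[]" "[]" ?B] that by (auto simp: car one)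
  have Q2: "([(i, 1), (i, 1)], []) \<in> word_cong ?B ?Q" if "i \<in> gens" for i
  proof -
    have "([] @ [(i, 1), (i, 1)] @ [], [] @ [(i, 0)] @ []) \<in> word_cong ?B ?Q"
    proof (rule word_cong.base)
      have "([(i, 1), (i, 1)], [(i, 1 \<otimes>\<^bsub>?Z\<^esub> 1)]) \<in> ?Q" using that car by blast
      then show "([(i, 1), (i, 1)], [(i, 0)]) \<in> ?Q" unfolding mult by simp
    qed (use that car in auto)
    then show ?thesis using word_cong.trans[OF _ Q1[OF that]] by simp
  qed
  have "word_quotient letters prels \<cong> word_quotient ?B ?Q"
  proof (rule word_quotient_iso[where h = ?h and k = ?k])
    fix l r assume "(l, r) \<in> prels"
    \<comment> \<open>Without finite labels only the inverse pairs and the squares remain, and all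
      of them are two letters of one generator.\<close>
    then have "\<exists>i b c. i \<in> gens \<and> l = [(i, b), (i, c)] \<and> r = []"
      unfolding prels_def coxeter_relators_def using inf by (fastforce simp: gens_def)
    then show "(concat (map ?h l), concat (map ?h r)) \<in> word_cong ?B ?Q"
      using Q2 by auto
  next
    fix l r assume "(l, r) \<in> ?Q"
    then consider i where "i \<in> gens" "l = [(i, 0)]" "r = []"
      | i x y where "i \<in> gens" "x \<in> {0, 1}" "y \<in> {0, 1}" "l = [(i, x), (i, y)]" "r = [(i, (x + y) mod 2)]"
      unfolding car one mult by blast
    then show "geqv (concat (map ?k l)) (concat (map ?k r))"
    proof cases
      case 1
      then show ?thesis by (simp add: word_cong.refl)
    next
      case 2
      have "geqv [(i, True)] [(i, True)]" using 2(1) by (intro word_cong.refl) (simp add: letters_def)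
      then show ?thesis using 2 geqv_square[OF 2(1)] by (auto simp: word_cong.refl)
    qed
  next
    fix a assume "a \<in> letters"
    then obtain i b where a: "a = (i, b)" "i \<in> gens" by (auto simp: letters_def)
    then show "geqv (concat (map ?k (?h a))) [a]" using geqv_letter[of i b] by simp
  next
    fix b assume "b \<in> ?B"
    then obtain i z where b: "b = (i, z)" "i \<in> gens" "z \<in> {0, 1}" using car by auto
    then have "([(i, 1)], [(i, 1)]) \<in> word_cong ?B ?Q"
      by (intro word_cong.refl) (simp add: car)
    then show "(concat (map ?h (?k b)), [b]) \<in> word_cong ?B ?Q"
      using b word_cong.sym[OF Q1[OF b(2)]] by auto
  qed (auto simp: letters_def car)
  then show ?thesis unfolding coxeter_group_eq free_product_def gens_def .
qed

end

section \<open>Growth rates and the final quotient\<close>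

lemma root_eq_exp: "0 < k \<Longrightarrow> 0 < x \<Longrightarrow> root k x = exp (ln x * inverse (real k))"
  by (simp add: root_powr_inverse powr_def divide_inverse mult.commute)

text \<open>The normalized counts have a positive limit, so their logarithms divided by
  \<open>k\<close> tend to 0 and their roots to 1; the superior limit is a genuine limit.\<close>

lemma growth_rate_eqI:
  assumes \<rho>: "\<rho> \<ge> 1" and c: "c > 0" and lim: "(\<lambda>k. real (a k) / \<rho> ^ k) \<longlonglongrightarrow> c"
  shows "growth_rate a = \<rho>"
proof -
  let ?x = "\<lambda>k. real (a k) / \<rho> ^ k"
  have "\<forall>\<^sub>F k in sequentially. ?x k > 0" using lim c by (rule order_tendstoD)
  then have ev: "\<forall>\<^sub>F k in sequentially. exp (ln (?x k) * inverse (real k)) * \<rho> = root k (real (a k))"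
    using eventually_gt_at_top[of 0]
  proof eventually_elim
    case (elim k)
    have ak: "real (a k) = ?x k * \<rho> ^ k" using \<rho> by simp
    have "root k (real (a k)) = root k (?x k) * root k (\<rho> ^ k)"
      by (subst ak) (rule real_root_mult)
    also have "root k (\<rho> ^ k) = \<rho>" using \<rho> elim by (simp add: real_root_power_cancel)
    also have "root k (?x k) = exp (ln (?x k) * inverse (real k))"
      using elim by (intro root_eq_exp) auto
    finally show ?case by simp
  qed
  have "(\<lambda>k. exp (ln (?x k) * inverse (real k)) * \<rho>) \<longlonglongrightarrow> exp (ln c * 0) * \<rho>"
    by (intro tendsto_intros lim lim_inverse_n) (use c in auto)
  then have "(\<lambda>k. root k (real (a k))) \<longlonglongrightarrow> \<rho>"
    using Lim_transform_eventually[OF _ ev] by fastforce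
  then have "limsup (\<lambda>k. ereal (root k (real (a k)))) = ereal \<rho>"
    by (intro lim_imp_Limsup) auto
  then show ?thesis unfolding growth_rate_def by simp
qed

theorem theorem1p2:
  fixes n :: nat and m :: "nat \<Rightarrow> nat \<Rightarrow> enat"
    and G :: "(nat \<times> bool) list set monoid" and S :: "(nat \<times> bool) list set set"
    and \<delta> :: real
  assumes "coxeter_matrix n m"
    and "G = coxeter_group n m"
    and "S = coxeter_generators n m"
    and "infinity_spanned n m"
    and "\<not> (\<exists>k::nat. G \<cong> free_product {1..k} (\<lambda>_. integer_mod_group 2))"
    and "\<delta> = geodesic_growth_rate G S / word_growth_rate G S"
  shows "(\<exists>\<nu>::real. \<nu> > 0 \<and>
            (\<lambda>k. real (geodesic_count G S k) / real (word_count G S k))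
              \<sim>[sequentially] (\<lambda>k. \<nu> * \<delta> ^ k)) \<and>
         \<delta> > 1 \<and>
         geodesic_growth_rate G S > word_growth_rate G S"
proof -
  interpret coxeter n m by unfold_locales (rule assms(1))
  obtain T where n: "n > 2" and T: "is_tree {1..n} T" "\<forall>i j. {i, j} \<in> T \<longrightarrow> m i j = \<infinity>"
    using assms(4) unfolding infinity_spanned_def by blast
  have "{(x, y). {x, y} \<in> T} \<subseteq> {(x, y). inf_adj x y}"
  proof clarify
    fix x y assume xy: "{x, y} \<in> T"
    then have "{x, y} \<subseteq> {1..n}" "card {x, y} = 2" using T(1) unfolding is_tree_def by blast+
    moreover from this have "x \<noteq> y" by auto
    ultimately show "inf_adj x y" using T(2) xy unfolding inf_adj_def gens_def by auto
  qed
  note mono = rtrancl_mono[OF this]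
  interpret spanned_coxeter n m
  proof unfold_locales
    fix s t assume "s \<in> gens" "t \<in> gens"
    then have "(s, t) \<in> {(x, y). {x, y} \<in> T}\<^sup>*"
      using T(1) unfolding is_tree_def gens_def by blast
    then show "(s, t) \<in> {(x, y). inf_adj x y}\<^sup>*" using mono by blast
  qed (rule n)
  \<comment> \<open>If all labels were infinite, \<open>G\<close> would be the free product of
    \<open>n\<close> copies of the group of order two.\<close>
  obtain i j where ij: "i \<in> gens" "j \<in> gens" "i < j" "m i j \<noteq> \<infinity>"
    using free_product_case assms(2,5) by blast
  obtain g c w d where *: "1 \<le> w" "w < g" "0 < c" "0 < d"
    and g: "(\<lambda>k. real (geodesic_count G S k) / g ^ k) \<longlonglongrightarrow> c"
    and w: "(\<lambda>k. real (word_count G S k) / w ^ k) \<longlonglongrightarrow> d"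
    using count_asymptotics[OF ij] unfolding assms(2,3) geodesic_count_eq word_count_eq by blast
  have gg: "geodesic_growth_rate G S = g"
    unfolding geodesic_growth_rate_def by (rule growth_rate_eqI[OF _ *(3) g]) (use * in simp)
  have ww: "word_growth_rate G S = w"
    unfolding word_growth_rate_def by (rule growth_rate_eqI[OF *(1,4) w])
  have \<delta>: "\<delta> = g / w" using assms(6) gg ww by simp
  have "(\<lambda>k. real (geodesic_count G S k) / real (word_count G S k))
    \<sim>[sequentially] (\<lambda>k. c / d * \<delta> ^ k)"
  proof (rule asymp_equivI')
    have "(\<lambda>k. (real (geodesic_count G S k) / g ^ k) / (real (word_count G S k) / w ^ k) / (c / d))
      \<longlonglongrightarrow> c / d / (c / d)"
      by (intro tendsto_intros g w) (use * in auto)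
    moreover have "(real (geodesic_count G S k) / g ^ k) / (real (word_count G S k) / w ^ k) / (c / d)
      = real (geodesic_count G S k) / real (word_count G S k) / (c / d * \<delta> ^ k)" for k
      unfolding \<delta> power_divide by (simp add: divide_inverse mult_ac)
    ultimately show "(\<lambda>k. real (geodesic_count G S k) / real (word_count G S k) / (c / d * \<delta> ^ k))
      \<longlonglongrightarrow> 1"
      using * by simp
  qed
  moreover have "c / d > 0" "\<delta> > 1" using * \<delta> by auto
  ultimately show ?thesis using * gg ww by blast
qed

end
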